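(* Let $\{\mathcal T_h\}_{h\in(0,h_0)}$ be conforming triangulations of $\Omega$, let $\alpha\in[0,1]$, and assume that for all $u\in H^2(\Omega)$ and all $h\in(0,h_0)$ the discrete solution $U$ satisfies $|u-U|_{H^1(\Omega)}\le C(u)h^\alpha$ with $C(u)$ independent of $h$. Let $C_K,C_\alpha>0$ be given, and let $C_L>0$ be sufficiently large with respect to the constant $C(u)$ for $u(x_1,x_2)=x_1^2+x_2^2$. Then there is a constant $C>0$, independent of $h$ and of the band, such that every band $\mathcal B=(\bigcup_{i=0}^N K_i)\cup(\bigcup_{i=1}^N\tilde K_i)\subset\mathcal T_h$, $h\in(0,h_0)$, satisfying $L\ge C_Lh^{2\alpha/5}$ and, for all $i=1,\dots,N$, $$|\tilde K_i|\le C_K|K_i|,\qquad |\tilde K_i|\le C_K|K_{i-1}|,\qquad \sin(\pi-\alpha_{i-1})\le C_\alpha\sin(\pi-\tilde\alpha_i),$$ must satisfy $$\min_{i=1,\dots,N}\frac{1}{\sin(\pi-\tilde\alpha_i)}\ \min_{i=1,\dots,N}|\tilde K_i|^{1/2}\,L\,N^{-1/2}\le Ch^\alpha.$$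
   Context: $\Omega\subset\mathbb R^2$ is a bounded polygonal domain with Lipschitz boundary; $h$ is the maximal diameter of elements of $\mathcal T_h$; $X_h\subset H^1(\Omega)$ is the space of globally continuous functions that are linear on every $K\in\mathcal T_h$. The discrete solution $U\in X_h$ associated with $u$ is the piecewise linear conforming finite element solution of Poisson's problem with exact solution $u$, with Dirichlet data imposed by piecewise linear Lagrange interpolation of $u$ on $\partial\Omega$. $|K|$ is the area of $K$. Band: for $N\ge1$, a band $\mathcal B\subset\mathcal T_h$ is a union of distinct elements $K_0,\dots,K_N,\tilde K_1,\dots,\tilde K_N$ of $\mathcal T_h$ of the following form. There are consecutive points $P_0,\dots,P_{N+1}$ on a straight line and points $Q_0,\dots,Q_N$ on one side of it such that $K_i$ is the triangle $P_iP_{i+1}Q_i$, whose longest edge is $P_iP_{i+1}$ (so its maximum angle is at $Q_i$), and $\tilde K_i$ is the triangle $Q_{i-1}Q_iP_i$, whose maximum angle is at $P_i$. $\alpha_i,\tilde\alpha_i$ denote the maximum angles of $K_i,\tilde K_i$; $\Gamma=\bigcup_{i=0}^N P_iP_{i+1}$ and $L$ is the length of $\Gamma$. "$C_L$ sufficiently large with respect to $C(u)$" means: larger than a threshold that depends only on $\Omega$, $h_0$, $\alpha$ and the constant $C(u)$ of the error estimate for $u=x_1^2+x_2^2$. *)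

theory Defs
  imports "HOL-Analysis.Analysis"
begin

type_synonym point = "real^2"

definition lipschitz_boundary :: "point set \<Rightarrow> bool" where
  "lipschitz_boundary \<Omega> \<longleftrightarrow>
     (\<forall>z \<in> frontier \<Omega>. \<exists>r > 0. \<exists>e n g l.
        norm e = 1 \<and> norm n = 1 \<and> e \<bullet> n = 0 \<and>
        l-lipschitz_on (UNIV :: real set) (g :: real \<Rightarrow> real) \<and>
        \<Omega> \<inter> ball z r = {x \<in> ball z r. x \<bullet> n < g (x \<bullet> e)})"

definition polygonal_lipschitz_domain :: "point set \<Rightarrow> bool" where
  "polygonal_lipschitz_domain \<Omega> \<longleftrightarrow>
     \<Omega> \<noteq> {} \<and> open \<Omega> \<and> connected \<Omega> \<and> bounded \<Omega> \<and>
     (\<exists>S :: (point \<times> point) set. finite S \<and> frontier \<Omega> = (\<Union>(a, b) \<in> S. closed_segment a b)) \<and>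
     lipschitz_boundary \<Omega>"

definition conforming_triangulation :: "point set \<Rightarrow> point set set \<Rightarrow> bool" where
  "conforming_triangulation \<Omega> \<T> \<longleftrightarrow>
     triangulation \<T> \<and> (\<forall>K \<in> \<T>. 2 simplex K) \<and> \<Union>\<T> = closure \<Omega>"

definition mesh_size :: "point set set \<Rightarrow> real" where
  "mesh_size \<T> = Max (diameter ` \<T>)"


definition partial :: "2 \<Rightarrow> (point \<Rightarrow> real) \<Rightarrow> point \<Rightarrow> real" where
  "partial i \<phi> x = frechet_derivative \<phi> (at x) (axis i 1)"

primrec Ck :: "nat \<Rightarrow> (point \<Rightarrow> real) \<Rightarrow> bool" where
  "Ck 0 \<phi> \<longleftrightarrow> continuous_on UNIV \<phi>"
| "Ck (Suc k) \<phi> \<longleftrightarrow> (\<forall>x. \<phi> differentiable (at x)) \<and> (\<forall>i. Ck k (partial i \<phi>))"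

definition test_function :: "point set \<Rightarrow> (point \<Rightarrow> real) \<Rightarrow> bool" where
  "test_function \<Omega> \<phi> \<longleftrightarrow>
     (\<forall>k. Ck k \<phi>) \<and> compact (closure {x. \<phi> x \<noteq> 0}) \<and> closure {x. \<phi> x \<noteq> 0} \<subseteq> \<Omega>"

definition square_integrable :: "point set \<Rightarrow> (point \<Rightarrow> real) \<Rightarrow> bool" where
  "square_integrable \<Omega> f \<longleftrightarrow>
     f \<in> borel_measurable (lebesgue_on \<Omega>) \<and> integrable (lebesgue_on \<Omega>) (\<lambda>x. (f x)\<^sup>2)"

text \<open>
  Functions on \<open>\<Omega>\<close> are represented by total functions whose values outside the closure of
  \<open>\<Omega>\<close> are irrelevant. A weak derivative is determined only almost everywhere, so weak derivatives
  and everything built from them are relations; the integrals involved do not depend on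
  the representative chosen.
\<close>

definition has_weak_partial ::
    "point set \<Rightarrow> 2 \<Rightarrow> (point \<Rightarrow> real) \<Rightarrow> (point \<Rightarrow> real) \<Rightarrow> bool" where
  "has_weak_partial \<Omega> i u g \<longleftrightarrow>
     square_integrable \<Omega> u \<and> square_integrable \<Omega> g \<and>
     (\<forall>\<phi>. test_function \<Omega> \<phi> \<longrightarrow>
        (\<integral>x. u x * partial i \<phi> x \<partial>lebesgue_on \<Omega>) = - (\<integral>x. g x * \<phi> x \<partial>lebesgue_on \<Omega>))"

definition has_weak_gradient ::
    "point set \<Rightarrow> (point \<Rightarrow> real) \<Rightarrow> (point \<Rightarrow> point) \<Rightarrow> bool" where
  "has_weak_gradient \<Omega> u G \<longleftrightarrow> (\<forall>i. has_weak_partial \<Omega> i u (\<lambda>x. G x $ i))"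

primrec sobolev :: "nat \<Rightarrow> point set \<Rightarrow> (point \<Rightarrow> real) set" where
  "sobolev 0 \<Omega> = {u. square_integrable \<Omega> u}"
| "sobolev (Suc k) \<Omega> = {u. \<forall>i. \<exists>g \<in> sobolev k \<Omega>. has_weak_partial \<Omega> i u g}"

definition has_H1_seminorm :: "point set \<Rightarrow> (point \<Rightarrow> real) \<Rightarrow> real \<Rightarrow> bool" where
  "has_H1_seminorm \<Omega> w s \<longleftrightarrow>
     (\<exists>G. has_weak_gradient \<Omega> w G \<and> s = sqrt (\<integral>x. (norm (G x))\<^sup>2 \<partial>lebesgue_on \<Omega>))"

definition has_weak_laplacian ::
    "point set \<Rightarrow> (point \<Rightarrow> real) \<Rightarrow> (point \<Rightarrow> real) \<Rightarrow> bool" where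
  "has_weak_laplacian \<Omega> u l \<longleftrightarrow>
     (\<exists>G H. has_weak_gradient \<Omega> u G \<and>
        (\<forall>i. has_weak_partial \<Omega> i (\<lambda>x. G x $ i) (\<lambda>x. H x $ i)) \<and>
        l = (\<lambda>x. \<Sum>i\<in>UNIV. (H x :: point) $ i))"


definition P1_space :: "point set \<Rightarrow> point set set \<Rightarrow> (point \<Rightarrow> real) set" where
  "P1_space \<Omega> \<T> =
     {v. continuous_on (closure \<Omega>) v \<and> (\<forall>K \<in> \<T>. \<exists>a b. \<forall>x \<in> K. v x = a \<bullet> x + b)}"

definition is_lagrange_interpolant ::
    "point set \<Rightarrow> point set set \<Rightarrow> (point \<Rightarrow> real) \<Rightarrow> (point \<Rightarrow> real) \<Rightarrow> bool" where
  "is_lagrange_interpolant \<Omega> \<T> w I \<longleftrightarrow>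
     I \<in> P1_space \<Omega> \<T> \<and> (\<forall>K \<in> \<T>. \<forall>p. p extreme_point_of K \<longrightarrow> I p = w p)"

text \<open>The data are the right-hand side \<open>f\<close> and a continuous function \<open>w\<close> giving the Dirichlet data.\<close>

definition is_poisson_fe_solution ::
    "point set \<Rightarrow> point set set \<Rightarrow> (point \<Rightarrow> real) \<Rightarrow> (point \<Rightarrow> real) \<Rightarrow> (point \<Rightarrow> real) \<Rightarrow> bool" where
  "is_poisson_fe_solution \<Omega> \<T> f w U \<longleftrightarrow>
     U \<in> P1_space \<Omega> \<T> \<and>
     (\<exists>I. is_lagrange_interpolant \<Omega> \<T> w I \<and> (\<forall>x \<in> frontier \<Omega>. U x = I x)) \<and>
     (\<exists>G. has_weak_gradient \<Omega> U G \<and>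
       (\<forall>v \<in> P1_space \<Omega> \<T>. (\<forall>x \<in> frontier \<Omega>. v x = 0) \<longrightarrow>
          (\<exists>V. has_weak_gradient \<Omega> v V \<and>
             (\<integral>x. G x \<bullet> V x \<partial>lebesgue_on \<Omega>) = (\<integral>x. f x * v x \<partial>lebesgue_on \<Omega>))))"

text \<open>
  Point values of a function in \<open>H\<^sup>2\<close> are those of its representative that is continuous
  up to the boundary (it exists by Sobolev embedding and is unique there).
\<close>

definition is_discrete_solution ::
    "point set \<Rightarrow> point set set \<Rightarrow> (point \<Rightarrow> real) \<Rightarrow> (point \<Rightarrow> real) \<Rightarrow> bool" where
  "is_discrete_solution \<Omega> \<T> u U \<longleftrightarrow>
     (\<exists>l w. has_weak_laplacian \<Omega> u l \<and>
        continuous_on (closure \<Omega>) w \<and> (AE x in lebesgue_on \<Omega>. w x = u x) \<and>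
        is_poisson_fe_solution \<Omega> \<T> (\<lambda>x. - l x) w U)"


text \<open>The angle at the middle argument.\<close>

definition vertex_angle :: "point \<Rightarrow> point \<Rightarrow> point \<Rightarrow> real" where
  "vertex_angle a b c = arccos (((a - b) \<bullet> (c - b)) / (norm (a - b) * norm (c - b)))"

definition max_angle :: "point \<Rightarrow> point \<Rightarrow> point \<Rightarrow> real" where
  "max_angle a b c = Max {vertex_angle c a b, vertex_angle a b c, vertex_angle b c a}"

definition area :: "point set \<Rightarrow> real" where
  "area K = measure lebesgue K"

definition band_K :: "(nat \<Rightarrow> point) \<Rightarrow> (nat \<Rightarrow> point) \<Rightarrow> nat \<Rightarrow> point set" where
  "band_K P Q i = convex hull {P i, P (i + 1), Q i}"

definition band_K' :: "(nat \<Rightarrow> point) \<Rightarrow> (nat \<Rightarrow> point) \<Rightarrow> nat \<Rightarrow> point set" where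
  "band_K' P Q i = convex hull {Q (i - 1), Q i, P i}"

definition band_angle :: "(nat \<Rightarrow> point) \<Rightarrow> (nat \<Rightarrow> point) \<Rightarrow> nat \<Rightarrow> real" where
  "band_angle P Q i = max_angle (P i) (P (i + 1)) (Q i)"

definition band_angle' :: "(nat \<Rightarrow> point) \<Rightarrow> (nat \<Rightarrow> point) \<Rightarrow> nat \<Rightarrow> real" where
  "band_angle' P Q i = max_angle (Q (i - 1)) (Q i) (P i)"

definition band_length :: "nat \<Rightarrow> (nat \<Rightarrow> point) \<Rightarrow> real" where
  "band_length N P = (\<Sum>i = 0..N. dist (P i) (P (i + 1)))"

text \<open>
  A band is given by its points \<open>P 0, \<dots>, P (N + 1)\<close> and \<open>Q 0, \<dots>, Q N\<close>; the values of
  \<open>P\<close> and \<open>Q\<close> at larger indices play no role. In the definition \<open>P\<close> is ordered along the line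
  with direction \<open>d\<close>, and \<open>Q\<close> lies strictly on the side of it to which \<open>n\<close> points.
\<close>

definition is_band ::
    "point set set \<Rightarrow> nat \<Rightarrow> (nat \<Rightarrow> point) \<Rightarrow> (nat \<Rightarrow> point) \<Rightarrow> bool" where
  "is_band \<T> N P Q \<longleftrightarrow>
     1 \<le> N \<and>
     (\<exists>a d t. d \<noteq> 0 \<and> strict_mono_on {0..N + 1} (t :: nat \<Rightarrow> real) \<and>
        (\<forall>i \<in> {0..N + 1}. P i = a + t i *\<^sub>R d)) \<and>
     (\<exists>n c. (\<forall>i \<in> {0..N + 1}. n \<bullet> P i = c) \<and> (\<forall>i \<in> {0..N}. n \<bullet> Q i > c)) \<and>
     (\<forall>i \<in> {0..N}. band_K P Q i \<in> \<T> \<and>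
        dist (P i) (Q i) \<le> dist (P i) (P (i + 1)) \<and>
        dist (P (i + 1)) (Q i) \<le> dist (P i) (P (i + 1))) \<and>
     (\<forall>i \<in> {1..N}. band_K' P Q i \<in> \<T> \<and>
        band_angle' P Q i = vertex_angle (Q (i - 1)) (P i) (Q i)) \<and>
     inj_on (band_K P Q) {0..N} \<and> inj_on (band_K' P Q) {1..N} \<and>
     band_K P Q ` {0..N} \<inter> band_K' P Q ` {1..N} = {}"

end

theory Submission
  imports Defs
begin

text \<open>
  Let \<open>U\<close> be the discrete solution for \<open>u = \<bar>x\<bar>\<^sup>2\<close> and let \<open>V\<close> be the sum of the jumps of the slope of
  \<open>U\<close> along the base line \<open>\<Gamma>\<close> of the band. If \<open>V \<le> L / 6\<close>, then \<open>U\<close> is too close to an affine function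
  on \<open>\<Gamma>\<close>: second differences with step \<open>L / 3\<close> show that \<open>u - U\<close> has mean size of order \<open>L\<^sup>2\<close> there. On the other
  hand, integrating the derivative of \<open>u - U\<close> along the rays normal to \<open>\<Gamma>\<close> up to the boundary, where
  \<open>\<bar>u - U\<bar> \<le> h\<^sup>2\<close>, gives \<open>\<integral>\<^sub>\<Gamma> \<bar>u - U\<bar> \<le> L h\<^sup>2 + O(L\<^sup>1\<^sup>/\<^sup>2 h\<^sup>\<alpha>)\<close>. Hence \<open>L\<^sup>5\<^sup>/\<^sup>2 = O(h\<^sup>\<alpha>)\<close>, which is excluded
  for large \<open>C_L\<close>, and \<open>V > L / 6\<close>.

  At \<open>P\<^sub>i\<close> continuity across the two edges of the triangle \<open>Q\<^bsub>i-1\<^esub> Q\<^sub>i P\<^sub>i\<close> bounds the jump by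
  \<open>4 sin (\<pi> - \<alpha>\<^sub>i)\<close>, where \<open>\<alpha>\<^sub>i\<close> is the maximum angle of that triangle, times the deviations of \<open>grad U\<close> from
  \<open>2 P\<^sub>i = grad u (P\<^sub>i)\<close> on the three adjacent triangles. The deviation on a triangle \<open>K\<close> is at most a
  multiple of \<open>\<bar>K\<bar>\<^sup>-\<^sup>1\<^sup>/\<^sup>2\<close> times the error of the gradient in \<open>L\<^sup>2(K)\<close>. Summing over \<open>i\<close> and applying the
  Cauchy-Schwarz inequality gives the estimate.
\<close>

section \<open>Plane geometry\<close>

text \<open>The function |x|^2 is chosen because it is explicit: its gradient is affine, its
  Laplacian is the constant 4, and on a line in any unit direction it is \<open>t\<^sup>2\<close>
  plus an affine function, so its second differences do not depend on where the band lies. Its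
  Lagrange interpolant is off by at most \<open>h\<^sup>2\<close> on elements of any shape, which
  matters because band elements may be arbitrarily flat. The error bound is assumed only for
  functions already known to be discrete solutions. Hence a solution has to be constructed from a
  Galerkin system, and its piecewise gradient has to be identified as its weak gradient. With k = L
  / 3 and D a bound for distances in the domain, small slope variation leads to \<open>k ^ 3 \<le> 4
  * \<eta> * k + 4 * (\<epsilon> * sqrt (3 * k * D))\<close>, where \<eta> = h^2 and \<epsilon> is
  of order h^\<alpha>. Dividing by the square root of k leaves k^(5/2) against h^\<alpha>; this is
  the origin of the exponent 2 \<alpha> / 5.\<close>

text \<open>In coordinates along the base line and its normal, \<open>(-c1, s1)\<close> and
  \<open>(c2, s2)\<close> are the unit directions of the two edges leaving the base point,
  \<open>(x, y)\<close>, \<open>(m1, y1)\<close>, \<open>(m2, y2)\<close> are the gradients on the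
  three adjacent elements and \<open>(X, Y)\<close> is the reference gradient. \<open>e1\<close> and
  \<open>e2\<close> express tangential continuity. The angle between the edges has cosine
  \<open>s1 * s2 - c1 * c2\<close> and sine \<open>s2 * c1 + s1 * c2\<close>. If both edges stay
  away from the normal, eliminating \<open>x\<close> produces the sine as a factor; otherwise the
  sine is at least 1/2 and the triangle inequality suffices.\<close>

lemma jump_bound_normalized:
  fixes c1 s1 c2 s2 x y m1 y1 m2 y2 X Y A A1 A2 :: real
  assumes pos: "c1 \<ge> 0" "s1 \<ge> 0" "c2 \<ge> 0" "s2 \<ge> 0"
    and unit: "c1\<^sup>2 + s1\<^sup>2 = 1" "c2\<^sup>2 + s2\<^sup>2 = 1"
    and e1: "y * s1 - x * c1 = y1 * s1 - m1 * c1"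
    and e2: "x * c2 + y * s2 = m2 * c2 + y2 * s2"
    and ang: "s1 * s2 - c1 * c2 \<le> 1 / 2"
    and A: "\<bar>y - Y\<bar> \<le> A"
    and A1: "\<bar>m1 - X\<bar> \<le> A1" "\<bar>y1 - Y\<bar> \<le> A1"
    and A2: "\<bar>m2 - X\<bar> \<le> A2" "\<bar>y2 - Y\<bar> \<le> A2"
  shows "\<bar>m2 - m1\<bar> \<le> 4 * (s2 * c1 + s1 * c2) * (A + A1 + A2)"
proof -
  define s where "s = s2 * c1 + s1 * c2"
  have s: "s2 * c1 \<le> s" "s1 * c2 \<le> s" "0 \<le> s" "0 \<le> s2 * c1" "0 \<le> s1 * c2"
    using pos by (auto simp: s_def)
  have nn: "0 \<le> A" "0 \<le> A1" "0 \<le> A2"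
    using A A1 A2 by linarith+
  show ?thesis
  proof (cases "1 / 2 \<le> c1 \<and> 1 / 2 \<le> c2")
    case True
    have tri: "\<bar>a - b - c\<bar> \<le> \<bar>a\<bar> + \<bar>b\<bar> + \<bar>c\<bar>" for a b c :: real by linarith
    have x: "x * c1 = y * s1 - y1 * s1 + m1 * c1" "x * c2 = m2 * c2 + y2 * s2 - y * s2"
      using e1 e2 by linarith+
    have "c2 * (y * s1 - y1 * s1 + m1 * c1) = c1 * (m2 * c2 + y2 * s2 - y * s2)"
      unfolding x[symmetric] by simp
    \<comment> \<open>The coefficients of \<open>y\<close>, \<open>y1\<close> and \<open>y2\<close>
      add up to zero, so \<open>Y\<close> can be subtracted from each of them.\<close>
    then have "(m2 - m1) * (c1 * c2) = (y - Y) * s - (y2 - Y) * (s2 * c1) - (y1 - Y) * (s1 * c2)"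
      unfolding s_def by (simp add: algebra_simps)
    then have "\<bar>m2 - m1\<bar> * (c1 * c2) = \<bar>(y - Y) * s - (y2 - Y) * (s2 * c1) - (y1 - Y) * (s1 * c2)\<bar>"
      using pos by (metis abs_mult abs_of_nonneg mult_nonneg_nonneg)
    also have "\<dots> \<le> \<bar>y - Y\<bar> * s + \<bar>y2 - Y\<bar> * (s2 * c1) + \<bar>y1 - Y\<bar> * (s1 * c2)"
      using tri[of "(y - Y) * s" "(y2 - Y) * (s2 * c1)" "(y1 - Y) * (s1 * c2)"] s(3-5)
      unfolding abs_mult[of "y - Y" s] abs_mult[of "y2 - Y" "s2 * c1"] abs_mult[of "y1 - Y" "s1 * c2"] by simp
    also have "\<dots> \<le> A * s + A2 * s + A1 * s"
      by (intro add_mono mult_right_mono[OF A] mult_mono[OF A2(2) s(1)] mult_mono[OF A1(2) s(2)] s nn)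
    finally have 1: "\<bar>m2 - m1\<bar> * (c1 * c2) \<le> s * (A + A1 + A2)"
      by (simp add: algebra_simps)
    have "(1/2) * (1/2) \<le> c1 * c2"
      using True by (intro mult_mono) auto
    then have "\<bar>m2 - m1\<bar> * (1/4) \<le> \<bar>m2 - m1\<bar> * (c1 * c2)"
      by (intro mult_left_mono) auto
    with 1 show ?thesis unfolding s_def[symmetric] by simp
  next
    case False
    have "c1\<^sup>2 \<le> 1\<^sup>2" "c2\<^sup>2 \<le> 1\<^sup>2"
      using unit zero_le_power2[of s1] zero_le_power2[of s2] unfolding one_power2 by linarith+
    then have le1: "c1 \<le> 1" "c2 \<le> 1"
      using power2_le_imp_le[of c1 1] power2_le_imp_le[of c2 1] by auto
    have "c1 * c2 \<le> 1/2"
    proof (cases "c1 \<le> 1/2")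
      case True
      then have "c1 * c2 \<le> 1/2 * 1" using le1 pos by (intro mult_mono) auto
      then show ?thesis by simp
    next
      case False2: False
      then have "c2 \<le> 1/2" using False by auto
      then have "c1 * c2 \<le> 1 * (1/2)" using le1 pos by (intro mult_mono) auto
      then show ?thesis by simp
    qed
    moreover have "0 \<le> s1 * s2" using pos by simp
    ultimately have "\<bar>s1 * s2 - c1 * c2\<bar> \<le> 1/2"
      using ang by linarith
    then have "(s1 * s2 - c1 * c2)\<^sup>2 \<le> (1/2)\<^sup>2"
      by (metis abs_ge_zero power2_abs power_mono)
    moreover have "s\<^sup>2 + (s1 * s2 - c1 * c2)\<^sup>2 = (c1\<^sup>2 + s1\<^sup>2) * (c2\<^sup>2 + s2\<^sup>2)"
      unfolding s_def by (simp add: power2_eq_square algebra_simps)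
    ultimately have "(1/2)\<^sup>2 \<le> s\<^sup>2"
      using unit by (simp add: power2_eq_square)
    then have "1/2 \<le> s" using s(3) power2_le_imp_le by blast
    then have "1 * (A + A1 + A2) \<le> (4 * s) * (A + A1 + A2)"
      using nn by (intro mult_right_mono) auto
    moreover have "\<bar>m2 - m1\<bar> \<le> 1 * (A + A1 + A2)"
      unfolding mult_1 using A1(1) A2(1) nn(1) by linarith
    ultimately show ?thesis unfolding s_def by (rule order_trans[rotated])
  qed
qed

text \<open>Lagrange's identity turns the sine of the \<open>arccos\<close> into a determinant, in
  any orthonormal frame; thus the angles of the band become expressions in edge coordinates.\<close>

lemma sin_pi_minus_vertex_angle:
  fixes a b c d n :: point
  assumes "a \<noteq> b" "c \<noteq> b" and on: "norm d = 1" "norm n = 1" "d \<bullet> n = 0"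
    and a: "a - b = x1 *\<^sub>R d + y1 *\<^sub>R n" and c: "c - b = x2 *\<^sub>R d + y2 *\<^sub>R n"
  shows "sin (pi - vertex_angle a b c) = \<bar>x1 * y2 - x2 * y1\<bar> / (norm (a - b) * norm (c - b))"
proof -
  have ip: "d \<bullet> d = 1" "n \<bullet> n = 1" "n \<bullet> d = 0"
    using on by (auto simp: norm_eq_1 inner_commute)
  let ?r = "norm (a - b) * norm (c - b)"
  have r: "?r > 0" using assms(1,2) by simp
  have na: "(norm (a - b))\<^sup>2 = x1\<^sup>2 + y1\<^sup>2" "(norm (c - b))\<^sup>2 = x2\<^sup>2 + y2\<^sup>2"
    unfolding a c power2_norm_eq_inner using ip on by (auto simp: inner_simps power2_eq_square)
  have dot: "(a - b) \<bullet> (c - b) = x1 * x2 + y1 * y2"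
    unfolding a c using ip on by (auto simp: inner_simps)
  have ab: "\<bar>((a - b) \<bullet> (c - b)) / ?r\<bar> \<le> 1"
  proof -
    have "\<bar>(a - b) \<bullet> (c - b)\<bar> / ?r \<le> 1"
      using Cauchy_Schwarz_ineq2[of "a - b" "c - b"] r by (subst divide_le_eq_1_pos) auto
    then show ?thesis using r by (simp only: abs_divide abs_of_pos)
  qed
  have "sin (pi - vertex_angle a b c) = sqrt (1 - (((a - b) \<bullet> (c - b)) / ?r)\<^sup>2)"
    unfolding vertex_angle_def sin_pi_minus using ab by (intro sin_arccos_abs)
  also have "1 - (((a - b) \<bullet> (c - b)) / ?r)\<^sup>2 = ((x1 * y2 - x2 * y1) / ?r)\<^sup>2"
  proof -
    have "?r\<^sup>2 = (x1\<^sup>2 + y1\<^sup>2) * (x2\<^sup>2 + y2\<^sup>2)"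
      by (simp add: power_mult_distrib na)
    then have "?r\<^sup>2 - ((a - b) \<bullet> (c - b))\<^sup>2 = (x1 * y2 - x2 * y1)\<^sup>2"
      unfolding dot by (simp add: power2_eq_square algebra_simps)
    then have "((x1 * y2 - x2 * y1) / ?r)\<^sup>2 = (?r\<^sup>2 - ((a - b) \<bullet> (c - b))\<^sup>2) / ?r\<^sup>2"
      by (simp only: power_divide)
    also have "\<dots> = 1 - (((a - b) \<bullet> (c - b)) / ?r)\<^sup>2"
      using r by (simp only: power_divide diff_divide_distrib divide_self power_not_zero less_imp_neq[THEN not_sym] simp_thms)
    finally show ?thesis by simp
  qed
  also have "sqrt (((x1 * y2 - x2 * y1) / ?r)\<^sup>2) = \<bar>x1 * y2 - x2 * y1\<bar> / ?r"
    by simp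
  finally show ?thesis .
qed

text \<open>Comparing the angles of a triangle via the law of cosines avoids the angle sum theorem.\<close>

lemma cos_max_angle_le_half:
  fixes a b c :: point
  assumes ne: "a \<noteq> b" "c \<noteq> b" "a \<noteq> c"
    and ang: "vertex_angle c a b \<le> vertex_angle a b c" "vertex_angle b c a \<le> vertex_angle a b c"
  shows "(a - b) \<bullet> (c - b) / (norm (a - b) * norm (c - b)) \<le> 1 / 2"
proof (rule ccontr)
  define A B C where "A = norm (c - b)" and "B = norm (a - c)" and "C = norm (a - b)"
  have pos: "A > 0" "B > 0" "C > 0" using ne by (auto simp: A_def B_def C_def)
  have sq: "(norm (a - c))\<^sup>2 = a \<bullet> a - 2 * (a \<bullet> c) + c \<bullet> c" for a c :: point
    by (simp add: power2_norm_eq_inner inner_simps inner_commute)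
  have lc: "2 * ((a - b) \<bullet> (c - b)) = (norm (a - b))\<^sup>2 + (norm (c - b))\<^sup>2 - (norm (a - c))\<^sup>2" for a b c :: point
    by (simp add: sq inner_simps inner_commute)
  have q: "\<bar>x / r\<bar> \<le> 1" if "\<bar>x\<bar> \<le> r" for x r :: real
  proof (cases "r = 0")
    case False
    then have "r > 0" using that by linarith
    then show ?thesis using that by simp
  qed simp
  have ab: "\<bar>((a - b) \<bullet> (c - b)) / (norm (a - b) * norm (c - b))\<bar> \<le> 1" for a b c :: point
    by (rule q) (rule Cauchy_Schwarz_ineq2)
  have nb: "norm (b - a) = C" "norm (c - a) = B" "norm (b - c) = A"
    by (auto simp: A_def B_def C_def norm_minus_commute)
  have half: "x / (u * v) = y / (2 * u * v)" if "2 * x = y" for x y u v :: real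
    using that[symmetric] by simp
  have cb: "(a - b) \<bullet> (c - b) / (norm (a - b) * norm (c - b)) = (C\<^sup>2 + A\<^sup>2 - B\<^sup>2) / (2 * C * A)"
    using half[OF lc[of a b c], of "norm (a - b)" "norm (c - b)"] by (simp only: nb A_def[symmetric] B_def[symmetric] C_def[symmetric])
  have ca: "(c - a) \<bullet> (b - a) / (norm (c - a) * norm (b - a)) = (B\<^sup>2 + C\<^sup>2 - A\<^sup>2) / (2 * B * C)"
    using half[OF lc[of c a b], of "norm (c - a)" "norm (b - a)"] by (simp only: nb A_def[symmetric] B_def[symmetric] C_def[symmetric])
  have cc: "(b - c) \<bullet> (a - c) / (norm (b - c) * norm (a - c)) = (A\<^sup>2 + B\<^sup>2 - C\<^sup>2) / (2 * A * B)"
    using half[OF lc[of b c a], of "norm (b - c)" "norm (a - c)"] by (simp only: nb A_def[symmetric] B_def[symmetric] C_def[symmetric])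
  have "(a - b) \<bullet> (c - b) / (norm (a - b) * norm (c - b)) \<le> (c - a) \<bullet> (b - a) / (norm (c - a) * norm (b - a))"
    using ang(1) unfolding vertex_angle_def by (subst (asm) arccos_le_mono) (use ab in auto)
  then have 1: "(C\<^sup>2 + A\<^sup>2 - B\<^sup>2) / (2 * C * A) \<le> (B\<^sup>2 + C\<^sup>2 - A\<^sup>2) / (2 * B * C)" unfolding ca cb .
  have "(a - b) \<bullet> (c - b) / (norm (a - b) * norm (c - b)) \<le> (b - c) \<bullet> (a - c) / (norm (b - c) * norm (a - c))"
    using ang(2) unfolding vertex_angle_def by (subst (asm) arccos_le_mono) (use ab in auto)
  then have 2: "(C\<^sup>2 + A\<^sup>2 - B\<^sup>2) / (2 * C * A) \<le> (A\<^sup>2 + B\<^sup>2 - C\<^sup>2) / (2 * A * B)" unfolding cc cb .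
  \<comment> \<open>Assuming \<open>C \<le> A\<close> is harmless: the two sides at \<open>b\<close>
    play symmetric roles and are swapped in the other case. A cosine above 1/2 makes
    \<open>B\<close> shorter than \<open>A\<close>, so the angle opposite \<open>A\<close> would
    exceed the one at \<open>b\<close>; the factorisation with \<open>A - B\<close> below shows this
    on the cosines.\<close>
  have key: False
    if pos: "A > 0" "B > 0" "C > 0" and le: "(C\<^sup>2 + A\<^sup>2 - B\<^sup>2) / (2 * C * A) \<le> (B\<^sup>2 + C\<^sup>2 - A\<^sup>2) / (2 * B * C)"
      and big: "(C\<^sup>2 + A\<^sup>2 - B\<^sup>2) / (2 * C * A) > 1 / 2" and AC: "C \<le> A" for A B C :: real
  proof -
    have "C\<^sup>2 + A\<^sup>2 - B\<^sup>2 > A * C" using big pos by (simp add: field_simps)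
    moreover have "C * C \<le> A * C" using AC pos by simp
    ultimately have "B\<^sup>2 < A\<^sup>2" by (simp add: power2_eq_square)
    then have BA: "B < A" using pos by (simp add: power2_less_imp_less)
    have "(C\<^sup>2 + A\<^sup>2 - B\<^sup>2) * B \<le> (B\<^sup>2 + C\<^sup>2 - A\<^sup>2) * A"
    proof -
      have "(C\<^sup>2 + A\<^sup>2 - B\<^sup>2) / (2 * C * A) * (2 * A * B * C) \<le> (B\<^sup>2 + C\<^sup>2 - A\<^sup>2) / (2 * B * C) * (2 * A * B * C)"
        using le pos by (intro mult_right_mono) auto
      then show ?thesis using pos by simp
    qed
    moreover have "(B\<^sup>2 + C\<^sup>2 - A\<^sup>2) * A - (C\<^sup>2 + A\<^sup>2 - B\<^sup>2) * B = (A - B) * (C\<^sup>2 - (A + B)\<^sup>2)"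
      by (simp add: power2_eq_square algebra_simps)
    moreover have "C\<^sup>2 < (A + B)\<^sup>2" using pos AC by (intro power_strict_mono) auto
    ultimately show False using BA by (smt (verit) mult_pos_neg)
  qed
  assume "\<not> ?thesis"
  then have big: "(C\<^sup>2 + A\<^sup>2 - B\<^sup>2) / (2 * C * A) > 1 / 2" unfolding cb by simp
  show False
  proof (cases "C \<le> A")
    case True then show False using key[of A B C] pos 1 big by blast
  next
    case False
    then show False using key[of C B A] pos 2 big by (simp add: algebra_simps)
  qed
qed

section \<open>Weak derivatives\<close>

lemma integral_lebesgue_translation:
  fixes f :: "'a::euclidean_space \<Rightarrow> real"
  assumes "f \<in> borel_measurable lebesgue"
  shows "(\<integral>x. f (c + x) \<partial>lebesgue) = (\<integral>x. f x \<partial>lebesgue)"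
    and "(\<lambda>x. f (c + x)) \<in> borel_measurable lebesgue"
    and "integrable lebesgue f \<Longrightarrow> integrable lebesgue (\<lambda>x. f (c + x))"
proof -
  have id: "(\<lambda>x. c + (\<Sum>j\<in>Basis. (1 * (x \<bullet> j)) *\<^sub>R j)) = (\<lambda>x::'a. c + x)"
    by (simp add: euclidean_representation)
  have leb: "lebesgue = distr lebesgue lebesgue (\<lambda>x::'a. c + x)"
    using lebesgue_affine_euclidean[of "\<lambda>_. 1" c] unfolding id by (simp add: density_1)
  have m: "(\<lambda>x::'a. c + x) \<in> measurable lebesgue lebesgue"
    using lebesgue_affine_measurable[of "\<lambda>_. 1" c] unfolding id by simp
  show "(\<integral>x. f (c + x) \<partial>lebesgue) = (\<integral>x. f x \<partial>lebesgue)"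
    using integral_distr[OF m assms] leb by simp
  show "(\<lambda>x. f (c + x)) \<in> borel_measurable lebesgue"
    using measurable_compose[OF m assms] .
  show "integrable lebesgue (\<lambda>x. f (c + x))" if "integrable lebesgue f"
    using integrable_distr[OF m, of f] leb that by simp
qed

lemma test_function_partial:
  assumes "test_function \<Omega> \<phi>"
  shows "\<exists>L \<ge> 0. \<forall>x. \<bar>\<phi> x\<bar> \<le> L \<and> \<bar>partial i \<phi> x\<bar> \<le> L"
    and "((\<lambda>t. \<phi> (x + t *\<^sub>R axis i 1)) has_real_derivative partial i \<phi> (x + s *\<^sub>R axis i 1)) (at s)"
    and "continuous_on UNIV \<phi>" "continuous_on UNIV (partial i \<phi>)"
    and "x \<notin> closure {x. \<phi> x \<noteq> 0} \<Longrightarrow> partial i \<phi> x = 0"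
proof -
  define S where "S = closure {x. \<phi> x \<noteq> 0}"
  have C: "\<And>k. Ck k \<phi>" and cS: "compact S"
    using assms by (auto simp: test_function_def S_def)
  have d: "\<phi> differentiable (at x)" for x using C[of "Suc 0"] by auto
  then have der: "(\<phi> has_derivative frechet_derivative \<phi> (at x)) (at x)" for x
    by (simp add: frechet_derivative_works)
  show c0: "continuous_on UNIV \<phi>" using C[of 0] by simp
  show c1: "continuous_on UNIV (partial i \<phi>)" using C[of "Suc 0"] by simp
  show "((\<lambda>t. \<phi> (x + t *\<^sub>R axis i 1)) has_real_derivative partial i \<phi> (x + s *\<^sub>R axis i 1)) (at s)" for x s
  proof -
    let ?D = "frechet_derivative \<phi> (at (x + s *\<^sub>R axis i 1))"
    have "linear ?D" using der has_derivative_linear by blast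
    then have eq: "?D (t *\<^sub>R axis i 1) = partial i \<phi> (x + s *\<^sub>R axis i 1) * t" for t
      by (simp add: linear_cmul partial_def)
    have "((\<lambda>t. x + t *\<^sub>R axis i 1) has_derivative (\<lambda>t. t *\<^sub>R axis i 1)) (at s)"
      by (auto intro!: derivative_eq_intros)
    from has_derivative_compose[OF this der] show ?thesis
      unfolding has_field_derivative_def by (simp add: eq)
  qed
  show z: "partial i \<phi> x = 0" if "x \<notin> closure {x. \<phi> x \<noteq> 0}" for x
  proof -
    have "((\<lambda>y. 0 :: real) has_derivative (\<lambda>h. 0)) (at x)" by simp
    then have "(\<phi> has_derivative (\<lambda>h. 0)) (at x)"
    proof (rule has_derivative_transform_within_open)
      show "open (- S)" "x \<in> - S" using that by (auto simp: S_def)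
      show "0 = \<phi> y" if "y \<in> - S" for y using that closure_subset S_def by force
    qed
    then have "frechet_derivative \<phi> (at x) = (\<lambda>h. 0)"
      using frechet_derivative_at by metis
    then show ?thesis by (simp add: partial_def)
  qed
  have zero: "\<phi> x = 0" if "x \<notin> S" for x using that closure_subset S_def by force
  have "bounded (\<phi> ` S)" "bounded (partial i \<phi> ` S)"
    by (rule compact_imp_bounded[OF compact_continuous_image[OF continuous_on_subset[OF _ subset_UNIV] cS]],
        rule c0 c1)+
  then obtain a b where ab: "\<And>x. x \<in> S \<Longrightarrow> \<bar>\<phi> x\<bar> \<le> a" "\<And>x. x \<in> S \<Longrightarrow> \<bar>partial i \<phi> x\<bar> \<le> b"
    unfolding bounded_iff by (metis imageI real_norm_def)
  have "\<bar>\<phi> x\<bar> \<le> max 0 (max a b) \<and> \<bar>partial i \<phi> x\<bar> \<le> max 0 (max a b)" for x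
    using ab[of x] zero[of x] z[of x] by (cases "x \<in> S") (auto simp: S_def)
  then show "\<exists>L \<ge> 0. \<forall>x. \<bar>\<phi> x\<bar> \<le> L \<and> \<bar>partial i \<phi> x\<bar> \<le> L"
    by (intro exI[of _ "max 0 (max a b)"]) auto
qed

lemma integrable_lebesgue_on_bounded:
  fixes f :: "'a::euclidean_space \<Rightarrow> real"
  assumes "S \<in> lmeasurable" "f \<in> borel_measurable (lebesgue_on S)" "\<And>x. x \<in> S \<Longrightarrow> \<bar>f x\<bar> \<le> B"
  shows "integrable (lebesgue_on S) f"
proof (rule integrableI_bounded_set[where A = S and B = B])
  have "S \<in> sets lebesgue" using assms(1) by auto
  then show "emeasure (lebesgue_on S) S < \<infinity>"
    using assms(1) by (simp add: emeasure_restrict_space fmeasurable_def del: emeasure_completion)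
qed (use assms in \<open>auto intro!: AE_I2\<close>)

lemma square_integrable_bounded:
  assumes "open \<Omega>" "bounded \<Omega>" "f \<in> borel_measurable (lebesgue_on \<Omega>)" "\<And>x. x \<in> \<Omega> \<Longrightarrow> \<bar>f x\<bar> \<le> B"
  shows "square_integrable \<Omega> f"
proof -
  have "integrable (lebesgue_on \<Omega>) (\<lambda>x. (f x)\<^sup>2)"
  proof (rule integrable_lebesgue_on_bounded)
    show "\<Omega> \<in> lmeasurable" using assms by (simp add: lmeasurable_open)
    show "(\<lambda>x. (f x)\<^sup>2) \<in> borel_measurable (lebesgue_on \<Omega>)" using assms(3) by measurable
    show "\<bar>(f x)\<^sup>2\<bar> \<le> B\<^sup>2" if "x \<in> \<Omega>" for x
      using power_mono[OF assms(4)[OF that], of 2] by simp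
  qed
  then show ?thesis using assms by (simp add: square_integrable_def)
qed

text \<open>
  The difference quotients of \<open>v \<phi>\<close> have integral zero by translation invariance and converge
  boundedly to \<open>g \<phi> + v \<partial>\<^sub>i \<phi>\<close>. No behaviour of \<open>v\<close> near the boundary enters.
\<close>

lemma has_weak_partial_segmentwise_lipschitz:
  fixes v g :: "point \<Rightarrow> real"
  assumes op: "open \<Omega>" and bd: "bounded \<Omega>"
    and vm: "v \<in> borel_measurable (lebesgue_on \<Omega>)" and gm: "g \<in> borel_measurable (lebesgue_on \<Omega>)"
    and vb: "\<And>x. x \<in> \<Omega> \<Longrightarrow> \<bar>v x\<bar> \<le> V" and gb: "\<And>x. x \<in> \<Omega> \<Longrightarrow> \<bar>g x\<bar> \<le> V"
    and lip: "\<And>x y. closed_segment x y \<subseteq> \<Omega> \<Longrightarrow> \<bar>v x - v y\<bar> \<le> M * norm (x - y)"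
    and der: "AE x in lebesgue_on \<Omega>. ((\<lambda>t. v (x + t *\<^sub>R axis i 1)) has_real_derivative g x) (at 0)"
  shows "has_weak_partial \<Omega> i v g"
  unfolding has_weak_partial_def
proof (intro conjI allI impI)
  show "square_integrable \<Omega> v" "square_integrable \<Omega> g"
    using square_integrable_bounded op bd vm gm vb gb by blast+
  have Om: "\<Omega> \<in> lmeasurable" using op bd by (simp add: lmeasurable_open)
  then have Os: "\<Omega> \<in> sets lebesgue" by auto
  fix \<phi> assume \<phi>: "test_function \<Omega> \<phi>"
  define S where "S = closure {x. \<phi> x \<noteq> 0}"
  let ?e = "axis i 1 :: point"
  let ?\<psi> = "partial i \<phi>"
  obtain L where L: "L \<ge> 0" "\<And>x. \<bar>\<phi> x\<bar> \<le> L" "\<And>x. \<bar>?\<psi> x\<bar> \<le> L"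
    using test_function_partial(1)[OF \<phi>, of i] by auto
  have pc: "continuous_on UNIV \<phi>" "continuous_on UNIV ?\<psi>"
    using test_function_partial[OF \<phi>] by auto
  have pm: "\<phi> \<in> borel_measurable (lebesgue_on \<Omega>)" "?\<psi> \<in> borel_measurable (lebesgue_on \<Omega>)"
    by (rule continuous_imp_measurable_on_sets_lebesgue[OF continuous_on_subset[OF _ subset_UNIV] Os], rule pc)+
  have S: "compact S" "S \<subseteq> \<Omega>" and z: "\<And>x. x \<notin> S \<Longrightarrow> \<phi> x = 0" "\<And>x. x \<notin> S \<Longrightarrow> ?\<psi> x = 0"
    using \<phi> closure_subset test_function_partial(5)[OF \<phi>] unfolding test_function_def S_def by force+
  have ne: "norm ?e = 1" by (simp add: norm_axis_1)
  have M: "M \<ge> 0" if "\<Omega> \<noteq> {}"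
  proof -
    from \<open>\<Omega> \<noteq> {}\<close> obtain x where "x \<in> \<Omega>" by blast
    with op obtain r where r: "r > 0" "cball x r \<subseteq> \<Omega>" unfolding open_contains_cball by blast
    have "closed_segment x (x + r *\<^sub>R ?e) \<subseteq> cball x r"
      using r(1) ne by (intro closed_segment_subset) (auto simp: dist_norm)
    then have "closed_segment x (x + r *\<^sub>R ?e) \<subseteq> \<Omega>" using r by blast
    from lip[OF this] have "0 \<le> M * r" using ne r by simp
    then show ?thesis using r(1) zero_le_mult_iff by force
  qed
  \<comment> \<open>A shift shorter than \<delta> that starts or ends in the support runs along a
    segment inside \<Omega>, where \<open>lip\<close> applies.\<close>
  obtain \<delta> where \<delta>: "\<delta> > 0" "(\<Union>x\<in>S. ball x \<delta>) \<subseteq> \<Omega>"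
    using compact_subset_open_imp_ball_epsilon_subset[OF S(1) op S(2)] by blast
  define w where "w x = (if x \<in> \<Omega> then v x * \<phi> x else 0)" for x
  define F where "F x = (if x \<in> \<Omega> then g x * \<phi> x + v x * ?\<psi> x else 0)" for x
  define t where "t n = \<delta> / (real n + 2)" for n
  define f where "f n x = (w (t n *\<^sub>R ?e + x) - w x) / t n" for n x
  have t: "0 < t n" "t n < \<delta>" for n
    using \<delta>(1) by (auto simp: t_def field_simps add_pos_nonneg)
  have t0: "t \<longlonglongrightarrow> 0"
  proof -
    have "(\<lambda>n. \<delta> / real (n + 2)) \<longlonglongrightarrow> 0"
      using LIMSEQ_ignore_initial_segment[OF lim_const_over_n[of \<delta>], of 2] by simp
    then show ?thesis unfolding t_def by (simp add: add.commute)
  qed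
  have wm: "w \<in> borel_measurable lebesgue"
    unfolding w_def using Os vm pm by (subst borel_measurable_if) auto
  have Fm: "F \<in> borel_measurable lebesgue"
    unfolding F_def using Os vm gm pm by (subst borel_measurable_if) auto
  have wi: "integrable lebesgue w"
  proof (rule integrableI_bounded_set[where A = \<Omega> and B = "V * L"])
    show "AE x in lebesgue. x \<in> \<Omega> \<longrightarrow> norm (w x) \<le> V * L"
      using vb L by (intro AE_I2) (auto simp: w_def abs_mult intro!: mult_mono order_trans[OF abs_ge_zero vb])
  qed (use Om wm in \<open>auto simp: w_def fmeasurable_def\<close>)
  have fm: "f n \<in> borel_measurable lebesgue" for n
    unfolding f_def using wm integral_lebesgue_translation(2)[OF wm, of "t n *\<^sub>R ?e"] by measurable
  have int0: "(\<integral>x. f n x \<partial>lebesgue) = 0" for n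
    unfolding f_def using integral_lebesgue_translation[OF wm, of "t n *\<^sub>R ?e"] wi by simp
  \<comment> \<open>The dominating function: the quotient vanishes unless the shift starts or ends
    in the support, and then the discrete product rule bounds it uniformly in
    \<open>n\<close>.\<close>
  have fb: "\<bar>f n x\<bar> \<le> (V * L + L * M) * indicator \<Omega> x" for n x
  proof (cases "x \<in> S \<or> t n *\<^sub>R ?e + x \<in> S")
    case True
    then obtain s where s: "s \<in> S" "s = x \<or> s = t n *\<^sub>R ?e + x" by blast
    let ?y = "t n *\<^sub>R ?e + x"
    have "closed_segment ?y x \<subseteq> ball s \<delta>"
      using s(2) t[of n] ne \<delta>(1) by (intro closed_segment_subset) (auto simp: dist_norm)
    then have sg: "closed_segment ?y x \<subseteq> \<Omega>" using \<delta>(2) s(1) by blast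
    then have xy: "x \<in> \<Omega>" "?y \<in> \<Omega>" by auto
    have V0: "0 \<le> V" using vb[OF xy(1)] by linarith
    have M0: "0 \<le> M" using M xy by blast
    have "\<bar>\<phi> ?y - \<phi> x\<bar> \<le> L * t n"
    proof -
      have "\<exists>u>0. u < t n \<and> \<phi> (x + t n *\<^sub>R ?e) - \<phi> (x + 0 *\<^sub>R ?e) = (t n - 0) * ?\<psi> (x + u *\<^sub>R ?e)"
        using test_function_partial(2)[OF \<phi>] t(1) by (intro MVT2) auto
      then obtain u where "\<phi> ?y - \<phi> x = t n * ?\<psi> (x + u *\<^sub>R ?e)" by (auto simp: add.commute)
      then show ?thesis using L(3) t(1)[of n] by (simp add: abs_mult mult.commute mult_left_mono)
    qed
    then have "\<bar>v ?y\<bar> * \<bar>\<phi> ?y - \<phi> x\<bar> \<le> V * (L * t n)"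
      using vb[OF xy(2)] V0 by (intro mult_mono) auto
    moreover have "\<bar>\<phi> x\<bar> * \<bar>v ?y - v x\<bar> \<le> L * (M * t n)"
      using lip[OF sg] L t(1)[of n] ne M0 by (intro mult_mono) auto
    moreover have "w ?y - w x = v ?y * (\<phi> ?y - \<phi> x) + \<phi> x * (v ?y - v x)"
      using xy by (simp add: w_def algebra_simps)
    then have "\<bar>w ?y - w x\<bar> \<le> \<bar>v ?y\<bar> * \<bar>\<phi> ?y - \<phi> x\<bar> + \<bar>\<phi> x\<bar> * \<bar>v ?y - v x\<bar>"
      by (metis abs_mult abs_triangle_ineq)
    ultimately have "\<bar>w ?y - w x\<bar> \<le> (V * L + L * M) * t n"
      by (simp add: algebra_simps)
    then show ?thesis using t(1)[of n] xy(1) by (simp add: f_def pos_divide_le_eq)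
  next
    case False
    then have "f n x = 0" using z by (auto simp: f_def w_def)
    moreover have "0 \<le> (V * L + L * M) * indicator \<Omega> x"
    proof (cases "x \<in> \<Omega>")
      case True
      have "0 \<le> V" using vb[OF True] by linarith
      moreover have "0 \<le> M" using M True by blast
      ultimately show ?thesis using L by simp
    qed simp
    ultimately show ?thesis by simp
  qed
  have lim: "AE x in lebesgue. (\<lambda>n. f n x) \<longlonglongrightarrow> F x"
  proof -
    have "AE x in lebesgue. x \<in> \<Omega> \<longrightarrow> ((\<lambda>t. v (x + t *\<^sub>R ?e)) has_real_derivative g x) (at 0)"
      using der Os by (subst (asm) AE_restrict_space_iff) auto
    then show ?thesis
    proof eventually_elim
      case (elim x)
      have lt: "(\<lambda>n. t n *\<^sub>R ?e + x) \<longlonglongrightarrow> 0 *\<^sub>R ?e + x"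
        by (intro tendsto_intros t0)
      show ?case
      proof (cases "x \<in> S")
        case True
        then have x: "x \<in> \<Omega>" using S by blast
        have "((\<lambda>t. v (x + t *\<^sub>R ?e) * \<phi> (x + t *\<^sub>R ?e)) has_real_derivative
            g x * \<phi> (x + 0 *\<^sub>R ?e) + ?\<psi> (x + 0 *\<^sub>R ?e) * v (x + 0 *\<^sub>R ?e)) (at 0)"
          by (intro DERIV_mult test_function_partial(2)[OF \<phi>] elim[rule_format] x)
        then have "((\<lambda>s. (v (x + s *\<^sub>R ?e) * \<phi> (x + s *\<^sub>R ?e) - v x * \<phi> x) / s)
            \<longlongrightarrow> F x) (at 0)"
          using x by (simp add: has_field_derivative_iff F_def mult.commute)
        moreover have "filterlim t (at 0) sequentially"
          using t0 t(1) by (auto simp: filterlim_at intro!: always_eventually less_imp_neq[THEN not_sym])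
        ultimately have "(\<lambda>n. (v (x + t n *\<^sub>R ?e) * \<phi> (x + t n *\<^sub>R ?e) - v x * \<phi> x) / t n) \<longlonglongrightarrow> F x"
          by (rule filterlim_compose)
        moreover have "\<forall>\<^sub>F n in sequentially. t n *\<^sub>R ?e + x \<in> \<Omega>"
          using lt x op by (simp add: topological_tendstoD)
        then have "\<forall>\<^sub>F n in sequentially.
            (v (x + t n *\<^sub>R ?e) * \<phi> (x + t n *\<^sub>R ?e) - v x * \<phi> x) / t n = f n x"
          by eventually_elim (use x in \<open>simp add: f_def w_def add.commute\<close>)
        ultimately show ?thesis using Lim_transform_eventually by fast
      next
        case False
        have "\<forall>\<^sub>F n in sequentially. t n *\<^sub>R ?e + x \<in> - S"
          using lt False S(1) by (intro topological_tendstoD) (auto simp: compact_imp_closed open_Compl)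
        then have "\<forall>\<^sub>F n in sequentially. 0 = f n x"
          by eventually_elim (use False z in \<open>simp add: f_def w_def\<close>)
        moreover have "F x = 0" using False z by (simp add: F_def)
        ultimately show ?thesis using Lim_transform_eventually[of "\<lambda>_. 0" 0] by force
      qed
    qed
  qed
  have "(\<lambda>n. \<integral>x. f n x \<partial>lebesgue) \<longlonglongrightarrow> (\<integral>x. F x \<partial>lebesgue)"
  proof (rule integral_dominated_convergence[OF Fm fm _ lim])
    show "integrable lebesgue (\<lambda>x. (V * L + L * M) * indicator \<Omega> x)"
      using Om by (intro integrable_mult_right integrable_real_indicator) (auto simp: fmeasurable_def)
    show "AE x in lebesgue. norm (f n x) \<le> (V * L + L * M) * indicator \<Omega> x" for n
      using fb by simp
  qed
  then have "(\<integral>x. F x \<partial>lebesgue) = 0"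
    by (simp add: int0 LIMSEQ_const_iff)
  moreover have "(\<integral>x. F x \<partial>lebesgue) = (\<integral>x. g x * \<phi> x + v x * ?\<psi> x \<partial>lebesgue_on \<Omega>)"
    unfolding F_def using Os by (subst integral_restrict_space) (auto simp: indicator_def intro!: Bochner_Integration.integral_cong)
  moreover have "integrable (lebesgue_on \<Omega>) (\<lambda>x. g x * \<phi> x)"
    using Om gm pm gb L by (intro integrable_lebesgue_on_bounded[where B = "V * L"])
      (auto simp: abs_mult intro!: mult_mono order_trans[OF abs_ge_zero vb])
  moreover have "integrable (lebesgue_on \<Omega>) (\<lambda>x. v x * ?\<psi> x)"
    using Om vm pm vb L by (intro integrable_lebesgue_on_bounded[where B = "V * L"])
      (auto simp: abs_mult intro!: mult_mono order_trans[OF abs_ge_zero vb])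
  ultimately show "(\<integral>x. v x * ?\<psi> x \<partial>lebesgue_on \<Omega>) = - (\<integral>x. g x * \<phi> x \<partial>lebesgue_on \<Omega>)"
    by simp
qed

section \<open>Piecewise linear functions on a triangulation\<close>

text \<open>Moving one vertex to the origin makes the others linearly independent, so a linear
  functional with prescribed values exists; \<open>adjoint g 1\<close> is the vector representing
  it.\<close>

lemma affine_interpolation:
  fixes C :: "'a::euclidean_space set" and w :: "'a \<Rightarrow> real"
  assumes "\<not> affine_dependent C"
  shows "\<exists>a b. \<forall>p \<in> C. a \<bullet> p + b = w p"
proof (cases "C = {}")
  case False
  then obtain p0 where p0: "p0 \<in> C" by blast
  have "independent ((\<lambda>x. - p0 + x) ` (C - {p0}))"
    using assms affine_dependent_iff_dependent2[OF p0] by simp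
  then obtain g where g: "linear g"
    "\<And>x. x \<in> (\<lambda>x. - p0 + x) ` (C - {p0}) \<Longrightarrow> g x = w (x + p0) - w p0"
    using linear_independent_extend[of _ "\<lambda>x. w (x + p0) - w p0"] by metis
  have ga: "g x = adjoint g 1 \<bullet> x" for x
    using adjoint_works[OF g(1), of x 1] by (simp add: inner_commute)
  have "adjoint g 1 \<bullet> p + (w p0 - adjoint g 1 \<bullet> p0) = w p" if "p \<in> C" for p
  proof (cases "p = p0")
    case False
    then have "g (- p0 + p) = w p - w p0" using g(2)[of "- p0 + p"] that by auto
    then show ?thesis using ga[of "- p0 + p"] by (simp add: inner_simps)
  qed simp
  then show ?thesis by blast
qed simp

lemma affine_eq_on_convex_hull:
  fixes a a' :: "'a::real_inner"
  assumes "\<And>p. p \<in> S \<Longrightarrow> a \<bullet> p + b = a' \<bullet> p + b'" and "x \<in> convex hull S"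
  shows "a \<bullet> x + b = a' \<bullet> x + b'"
proof -
  have "S \<subseteq> {x. (a - a') \<bullet> x = b' - b}"
    using assms(1) by (auto simp: inner_simps algebra_simps)
  then have "convex hull S \<subseteq> {x. (a - a') \<bullet> x = b' - b}"
    by (intro hull_minimal convex_hyperplane)
  then show ?thesis using assms(2) by (auto simp: inner_simps algebra_simps)
qed

lemma inner_eq_on_interior:
  fixes a a' :: "'a::euclidean_space"
  assumes "interior K \<noteq> {}" and "\<And>x y. x \<in> K \<Longrightarrow> y \<in> K \<Longrightarrow> a \<bullet> (x - y) = a' \<bullet> (x - y)"
  shows "a = a'"
proof -
  obtain x r where r: "r > 0" "ball x r \<subseteq> K"
    using assms(1) by (metis all_not_in_conv mem_interior)
  have "a \<bullet> b = a' \<bullet> b" if "b \<in> Basis" for b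
  proof -
    have "x + (r/2) *\<^sub>R b \<in> ball x r" using r that by (simp add: dist_norm)
    then have "a \<bullet> (x + (r/2) *\<^sub>R b - x) = a' \<bullet> (x + (r/2) *\<^sub>R b - x)"
      using r by (intro assms(2)) auto
    then show ?thesis using r by (simp add: inner_simps)
  qed
  then show ?thesis by (rule euclidean_eqI)
qed

lemma AE_not_in_negligible: "negligible Z \<Longrightarrow> AE x in lebesgue. x \<notin> Z"
  unfolding eventually_ae_filter_negligible by (intro exI[of _ Z]) simp

locale triangulated_domain =
  fixes \<Omega> :: "point set" and \<T> :: "point set set"
  assumes domain: "polygonal_lipschitz_domain \<Omega>" and mesh: "conforming_triangulation \<Omega> \<T>"
begin

lemma domain_open: "open \<Omega>" and domain_bounded: "bounded \<Omega>" and domain_nonempty: "\<Omega> \<noteq> {}"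
  using domain by (auto simp: polygonal_lipschitz_domain_def)

lemma domain_lmeasurable: "\<Omega> \<in> lmeasurable"
  using domain_open domain_bounded by (simp add: lmeasurable_open)

lemma mesh_finite: "finite \<T>" and Union_mesh: "\<Union>\<T> = closure \<Omega>"
  using mesh by (auto simp: conforming_triangulation_def triangulation_def)

lemma closure_compact: "compact (closure \<Omega>)"
  using domain_bounded by (simp add: compact_closure)

lemma element:
  assumes "K \<in> \<T>"
  shows "compact K" "convex K" "interior K \<noteq> {}" "K \<subseteq> closure \<Omega>"
    "\<exists>C. finite C \<and> \<not> affine_dependent C \<and> K = convex hull C"
proof -
  have s: "2 simplex K" using assms mesh by (auto simp: conforming_triangulation_def)
  show "compact K" "convex K" using s compact_simplex convex_simplex by blast+
  have "affine hull K = UNIV"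
    using aff_dim_simplex[OF s] aff_dim_eq_full[of K] by simp
  then have "rel_interior K = interior K" by (rule rel_interior_interior)
  moreover have "K \<noteq> {}" using s by auto
  ultimately show "interior K \<noteq> {}" using rel_interior_eq_empty \<open>convex K\<close> by blast
  show "K \<subseteq> closure \<Omega>" using assms Union_mesh by blast
  show "\<exists>C. finite C \<and> \<not> affine_dependent C \<and> K = convex hull C"
    using s by (auto simp: simplex)
qed

lemma element_Int_face: "K \<in> \<T> \<Longrightarrow> K' \<in> \<T> \<Longrightarrow> K \<inter> K' face_of K"
  using mesh by (auto simp: conforming_triangulation_def triangulation_def)

text \<open>The common part is a face of \<open>K\<close> that contains a relative interior point of
  \<open>K\<close>, hence all of \<open>K\<close>. So \<open>K\<close> is a face of
  \<open>K'\<close>, and since \<open>x\<close> is now interior to \<open>K'\<close> as well, the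
  same argument gives the other inclusion.\<close>

lemma element_eqI:
  assumes "K \<in> \<T>" "K' \<in> \<T>" "x \<in> interior K" "x \<in> K'"
  shows "K = K'"
proof -
  have "x \<in> rel_interior K" using assms(3) by (rule subsetD[OF interior_subset_rel_interior])
  then have "K \<subseteq> K \<inter> K'"
    using assms interior_subset[of K] by (intro subset_of_face_of[OF element_Int_face]) auto
  then have "K = K \<inter> K'" by blast
  then have "K face_of K'" using element_Int_face[of K' K] assms by (simp add: Int_commute)
  moreover have "interior K \<subseteq> interior K'" using \<open>K \<subseteq> K \<inter> K'\<close> by (intro interior_mono) auto
  then have "x \<in> rel_interior K'" using assms(3) interior_subset_rel_interior by blast
  moreover have "x \<in> K" using assms(3) interior_subset by blast
  ultimately have "K' \<subseteq> K" using subset_of_face_of[of K K' K'] by blast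
  then show ?thesis using \<open>K \<subseteq> K \<inter> K'\<close> by blast
qed

section \<open>The null set of edges and boundary points\<close>

definition skeleton :: "point set" where
  "skeleton = frontier \<Omega> \<union> (\<Union>K\<in>\<T>. frontier K)"

text \<open>An open set may have a boundary of positive measure; polygonality makes it a finite
  union of segments. Element boundaries are null by convexity.\<close>

lemma negligible_skeleton: "negligible skeleton"
proof -
  obtain S :: "(point \<times> point) set" where S: "finite S" "frontier \<Omega> = (\<Union>(a, b)\<in>S. closed_segment a b)"
    using domain by (auto simp: polygonal_lipschitz_domain_def)
  have "negligible (closed_segment a b)" for a b :: point
  proof -
    have "collinear {a, b}" by simp
    then have "aff_dim (closed_segment a b) \<le> 1"
      by (simp add: segment_convex_hull aff_dim_convex_hull collinear_aff_dim)
    then have "affine hull (closed_segment a b) \<noteq> UNIV"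
      using aff_dim_eq_full[of "closed_segment a b"] by auto
    then have "interior (closed_segment a b) = {}"
      using affine_hull_nonempty_interior by blast
    then have "closed_segment a b \<subseteq> frontier (closed_segment a b)"
      by (simp add: frontier_def)
    then show ?thesis
      using negligible_convex_frontier[of "closed_segment a b"] negligible_subset by blast
  qed
  then have "negligible (frontier \<Omega>)" unfolding S(2) using S(1) by (intro negligible_Union) auto
  moreover have "negligible (\<Union>K\<in>\<T>. frontier K)"
    using mesh_finite element(2) by (intro negligible_Union) (auto intro: negligible_convex_frontier)
  ultimately show ?thesis unfolding skeleton_def by (rule negligible_Un)
qed

lemma AE_regular: "AE x in lborel. x \<notin> skeleton"
  using AE_not_in_negligible[OF negligible_skeleton] by (simp add: AE_completion_iff)

lemma regular_point:
  assumes "x \<notin> skeleton" "x \<in> \<Union>\<T>"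
  shows "\<exists>!K. K \<in> \<T> \<and> x \<in> interior K" "x \<in> \<Omega>"
proof -
  show "x \<in> \<Omega>"
    using assms domain_open unfolding Union_mesh skeleton_def
    by (auto simp: frontier_def interior_open)
  obtain K where "K \<in> \<T>" "x \<in> K" using assms by blast
  then have "x \<in> interior K"
    using assms closure_subset[of K] by (auto simp: skeleton_def frontier_def)
  then show "\<exists>!K. K \<in> \<T> \<and> x \<in> interior K"
    using \<open>K \<in> \<T>\<close> element_eqI interior_subset by blast
qed

section \<open>Gradients of piecewise linear functions\<close>

text \<open>The choice is unambiguous for \<open>v\<close> in \<open>P1\<close> and \<open>K\<close>
  in the mesh, because an element has interior points.\<close>

definition grad :: "(point \<Rightarrow> real) \<Rightarrow> point set \<Rightarrow> point" where
  "grad v K = (SOME a. \<exists>b. \<forall>x\<in>K. v x = a \<bullet> x + b)"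

text \<open>A Borel representative of the piecewise gradient that is defined everywhere: at most one
  summand is nonzero, and the value on edges and outside the mesh is 0.\<close>

definition Grad :: "(point \<Rightarrow> real) \<Rightarrow> point \<Rightarrow> point" where
  "Grad v x = (\<Sum>K\<in>\<T>. indicator (interior K) x *\<^sub>R grad v K)"

abbreviation P1 :: "(point \<Rightarrow> real) set" where "P1 \<equiv> P1_space \<Omega> \<T>"

lemma P1_affine: "v \<in> P1 \<Longrightarrow> K \<in> \<T> \<Longrightarrow> \<exists>b. \<forall>x\<in>K. v x = grad v K \<bullet> x + b"
  unfolding grad_def by (rule someI_ex) (auto simp: P1_space_def)

lemma P1_diff: "v \<in> P1 \<Longrightarrow> K \<in> \<T> \<Longrightarrow> x \<in> K \<Longrightarrow> y \<in> K \<Longrightarrow> v x - v y = grad v K \<bullet> (x - y)"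
  using P1_affine[of v K] by (auto simp: inner_simps)

lemma P1_continuous: "v \<in> P1 \<Longrightarrow> continuous_on (closure \<Omega>) v"
  by (simp add: P1_space_def)

lemma P1_closed:
  shows "(\<lambda>x. 0) \<in> P1" "v \<in> P1 \<Longrightarrow> w \<in> P1 \<Longrightarrow> (\<lambda>x. v x + w x) \<in> P1" "v \<in> P1 \<Longrightarrow> (\<lambda>x. c * v x) \<in> P1"
proof -
  show "(\<lambda>x. 0) \<in> P1" by (auto simp: P1_space_def intro!: exI[of _ 0])
  show "(\<lambda>x. v x + w x) \<in> P1" if vw: "v \<in> P1" "w \<in> P1"
    unfolding P1_space_def
  proof (intro CollectI conjI ballI)
    show "continuous_on (closure \<Omega>) (\<lambda>x. v x + w x)"
      using vw by (intro continuous_intros P1_continuous)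
    fix K assume K: "K \<in> \<T>"
    obtain b b' where "\<forall>x\<in>K. v x = grad v K \<bullet> x + b" "\<forall>x\<in>K. w x = grad w K \<bullet> x + b'"
      using P1_affine vw K by metis
    then have "\<forall>x\<in>K. v x + w x = (grad v K + grad w K) \<bullet> x + (b + b')" by (simp add: inner_simps)
    then show "\<exists>a b. \<forall>x\<in>K. v x + w x = a \<bullet> x + b" by blast
  qed
  show "(\<lambda>x. c * v x) \<in> P1" if v: "v \<in> P1"
    unfolding P1_space_def
  proof (intro CollectI conjI ballI)
    show "continuous_on (closure \<Omega>) (\<lambda>x. c * v x)"
      using v by (intro continuous_intros P1_continuous)
    fix K assume K: "K \<in> \<T>"
    obtain b where "\<forall>x\<in>K. v x = grad v K \<bullet> x + b"
      using P1_affine v K by metis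
    then have "\<forall>x\<in>K. c * v x = (c *\<^sub>R grad v K) \<bullet> x + c * b" by (simp add: algebra_simps)
    then show "\<exists>a b. \<forall>x\<in>K. c * v x = a \<bullet> x + b" by blast
  qed
qed

lemma grad_unique:
  assumes "K \<in> \<T>" "v \<in> P1" "\<And>x y. x \<in> K \<Longrightarrow> y \<in> K \<Longrightarrow> v x - v y = a \<bullet> (x - y)"
  shows "grad v K = a"
  by (rule inner_eq_on_interior[OF element(3)[OF assms(1)]])
     (use P1_diff[OF assms(2,1)] assms(3) in metis)

lemma grad_add: "K \<in> \<T> \<Longrightarrow> v \<in> P1 \<Longrightarrow> w \<in> P1 \<Longrightarrow> grad (\<lambda>x. v x + w x) K = grad v K + grad w K"
  by (intro grad_unique P1_closed) (auto simp: P1_diff[symmetric] inner_add_left)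

lemma grad_scale: "K \<in> \<T> \<Longrightarrow> v \<in> P1 \<Longrightarrow> grad (\<lambda>x. c * v x) K = c *\<^sub>R grad v K"
  by (intro grad_unique P1_closed) (auto simp: P1_diff[symmetric] right_diff_distrib[symmetric])

lemma Grad_add: "v \<in> P1 \<Longrightarrow> w \<in> P1 \<Longrightarrow> Grad (\<lambda>x. v x + w x) x = Grad v x + Grad w x"
  by (simp add: Grad_def grad_add scaleR_add_right sum.distrib)

lemma Grad_scale: "v \<in> P1 \<Longrightarrow> Grad (\<lambda>x. c * v x) x = c *\<^sub>R Grad v x"
  by (simp add: Grad_def grad_scale scaleR_sum_right mult.commute)

lemma Grad_eq:
  assumes "K \<in> \<T>" "x \<in> interior K"
  shows "Grad v x = grad v K"
proof -
  have "Grad v x = (\<Sum>K'\<in>{K}. indicator (interior K') x *\<^sub>R grad v K')"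
    unfolding Grad_def using assms mesh_finite element_eqI[OF assms(1) _ assms(2)] interior_subset
    by (intro sum.mono_neutral_right) (auto simp: indicator_def)
  then show ?thesis using assms by simp
qed

text \<open>A crude, mesh-dependent bound. It serves boundedness, measurability and integrability
  arguments and enters no constant of the final estimate.\<close>

definition grad_bound :: "(point \<Rightarrow> real) \<Rightarrow> real" where
  "grad_bound v = (\<Sum>K\<in>\<T>. norm (grad v K))"

lemma grad_bound: "K \<in> \<T> \<Longrightarrow> norm (grad v K) \<le> grad_bound v" "0 \<le> grad_bound v"
  unfolding grad_bound_def using mesh_finite by (auto intro!: member_le_sum sum_nonneg)

lemma norm_Grad_le: "norm (Grad v x) \<le> grad_bound v"
proof -
  have "norm (Grad v x) \<le> (\<Sum>K\<in>\<T>. norm (indicator (interior K) x *\<^sub>R grad v K))"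
    unfolding Grad_def by (rule norm_sum)
  also have "\<dots> \<le> grad_bound v"
    unfolding grad_bound_def by (intro sum_mono) (auto simp: indicator_def)
  finally show ?thesis .
qed

lemma Grad_measurable [measurable]: "Grad v \<in> borel_measurable borel"
proof -
  have "interior K \<in> sets borel" for K :: "point set" by auto
  then show ?thesis unfolding Grad_def[abs_def] by measurable
qed

text \<open>The parameter interval is covered by the finitely many closed preimages of the elements,
  and Lipschitz bounds on such pieces of an interval glue together. Leaving \<open>M\<close> free
  allows \<open>M = 0\<close>, by which vanishing gradients make \<open>v\<close> constant along the
  segment.\<close>

lemma P1_lipschitz_on_segment:
  assumes v: "v \<in> P1" and seg: "closed_segment x y \<subseteq> closure \<Omega>"
    and M: "\<And>K. K \<in> \<T> \<Longrightarrow> norm (grad v K) \<le> M" "0 \<le> M"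
  shows "\<bar>v x - v y\<bar> \<le> M * norm (x - y)"
proof -
  define p where "p t = x + t *\<^sub>R (y - x)" for t
  have pc: "continuous_on UNIV p" unfolding p_def by (intro continuous_intros)
  have "(M * norm (x - y))-lipschitz_on {0..1} (v \<circ> p)"
  proof (rule lipschitz_on_closed_Union[where U = "\<lambda>K. p -` K \<inter> {0..1}" and I = \<T>])
    fix K assume K: "K \<in> \<T>"
    have "closed K" using element(1)[OF K] compact_imp_closed by blast
    then show "closed (p -` K \<inter> {0..1})"
      using pc by (intro closed_Int closed_vimage) auto
    show "(M * norm (x - y))-lipschitz_on (p -` K \<inter> {0..1}) (v \<circ> p)"
    proof (rule lipschitz_onI)
      fix s t assume "s \<in> p -` K \<inter> {0..1}" "t \<in> p -` K \<inter> {0..1}"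
      then have "v (p s) - v (p t) = grad v K \<bullet> (p s - p t)"
        using P1_diff[OF v K] by simp
      also have "p s - p t = (s - t) *\<^sub>R (y - x)" by (simp add: p_def algebra_simps)
      finally have "\<bar>v (p s) - v (p t)\<bar> = \<bar>s - t\<bar> * \<bar>grad v K \<bullet> (y - x)\<bar>" by (simp add: abs_mult)
      also have "\<dots> \<le> \<bar>s - t\<bar> * (M * norm (x - y))"
      proof (rule mult_left_mono)
        have "\<bar>grad v K \<bullet> (y - x)\<bar> \<le> norm (grad v K) * norm (y - x)" by (rule Cauchy_Schwarz_ineq2)
        also have "\<dots> \<le> M * norm (x - y)"
          using M(1)[OF K] by (simp add: norm_minus_commute mult_right_mono)
        finally show "\<bar>grad v K \<bullet> (y - x)\<bar> \<le> M * norm (x - y)" .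
      qed simp
      finally show "dist ((v \<circ> p) s) ((v \<circ> p) t) \<le> M * norm (x - y) * dist s t"
        by (simp add: dist_real_def mult.commute)
    qed (use M(2) in simp)
  next
    show "{0..1} \<subseteq> (\<Union>K\<in>\<T>. p -` K \<inter> {0..1})"
    proof
      fix t :: real assume t: "t \<in> {0..1}"
      then have "p t \<in> closed_segment x y"
        unfolding closed_segment_def p_def by (auto simp: algebra_simps intro!: exI[of _ t])
      then have "p t \<in> \<Union>\<T>" using seg Union_mesh by blast
      then show "t \<in> (\<Union>K\<in>\<T>. p -` K \<inter> {0..1})" using t by blast
    qed
  qed (use mesh_finite M(2) in auto)
  then have "dist ((v \<circ> p) 0) ((v \<circ> p) 1) \<le> M * norm (x - y) * dist 0 (1::real)"
    by (rule lipschitz_onD) auto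
  then show ?thesis by (simp add: p_def dist_real_def)
qed

lemma domain_norm_bound: "\<exists>R > 0. \<forall>x \<in> closure \<Omega>. norm x \<le> R"
  using closure_compact compact_imp_bounded bounded_pos by blast

lemma P1_bound:
  assumes "v \<in> P1"
  shows "\<exists>B \<ge> 0. \<forall>x \<in> closure \<Omega>. \<bar>v x\<bar> \<le> B"
proof -
  have "bounded (v ` closure \<Omega>)"
    by (rule compact_imp_bounded[OF compact_continuous_image[OF P1_continuous[OF assms] closure_compact]])
  then obtain B where "B > 0" "\<forall>y \<in> v ` closure \<Omega>. norm y \<le> B"
    unfolding bounded_pos by blast
  then show ?thesis by (intro exI[of _ B]) auto
qed

lemma P1_measurable: "v \<in> P1 \<Longrightarrow> v \<in> borel_measurable (lebesgue_on \<Omega>)"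
  using domain_lmeasurable closure_subset[of \<Omega>] P1_continuous
  by (intro continuous_imp_measurable_on_sets_lebesgue) (auto intro: continuous_on_subset)

text \<open>One computation for three uses: \<open>k = 0\<close> gives piecewise linear functions,
  \<open>v = 0\<close> with \<open>k = 1\<close> gives |x|^2, and \<open>v = - U\<close> with
  \<open>k = 1\<close> gives the discretisation error.\<close>

lemma has_weak_gradient_quadratic_plus_P1:
  assumes v: "v \<in> P1"
  shows "has_weak_gradient \<Omega> (\<lambda>x. k * (x \<bullet> x) + v x) (\<lambda>x. (2 * k) *\<^sub>R x + Grad v x)"
  unfolding has_weak_gradient_def
proof
  fix i :: 2
  let ?e = "axis i 1 :: point"
  obtain R where R: "R > 0" "\<And>x. x \<in> closure \<Omega> \<Longrightarrow> norm x \<le> R" using domain_norm_bound by blast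
  obtain B where B: "B \<ge> 0" "\<And>x. x \<in> closure \<Omega> \<Longrightarrow> \<bar>v x\<bar> \<le> B" using P1_bound[OF v] by blast
  have cl: "x \<in> \<Omega> \<Longrightarrow> x \<in> closure \<Omega>" for x using closure_subset by blast
  have Os: "\<Omega> \<in> sets lebesgue" using domain_lmeasurable by auto
  show "has_weak_partial \<Omega> i (\<lambda>x. k * (x \<bullet> x) + v x) (\<lambda>x. ((2 * k) *\<^sub>R x + Grad v x) $ i)"
  \<comment> \<open>\<open>V\<close> adds the bounds for the function and for its derivative, so
    that it serves for both; the factor \<open>2 * R\<close> bounds the norm of \<open>x + y\<close>
    in the difference of squares.\<close>
  proof (rule has_weak_partial_segmentwise_lipschitz[OF domain_open domain_bounded,
        where V = "(\<bar>k\<bar> * R\<^sup>2 + B) + (2 * \<bar>k\<bar> * R + grad_bound v)" and M = "\<bar>k\<bar> * (2 * R) + grad_bound v"])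
    show "(\<lambda>x. k * (x \<bullet> x) + v x) \<in> borel_measurable (lebesgue_on \<Omega>)"
      by (intro borel_measurable_add P1_measurable[OF v] continuous_imp_measurable_on_sets_lebesgue
          continuous_intros Os)
    have "(\<lambda>x. ((2 * k) *\<^sub>R x + Grad v x) $ i) \<in> borel_measurable borel"
      unfolding cart_eq_inner_axis by measurable
    then show "(\<lambda>x. ((2 * k) *\<^sub>R x + Grad v x) $ i) \<in> borel_measurable (lebesgue_on \<Omega>)"
      by (intro measurable_restrict_space1 measurable_completion) simp
    fix x assume x: "x \<in> \<Omega>"
    have "x \<bullet> x \<le> R\<^sup>2"
      using power_mono[OF R(2)[OF cl[OF x]], of 2] by (simp add: power2_norm_eq_inner)
    then have 1: "\<bar>k * (x \<bullet> x)\<bar> \<le> \<bar>k\<bar> * R\<^sup>2" by (simp add: abs_mult mult_left_mono)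
    have "norm ((2 * k) *\<^sub>R x) \<le> 2 * \<bar>k\<bar> * R"
      using R(2)[OF cl[OF x]] by (simp add: abs_mult mult_left_mono)
    moreover have "\<bar>((2 * k) *\<^sub>R x + Grad v x) $ i\<bar> \<le> norm ((2 * k) *\<^sub>R x) + norm (Grad v x)"
      by (rule order_trans[OF component_le_norm_cart norm_triangle_ineq])
    ultimately have 2: "\<bar>((2 * k) *\<^sub>R x + Grad v x) $ i\<bar> \<le> 2 * \<bar>k\<bar> * R + grad_bound v"
      using norm_Grad_le[of v x] by linarith
    have 3: "0 \<le> \<bar>k\<bar> * R\<^sup>2 + B" "0 \<le> 2 * \<bar>k\<bar> * R + grad_bound v"
      using R(1) B(1) grad_bound(2)[of v] by auto
    show "\<bar>k * (x \<bullet> x) + v x\<bar> \<le> (\<bar>k\<bar> * R\<^sup>2 + B) + (2 * \<bar>k\<bar> * R + grad_bound v)"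
      using 1 B(2)[OF cl[OF x]] 3 by linarith
    show "\<bar>((2 * k) *\<^sub>R x + Grad v x) $ i\<bar> \<le> (\<bar>k\<bar> * R\<^sup>2 + B) + (2 * \<bar>k\<bar> * R + grad_bound v)"
      using 2 3 by linarith
  next
    fix x y assume seg: "closed_segment x y \<subseteq> \<Omega>"
    then have xy: "norm x \<le> R" "norm y \<le> R" using R(2) cl by auto
    have "x \<bullet> x - y \<bullet> y = (x + y) \<bullet> (x - y)" by (simp add: inner_simps inner_commute)
    then have "\<bar>x \<bullet> x - y \<bullet> y\<bar> \<le> norm (x + y) * norm (x - y)" using Cauchy_Schwarz_ineq2 by metis
    also have "\<dots> \<le> (2 * R) * norm (x - y)"
      using norm_triangle_ineq[of x y] xy by (intro mult_right_mono) auto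
    finally have "\<bar>k\<bar> * \<bar>x \<bullet> x - y \<bullet> y\<bar> \<le> \<bar>k\<bar> * ((2 * R) * norm (x - y))" by (intro mult_left_mono) auto
    moreover have "\<bar>v x - v y\<bar> \<le> grad_bound v * norm (x - y)"
      using seg closure_subset by (intro P1_lipschitz_on_segment v grad_bound) auto
    moreover have "\<bar>(k * (x \<bullet> x) + v x) - (k * (y \<bullet> y) + v y)\<bar> \<le> \<bar>k\<bar> * \<bar>x \<bullet> x - y \<bullet> y\<bar> + \<bar>v x - v y\<bar>"
    proof -
      have "(k * (x \<bullet> x) + v x) - (k * (y \<bullet> y) + v y) = k * (x \<bullet> x - y \<bullet> y) + (v x - v y)"
        by (simp add: algebra_simps)
      then show ?thesis by (metis abs_mult abs_triangle_ineq)
    qed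
    ultimately show "\<bar>(k * (x \<bullet> x) + v x) - (k * (y \<bullet> y) + v y)\<bar> \<le> (\<bar>k\<bar> * (2 * R) + grad_bound v) * norm (x - y)"
      by (simp add: algebra_simps)
  next
    have "AE x in lebesgue. x \<in> \<Omega> \<longrightarrow> ((\<lambda>t. k * ((x + t *\<^sub>R ?e) \<bullet> (x + t *\<^sub>R ?e)) + v (x + t *\<^sub>R ?e))
        has_real_derivative ((2 * k) *\<^sub>R x + Grad v x) $ i) (at 0)"
      using AE_not_in_negligible[OF negligible_skeleton]
    proof eventually_elim
      case (elim x)
      show ?case
      proof
        assume "x \<in> \<Omega>"
        then have "x \<in> \<Union>\<T>" using cl Union_mesh by blast
        then obtain K where K: "K \<in> \<T>" "x \<in> interior K" using regular_point[OF elim] by blast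
        have "((\<lambda>t. k * (x \<bullet> x + 2 * t * (x \<bullet> ?e) + t * t * (?e \<bullet> ?e)) + (v x + t * (grad v K \<bullet> ?e)))
          has_real_derivative ((2 * k) *\<^sub>R x + grad v K) $ i) (at 0)"
          by (auto intro!: derivative_eq_intros simp: inner_axis)
        then show "((\<lambda>t. k * ((x + t *\<^sub>R ?e) \<bullet> (x + t *\<^sub>R ?e)) + v (x + t *\<^sub>R ?e))
          has_real_derivative ((2 * k) *\<^sub>R x + Grad v x) $ i) (at 0)"
          unfolding Grad_eq[OF K]
        proof (rule has_field_derivative_transform_within_open)
          show "open ((\<lambda>t. x + t *\<^sub>R ?e) -` interior K)"
            by (intro open_vimage continuous_intros) auto
          show "0 \<in> (\<lambda>t. x + t *\<^sub>R ?e) -` interior K" using K by simp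
          fix t assume "t \<in> (\<lambda>t. x + t *\<^sub>R ?e) -` interior K"
          then have "v (x + t *\<^sub>R ?e) - v x = grad v K \<bullet> (x + t *\<^sub>R ?e - x)"
            using K interior_subset by (intro P1_diff v) auto
          then have "v (x + t *\<^sub>R ?e) = v x + t * (grad v K \<bullet> ?e)" by simp
          then show "k * (x \<bullet> x + 2 * t * (x \<bullet> ?e) + t * t * (?e \<bullet> ?e)) + (v x + t * (grad v K \<bullet> ?e)) =
            k * ((x + t *\<^sub>R ?e) \<bullet> (x + t *\<^sub>R ?e)) + v (x + t *\<^sub>R ?e)"
            by (simp add: inner_simps inner_commute algebra_simps)
        qed
      qed
    qed
    then show "AE x in lebesgue_on \<Omega>. ((\<lambda>t. k * ((x + t *\<^sub>R ?e) \<bullet> (x + t *\<^sub>R ?e)) + v (x + t *\<^sub>R ?e))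
        has_real_derivative ((2 * k) *\<^sub>R x + Grad v x) $ i) (at 0)"
      using Os by (subst AE_restrict_space_iff) auto
  qed
qed

text \<open>Applied to the components of \<open>2 *\<^sub>R x\<close>, this yields the second
  derivatives of |x|^2, hence its membership in H^2 and its Laplacian.\<close>

lemma has_weak_partial_linear: "has_weak_partial \<Omega> i (\<lambda>x. a \<bullet> x) (\<lambda>x. a $ i)"
proof -
  obtain R where R: "R > 0" "\<And>x. x \<in> closure \<Omega> \<Longrightarrow> norm x \<le> R" using domain_norm_bound by blast
  have Os: "\<Omega> \<in> sets lebesgue" using domain_lmeasurable by auto
  show ?thesis
  proof (rule has_weak_partial_segmentwise_lipschitz[OF domain_open domain_bounded,
        where V = "norm a * R + norm a" and M = "norm a"])
    show "(\<lambda>x. a \<bullet> x) \<in> borel_measurable (lebesgue_on \<Omega>)"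
      using Os by (intro continuous_imp_measurable_on_sets_lebesgue continuous_intros)
    show "\<bar>a \<bullet> x\<bar> \<le> norm a * R + norm a" if "x \<in> \<Omega>" for x
    proof -
      have "\<bar>a \<bullet> x\<bar> \<le> norm a * norm x" by (rule Cauchy_Schwarz_ineq2)
      also have "\<dots> \<le> norm a * R"
        using R(2)[of x] that closure_subset by (intro mult_left_mono) auto
      finally show ?thesis using norm_ge_zero[of a] by linarith
    qed
    show "\<bar>a $ i\<bar> \<le> norm a * R + norm a" for x :: point
      using component_le_norm_cart[of a i] R(1) norm_ge_zero[of a] by (smt (verit) mult_nonneg_nonneg)
    show "\<bar>a \<bullet> x - a \<bullet> y\<bar> \<le> norm a * norm (x - y)" for x y
      by (metis Cauchy_Schwarz_ineq2 inner_diff_right)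
    have "((\<lambda>t. a \<bullet> (x + t *\<^sub>R axis i 1)) has_real_derivative a $ i) (at 0)" for x
      by (auto simp: inner_simps inner_axis intro!: derivative_eq_intros)
    then show "AE x in lebesgue_on \<Omega>. ((\<lambda>t. a \<bullet> (x + t *\<^sub>R axis i 1)) has_real_derivative a $ i) (at 0)"
      by simp
  qed simp
qed

end

section \<open>The discrete solution\<close>

text \<open>Finite dimension is replaced by a finite set \<open>A\<close> of points such that
  functions vanishing on \<open>A\<close> have zero energy. The induction over \<open>A\<close>
  imposes \<open>v p = 0\<close>, which cuts \<open>W\<close> down to a subspace of codimension at
  most one, and then adds one direction that is \<open>B\<close>-orthogonal to it. The form is only
  semidefinite, as functions may differ off the domain without changing \<open>B\<close>;
  solvability then asks that \<open>r\<close> vanish on functions of zero energy.\<close>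

lemma galerkin_solution:
  fixes B :: "('a \<Rightarrow> real) \<Rightarrow> ('a \<Rightarrow> real) \<Rightarrow> real" and r :: "('a \<Rightarrow> real) \<Rightarrow> real"
  assumes "finite A"
    and "(\<lambda>x. 0) \<in> W"
    and "\<And>v w. v \<in> W \<Longrightarrow> w \<in> W \<Longrightarrow> (\<lambda>x. v x + w x) \<in> W"
    and "\<And>c v. v \<in> W \<Longrightarrow> (\<lambda>x. c * v x) \<in> W"
    and "\<And>v w z. v \<in> W \<Longrightarrow> w \<in> W \<Longrightarrow> z \<in> W \<Longrightarrow> B (\<lambda>x. v x + w x) z = B v z + B w z"
    and "\<And>c v z. v \<in> W \<Longrightarrow> z \<in> W \<Longrightarrow> B (\<lambda>x. c * v x) z = c * B v z"
    and "\<And>v w. v \<in> W \<Longrightarrow> w \<in> W \<Longrightarrow> B v w = B w v"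
    and "\<And>v. v \<in> W \<Longrightarrow> 0 \<le> B v v"
    and "\<And>v w. v \<in> W \<Longrightarrow> w \<in> W \<Longrightarrow> r (\<lambda>x. v x + w x) = r v + r w"
    and "\<And>c v. v \<in> W \<Longrightarrow> r (\<lambda>x. c * v x) = c * r v"
    and "\<And>v. v \<in> W \<Longrightarrow> B v v = 0 \<Longrightarrow> r v = 0"
    and "\<And>v. v \<in> W \<Longrightarrow> (\<And>p. p \<in> A \<Longrightarrow> v p = 0) \<Longrightarrow> B v v = 0"
  shows "\<exists>z \<in> W. \<forall>w \<in> W. B z w = r w"
  using assms
proof (induction A arbitrary: W r rule: finite_induct)
  case (empty W r)
  note h = empty.prems
  have "B (\<lambda>x. 0) w = 0" if "w \<in> W" for w
    using h(5)[of "\<lambda>x. 0" w 0] h(1) that h(5)[of w w 0] by simp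
  moreover have "r w = 0" if "w \<in> W" for w
    using h(10)[of w] h(11)[of w] that by simp
  ultimately show ?case using h(1) by (intro bexI[of _ "\<lambda>x. 0"]) auto
next
  case (insert p A W r)
  note h = insert.prems
  define W' where "W' = {w \<in> W. w p = 0}"
  have sub: "w \<in> W' \<Longrightarrow> w \<in> W" for w by (simp add: W'_def)
  have IH: "\<exists>z \<in> W'. \<forall>w \<in> W'. B z w = r' w"
    if r': "\<And>v w. v \<in> W' \<Longrightarrow> w \<in> W' \<Longrightarrow> r' (\<lambda>x. v x + w x) = r' v + r' w"
      "\<And>c v. v \<in> W' \<Longrightarrow> r' (\<lambda>x. c * v x) = c * r' v"
      "\<And>v. v \<in> W' \<Longrightarrow> B v v = 0 \<Longrightarrow> r' v = 0" for r'
  proof (rule insert.IH)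
    show "(\<lambda>x. 0) \<in> W'" using h(1) by (simp add: W'_def)
    show "(\<lambda>x. v x + w x) \<in> W'" if "v \<in> W'" "w \<in> W'" for v w
      using that h(2) by (simp add: W'_def)
    show "(\<lambda>x. c * v x) \<in> W'" if "v \<in> W'" for c v
      using that h(3) by (simp add: W'_def)
    show "B v v = 0" if "v \<in> W'" "\<And>p. p \<in> A \<Longrightarrow> v p = 0" for v
      using that h(11)[of v] by (auto simp: W'_def)
  qed (use h(4-7) r' sub in auto)
  show ?case
  proof (cases "W' = W")
    case True
    show ?thesis using IH[of r] h(8-10) by (simp add: True)
  next
    case False
    then obtain w0 where w0: "w0 \<in> W" "w0 p \<noteq> 0" by (auto simp: W'_def)
    \<comment> \<open>The degenerate case of Cauchy-Schwarz. If the product were nonzero, the energy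
      of \<open>w0 + t v\<close> would be affine and nonconstant in \<open>t\<close>; the chosen
      \<open>t\<close> makes it -1.\<close>
    have CS: "B w0 v = 0" if v: "v \<in> W" "B v v = 0" for v
    proof (rule ccontr)
      assume nz: "B w0 v \<noteq> 0"
      define t where "t = - (B w0 w0 + 1) / (2 * B w0 v)"
      have tv: "(\<lambda>x. t * v x) \<in> W" using h(3) v by blast
      have s: "(\<lambda>x. w0 x + t * v x) \<in> W" using h(2) w0(1) tv by blast
      have "B (\<lambda>x. w0 x + t * v x) (\<lambda>x. w0 x + t * v x)
          = B w0 (\<lambda>x. w0 x + t * v x) + t * B v (\<lambda>x. w0 x + t * v x)"
        using h(4)[OF w0(1) tv s] h(5)[OF v(1) s] by simp
      also have "\<dots> = B (\<lambda>x. w0 x + t * v x) w0 + t * B (\<lambda>x. w0 x + t * v x) v"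
        using h(6)[OF w0(1) s] h(6)[OF v(1) s] by simp
      also have "\<dots> = B w0 w0 + 2 * t * B w0 v"
        using h(4)[OF w0(1) tv w0(1)] h(4)[OF w0(1) tv v(1)] h(5)[OF v(1) w0(1)] h(5)[OF v(1) v(1)]
          v(2) h(6)[OF v(1) w0(1)] by simp
      also have "\<dots> = -1" using nz by (simp add: t_def field_simps)
      finally show False using h(7)[OF s] by simp
    qed
    \<comment> \<open>The \<open>B\<close>-projection of \<open>w0\<close> to \<open>W'\<close>,
      obtained from the induction hypothesis for the functional \<open>B w0\<close>;
      \<open>CS\<close> is its compatibility condition.\<close>
    obtain q where q: "q \<in> W'" "\<And>w. w \<in> W' \<Longrightarrow> B q w = B w0 w"
    proof -
      have "\<exists>z \<in> W'. \<forall>w \<in> W'. B z w = B w0 w"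
      proof (rule IH)
        fix v w assume vw: "v \<in> W'" "w \<in> W'"
        then have "(\<lambda>x. v x + w x) \<in> W" using h(2) sub by blast
        then show "B w0 (\<lambda>x. v x + w x) = B w0 v + B w0 w"
          using h(4)[of v w w0] h(6)[of w0] w0(1) sub vw by metis
      next
        fix c v assume v: "v \<in> W'"
        then have "(\<lambda>x. c * v x) \<in> W" using h(3) sub by blast
        then show "B w0 (\<lambda>x. c * v x) = c * B w0 v"
          using h(5)[of v w0 c] h(6)[of w0] w0(1) sub v by metis
      qed (use CS sub in auto)
      then show thesis using that by blast
    qed
    define wp where "wp = (\<lambda>x. w0 x + (-1) * q x)"
    have wp: "wp \<in> W" "wp p \<noteq> 0"
      using h(2)[OF w0(1) h(3)[OF sub[OF q(1)], of "-1"]] w0 q(1) by (simp_all add: wp_def W'_def)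
    have orth: "B wp w = 0" if "w \<in> W'" for w
    proof -
      have "(\<lambda>x. (-1) * q x) \<in> W" using h(3) q(1) sub by blast
      then have "B wp w = B w0 w + (-1) * B q w"
        unfolding wp_def using h(4)[OF w0(1), of "\<lambda>x. (-1) * q x" w] h(5)[of q w "-1"] that sub q(1) by simp
      then show ?thesis using q(2)[OF that] by simp
    qed
    obtain z' where z': "z' \<in> W'" "\<And>w. w \<in> W' \<Longrightarrow> B z' w = r w"
    proof -
      have "\<exists>z \<in> W'. \<forall>w \<in> W'. B z w = r w"
        by (rule IH) (use h(8-10) sub in auto)
      then show thesis using that by blast
    qed
    \<comment> \<open>The coefficient that makes the equation hold for the test function
      \<open>wp\<close>. If \<open>wp\<close> has zero energy, then \<open>r wp = 0\<close> and any
      coefficient would do.\<close>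
    define t where "t = (if B wp wp = 0 then 0 else r wp / B wp wp)"
    have t: "t * B wp wp = r wp" using h(10)[OF wp(1)] by (simp add: t_def)
    define z where "z = (\<lambda>x. z' x + t * wp x)"
    have twp: "(\<lambda>x. t * wp x) \<in> W" using h(3) wp by blast
    have zW: "z \<in> W" unfolding z_def using h(2) twp z'(1) sub by blast
    have "B z w = r w" if w: "w \<in> W" for w
    proof -
      define s where "s = w p / wp p"
      define w' where "w' = (\<lambda>x. w x + (- s) * wp x)"
      have w'W: "w' \<in> W'"
      proof -
        have "(\<lambda>x. w x + (- s) * wp x) \<in> W" by (rule h(2)[OF w h(3)[OF wp(1)]])
        moreover have "w p + (- s) * wp p = 0" using wp(2) by (simp add: s_def)
        ultimately show ?thesis unfolding w'_def W'_def by blast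
      qed
      have w_eq: "w = (\<lambda>x. w' x + s * wp x)" by (auto simp: w'_def)
      have swp: "(\<lambda>x. s * wp x) \<in> W" using h(3) wp by blast
      have Bz: "B z v = B z' v + t * B wp v" if "v \<in> W" for v
        unfolding z_def using h(4)[OF _ twp that, of z'] h(5)[OF wp(1) that] z'(1) sub by simp
      have "B z w = B w z" using h(6)[OF zW w] .
      also have "\<dots> = B w' z + s * B wp z"
        using h(4)[OF sub[OF w'W] swp zW] h(5)[OF wp(1) zW, of s] w_eq by metis
      also have "\<dots> = B z w' + s * B z wp"
        using h(6)[OF zW] w'W sub wp(1) by simp
      also have "\<dots> = B z' w' + t * B wp w' + s * (B z' wp + t * B wp wp)"
        using Bz w'W sub wp(1) by simp
      also have "B z' wp = 0" using orth[OF z'(1)] h(6)[OF wp(1)] z'(1) sub by simp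
      also have "B wp w' = 0" using orth w'W by simp
      also have "B z' w' + t * 0 + s * (0 + t * B wp wp) = r w' + s * r wp"
        using z'(2)[OF w'W] t by simp
      also have "\<dots> = r w"
        using h(8)[OF sub[OF w'W] swp] h(9)[OF wp(1), of s] w_eq by metis
      finally show ?thesis .
    qed
    then show ?thesis using zW by blast
  qed
qed

lemma inner_self_2: "(x::point) \<bullet> x = (x $ 1)\<^sup>2 + (x $ 2)\<^sup>2"
  by (simp add: inner_vec_def sum_2 power2_eq_square)

context triangulated_domain
begin

section \<open>Lagrange interpolation\<close>

definition vertices :: "point set" where
  "vertices = (\<Union>K\<in>\<T>. {p. p extreme_point_of K})"

lemma finite_vertices: "finite vertices"
proof -
  have "finite {p. p extreme_point_of K}" if K: "K \<in> \<T>" for K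
  proof -
    obtain C where "finite C" "K = convex hull C" using element(5)[OF K] by blast
    then show ?thesis using extreme_points_of_convex_hull[of C] finite_subset by blast
  qed
  then show ?thesis unfolding vertices_def using mesh_finite by blast
qed

lemma element_hull: "K \<in> \<T> \<Longrightarrow> K = convex hull {p. p extreme_point_of K}"
  by (intro Krein_Milman_Minkowski element)

lemma P1_zero_of_vertices:
  assumes v: "v \<in> P1" and 0: "\<And>p. p \<in> vertices \<Longrightarrow> v p = 0" and x: "x \<in> closure \<Omega>"
  shows "v x = 0"
proof -
  obtain K where K: "K \<in> \<T>" "x \<in> K" using x Union_mesh by blast
  obtain b where b: "\<forall>y\<in>K. v y = grad v K \<bullet> y + b" using P1_affine[OF v K(1)] by blast
  have "grad v K \<bullet> p + b = 0 \<bullet> p + 0" if "p \<in> {p. p extreme_point_of K}" for p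
    using b 0[of p] that K(1) by (auto simp: vertices_def extreme_point_of_def)
  moreover have "x \<in> convex hull {p. p extreme_point_of K}" using element_hull[OF K(1)] K(2) by blast
  ultimately have "grad v K \<bullet> x + b = 0 \<bullet> x + 0" by (rule affine_eq_on_convex_hull)
  then show ?thesis using K(2) b by simp
qed

text \<open>Conformity makes the affine pieces fit: the intersection of two elements is a face of
  both, hence the convex hull of its extreme points, and these are vertices of both elements, where
  the pieces agree.\<close>

lemma lagrange_interpolant_exists: "\<exists>I. is_lagrange_interpolant \<Omega> \<T> w I"
proof -
  have "\<exists>a b. \<forall>p. p extreme_point_of K \<longrightarrow> a \<bullet> p + b = w p" if K: "K \<in> \<T>" for K
  proof -
    obtain C where C: "finite C" "\<not> affine_dependent C" "K = convex hull C" using element(5)[OF K] by blast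
    obtain a b where "\<forall>p\<in>C. a \<bullet> p + b = w p" using affine_interpolation[OF C(2)] by blast
    then show ?thesis using extreme_points_of_convex_hull[of C] C(3) by blast
  qed
  then obtain A B where AB: "\<And>K p. K \<in> \<T> \<Longrightarrow> p extreme_point_of K \<Longrightarrow> A K \<bullet> p + B K = w p"
    by metis
  have glue: "A K \<bullet> x + B K = A K' \<bullet> x + B K'"
    if K: "K \<in> \<T>" "x \<in> K" and K': "K' \<in> \<T>" "x \<in> K'" for K K' x
  proof -
    let ?F = "K \<inter> K'"
    have f: "?F face_of K" "?F face_of K'"
      using element_Int_face[OF K(1) K'(1)] element_Int_face[OF K'(1) K(1)] by (simp_all add: Int_commute)
    have "compact ?F" "convex ?F"
      using element(1,2)[OF K(1)] element(1,2)[OF K'(1)] by (auto intro: compact_Int convex_Int)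
    then have "?F = convex hull {p. p extreme_point_of ?F}" by (rule Krein_Milman_Minkowski)
    then have "x \<in> convex hull {p. p extreme_point_of ?F}" using K K' by blast
    then show ?thesis
    proof (rule affine_eq_on_convex_hull[rotated])
      fix p assume "p \<in> {p. p extreme_point_of ?F}"
      then have "p extreme_point_of K" "p extreme_point_of K'"
        using extreme_point_of_face[OF f(1)] extreme_point_of_face[OF f(2)] by auto
      then show "A K \<bullet> p + B K = A K' \<bullet> p + B K'" using AB K(1) K'(1) by metis
    qed
  qed
  define I where "I x = (let K = (SOME K. K \<in> \<T> \<and> x \<in> K) in A K \<bullet> x + B K)" for x
  have I: "I x = A K \<bullet> x + B K" if "K \<in> \<T>" "x \<in> K" for K x
  proof -
    have "(SOME K. K \<in> \<T> \<and> x \<in> K) \<in> \<T> \<and> x \<in> (SOME K. K \<in> \<T> \<and> x \<in> K)"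
      by (rule someI[of _ K]) (use that in simp)
    then show ?thesis unfolding I_def Let_def using glue that by blast
  qed
  have "continuous_on (\<Union>K\<in>\<T>. K) I"
  proof (rule continuous_on_closed_Union[OF mesh_finite])
    show "closed K" if "K \<in> \<T>" for K using element(1)[OF that] compact_imp_closed by blast
    show "continuous_on K I" if "K \<in> \<T>" for K
    proof -
      have "continuous_on K (\<lambda>x. A K \<bullet> x + B K)" by (intro continuous_intros)
      then show ?thesis using I[OF that] by (simp cong: continuous_on_cong)
    qed
  qed
  then have "I \<in> P1" unfolding P1_space_def using I Union_mesh by auto
  moreover have "I p = w p" if "K \<in> \<T>" "p extreme_point_of K" for K p
    using I[OF that(1)] AB[OF that] that(2) by (simp add: extreme_point_of_def)
  ultimately show ?thesis unfolding is_lagrange_interpolant_def by blast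
qed

text \<open>Subtract from \<open>I\<close> the tangent plane of |y|^2 at \<open>x\<close>. At a
  vertex \<open>p\<close> the difference is |p - x|^2, which lies between 0 and the squared mesh
  size. Being affine, it keeps this range on the whole element, and its value at \<open>x\<close> is
  the interpolation error.\<close>

lemma lagrange_interpolant_error:
  assumes I: "is_lagrange_interpolant \<Omega> \<T> (\<lambda>x. x \<bullet> x) I" and x: "x \<in> closure \<Omega>"
  shows "\<bar>I x - x \<bullet> x\<bar> \<le> (mesh_size \<T>)\<^sup>2"
proof -
  have IP: "I \<in> P1" and Ip: "\<And>K p. K \<in> \<T> \<Longrightarrow> p extreme_point_of K \<Longrightarrow> I p = p \<bullet> p"
    using I by (auto simp: is_lagrange_interpolant_def)
  obtain K where K: "K \<in> \<T>" "x \<in> K" using x Union_mesh by blast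
  obtain b where b: "\<forall>y\<in>K. I y = grad I K \<bullet> y + b" using P1_affine[OF IP K(1)] by blast
  let ?J = "\<lambda>y. (grad I K - 2 *\<^sub>R x) \<bullet> y"
  let ?c = "- b - x \<bullet> x"
  have "?c \<le> ?J p \<and> ?J p \<le> (mesh_size \<T>)\<^sup>2 + ?c" if p: "p extreme_point_of K" for p
  proof -
    have pK: "p \<in> K" using p by (simp add: extreme_point_of_def)
    have "dist p x \<le> diameter K"
      using element(1)[OF K(1)] pK K(2) by (intro diameter_bounded_bound compact_imp_bounded)
    also have "\<dots> \<le> mesh_size \<T>" unfolding mesh_size_def using K mesh_finite by (intro Max_ge) auto
    finally have "(norm (p - x))\<^sup>2 \<le> (mesh_size \<T>)\<^sup>2" by (intro power_mono) (auto simp: dist_norm)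
    moreover have "(norm (p - x))\<^sup>2 = ?J p - ?c"
    proof -
      have "grad I K \<bullet> p + b = p \<bullet> p" using b pK Ip[OF K(1) p] by simp
      then show ?thesis by (simp add: power2_norm_eq_inner inner_simps inner_commute)
    qed
    ultimately show ?thesis using zero_le_power2[of "norm (p - x)"] by linarith
  qed
  then have "{p. p extreme_point_of K} \<subseteq> {y. ?J y \<ge> ?c} \<inter> {y. ?J y \<le> (mesh_size \<T>)\<^sup>2 + ?c}" by blast
  then have "convex hull {p. p extreme_point_of K} \<subseteq> {y. ?J y \<ge> ?c} \<inter> {y. ?J y \<le> (mesh_size \<T>)\<^sup>2 + ?c}"
    by (intro hull_minimal convex_Int convex_halfspace_ge convex_halfspace_le)
  then have "?c \<le> ?J x" "?J x \<le> (mesh_size \<T>)\<^sup>2 + ?c" using element_hull[OF K(1)] K(2) by blast+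
  moreover have "?J x - ?c = I x - x \<bullet> x" using b K(2) by (simp add: inner_simps)
  ultimately show ?thesis by linarith
qed

section \<open>Existence of a discrete solution for a constant right-hand side\<close>

lemma integrable_Grad_inner: "integrable (lebesgue_on \<Omega>) (\<lambda>x. Grad v x \<bullet> Grad w x)"
proof (rule integrable_lebesgue_on_bounded[OF domain_lmeasurable, where B = "grad_bound v * grad_bound w"])
  have "(\<lambda>x. Grad v x \<bullet> Grad w x) \<in> borel_measurable borel" by measurable
  then show "(\<lambda>x. Grad v x \<bullet> Grad w x) \<in> borel_measurable (lebesgue_on \<Omega>)"
    by (intro measurable_restrict_space1 measurable_completion) simp
  show "\<bar>Grad v x \<bullet> Grad w x\<bar> \<le> grad_bound v * grad_bound w" for x
    using Cauchy_Schwarz_ineq2[of "Grad v x" "Grad w x"]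
      mult_mono[OF norm_Grad_le[of v x] norm_Grad_le[of w x]] grad_bound(2)[of v] by auto
qed

lemma integrable_P1: "v \<in> P1 \<Longrightarrow> integrable (lebesgue_on \<Omega>) v"
  using P1_bound[of v] closure_subset[of \<Omega>]
  by (auto intro!: integrable_lebesgue_on_bounded[OF domain_lmeasurable P1_measurable])

text \<open>From \<open>x\<close> a coordinate direction is followed until it first meets the
  boundary, where \<open>v\<close> vanishes; along this segment \<open>v\<close> is Lipschitz with
  constant 0.\<close>

lemma P1_zero_of_grad_zero:
  assumes v: "v \<in> P1" "\<And>x. x \<in> frontier \<Omega> \<Longrightarrow> v x = 0" and g: "\<And>K. K \<in> \<T> \<Longrightarrow> grad v K = 0" and x: "x \<in> \<Omega>"
  shows "v x = 0"
proof -
  have "axis 1 1 \<noteq> (0 :: point)" by (simp add: axis_eq_0_iff)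
  moreover have "x \<in> interior \<Omega>" using x domain_open by (simp add: interior_open)
  ultimately obtain d where d: "0 < d" "x + d *\<^sub>R axis 1 1 \<in> frontier \<Omega>"
    "\<And>e. 0 \<le> e \<Longrightarrow> e < d \<Longrightarrow> x + e *\<^sub>R axis 1 1 \<in> interior \<Omega>"
    using ray_to_frontier[OF domain_bounded] by metis
  have "closed_segment x (x + d *\<^sub>R axis 1 1) \<subseteq> closure \<Omega>"
  proof
    fix y assume "y \<in> closed_segment x (x + d *\<^sub>R axis 1 1)"
    then obtain t where t: "0 \<le> t" "t \<le> 1" "y = x + (t * d) *\<^sub>R axis 1 1"
      by (auto simp: closed_segment_def algebra_simps)
    show "y \<in> closure \<Omega>"
    proof (cases "t = 1")
      case True then show ?thesis using d(2) t by (simp add: frontier_def)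
    next
      case False
      then have "y \<in> interior \<Omega>" unfolding t(3) using t d(1) by (intro d(3)) auto
      then show ?thesis using interior_subset closure_subset by blast
    qed
  qed
  from P1_lipschitz_on_segment[OF v(1) this, of 0] show ?thesis using g v(2)[OF d(2)] by simp
qed

lemma Grad_inner_self_zero:
  assumes "(\<integral>x. Grad v x \<bullet> Grad v x \<partial>lebesgue_on \<Omega>) = 0" and K: "K \<in> \<T>"
  shows "grad v K = 0"
proof -
  have Os: "\<Omega> \<in> sets lebesgue" using domain_lmeasurable by auto
  have "AE x in lebesgue_on \<Omega>. Grad v x \<bullet> Grad v x = 0"
    using assms integrable_Grad_inner integral_nonneg_eq_0_iff_AE[of "lebesgue_on \<Omega>" "\<lambda>x. Grad v x \<bullet> Grad v x"]
    by simp
  then have "AE x in lebesgue. x \<in> \<Omega> \<longrightarrow> Grad v x = 0"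
    using Os by (subst (asm) AE_restrict_space_iff) auto
  then have "AE x in lebesgue. x \<notin> skeleton \<and> (x \<in> \<Omega> \<longrightarrow> Grad v x = 0)"
    using AE_not_in_negligible[OF negligible_skeleton] by eventually_elim blast
  then obtain Z where Z: "negligible Z" "{x. \<not> (x \<notin> skeleton \<and> (x \<in> \<Omega> \<longrightarrow> Grad v x = 0))} \<subseteq> Z"
    unfolding eventually_ae_filter_negligible by blast
  have "\<not> negligible (interior K)"
    using open_not_negligible[of "interior K"] element(3)[OF K] by simp
  then have "\<not> interior K \<subseteq> Z" using Z(1) negligible_subset by blast
  then obtain x where x: "x \<in> interior K" "x \<notin> Z" by blast
  then have "x \<notin> skeleton" "x \<in> \<Omega> \<longrightarrow> Grad v x = 0" using Z(2) by auto
  moreover have "x \<in> \<Union>\<T>" using x K interior_subset by blast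
  ultimately have "Grad v x = 0" using regular_point(2) by blast
  then show ?thesis using Grad_eq[OF K x(1)] by simp
qed

lemma has_weak_gradient_P1: "v \<in> P1 \<Longrightarrow> has_weak_gradient \<Omega> v (Grad v)"
  using has_weak_gradient_quadratic_plus_P1[of v 0] by simp

text \<open>The interpolant lifts the boundary data, so the unknown is a correction \<open>z\<close>
  with zero boundary values, and the energy product with \<open>I\<close> moves to the right-hand
  side.\<close>

lemma poisson_fe_solution_exists:
  fixes c :: real
  assumes I: "is_lagrange_interpolant \<Omega> \<T> w I"
  shows "\<exists>U. is_poisson_fe_solution \<Omega> \<T> (\<lambda>x. c) w U \<and> (\<forall>x\<in>frontier \<Omega>. U x = I x)"
proof -
  have IP: "I \<in> P1" using I by (simp add: is_lagrange_interpolant_def)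
  let ?W = "{v \<in> P1. \<forall>x\<in>frontier \<Omega>. v x = 0}"
  let ?B = "\<lambda>v w. (\<integral>x. Grad v x \<bullet> Grad w x \<partial>lebesgue_on \<Omega>)"
  let ?r = "\<lambda>v. (\<integral>x. c * v x \<partial>lebesgue_on \<Omega>) - ?B I v"
  have "\<exists>z\<in>?W. \<forall>v\<in>?W. ?B z v = ?r v"
  proof (rule galerkin_solution[OF finite_vertices])
    show "(\<lambda>x. 0) \<in> ?W" using P1_closed by auto
    show "(\<lambda>x. v x + w x) \<in> ?W" if "v \<in> ?W" "w \<in> ?W" for v w using that P1_closed(2) by auto
    show "(\<lambda>x. c * v x) \<in> ?W" if "v \<in> ?W" for c v using that P1_closed(3) by auto
    show "?B (\<lambda>x. v x + w x) z = ?B v z + ?B w z" if "v \<in> ?W" "w \<in> ?W" "z \<in> ?W" for v w z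
      using that by (simp add: Grad_add inner_add_left integrable_Grad_inner)
    show "?B (\<lambda>x. c * v x) z = c * ?B v z" if "v \<in> ?W" "z \<in> ?W" for c v z
      using that by (simp add: Grad_scale)
    show "?B v w = ?B w v" for v w by (simp add: inner_commute)
    show "0 \<le> ?B v v" for v by simp
    show "?r (\<lambda>x. v x + w x) = ?r v + ?r w" if "v \<in> ?W" "w \<in> ?W" for v w
      using that by (simp add: Grad_add inner_add_right distrib_left integrable_Grad_inner integrable_P1)
    show "?r (\<lambda>x. k * v x) = k * ?r v" if "v \<in> ?W" for k v
      using that by (simp add: Grad_scale right_diff_distrib mult.left_commute[of c k])
    \<comment> \<open>Zero energy gives \<open>v = 0\<close> on \<Omega>, not as a total function;
      this is enough because \<open>?r\<close> sees only integrals over \<Omega>.\<close>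
    show "?r v = 0" if "v \<in> ?W" "?B v v = 0" for v
    proof -
      have g: "\<And>K. K \<in> \<T> \<Longrightarrow> grad v K = 0" using Grad_inner_self_zero that(2) by blast
      then have "Grad v x = 0" for x by (simp add: Grad_def)
      moreover have "(\<integral>x. c * v x \<partial>lebesgue_on \<Omega>) = (\<integral>x. 0 \<partial>lebesgue_on \<Omega>)"
        using P1_zero_of_grad_zero[OF _ _ g] that(1) by (intro Bochner_Integration.integral_cong) auto
      ultimately show ?thesis by simp
    qed
    show "?B v v = 0" if "v \<in> ?W" "\<And>p. p \<in> vertices \<Longrightarrow> v p = 0" for v
    proof -
      have "grad v K = 0" if "K \<in> \<T>" for K
      proof (rule grad_unique[OF that])
        show "v \<in> P1" using \<open>v \<in> ?W\<close> by simp
        have "v x = 0" if "x \<in> K" for x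
        proof (rule P1_zero_of_vertices)
          show "v \<in> P1" using \<open>v \<in> ?W\<close> by simp
          show "x \<in> closure \<Omega>" using that element(4)[OF \<open>K \<in> \<T>\<close>] by blast
        qed fact
        then show "v x - v y = 0 \<bullet> (x - y)" if "x \<in> K" "y \<in> K" for x y using that by simp
      qed
      then show ?thesis by (simp add: Grad_def)
    qed
  qed
  then obtain z where z: "z \<in> P1" "\<And>x. x \<in> frontier \<Omega> \<Longrightarrow> z x = 0" "\<And>v. v \<in> ?W \<Longrightarrow> ?B z v = ?r v"
    by blast
  define U where "U x = I x + z x" for x
  have UP: "U \<in> P1" unfolding U_def[abs_def] by (rule P1_closed(2)[OF IP z(1)])
  have Ufr: "\<forall>x\<in>frontier \<Omega>. U x = I x" by (simp add: U_def z(2))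
  have "?B U v = (\<integral>x. c * v x \<partial>lebesgue_on \<Omega>)" if "v \<in> ?W" for v
    using z(3)[OF that] IP z(1) unfolding U_def[abs_def]
    by (simp add: Grad_add inner_add_left integrable_Grad_inner)
  then have "is_poisson_fe_solution \<Omega> \<T> (\<lambda>x. c) w U"
    unfolding is_poisson_fe_solution_def
    using UP I Ufr has_weak_gradient_P1 by (intro conjI exI[of _ I] exI[of _ "Grad U"]) auto
  then show ?thesis using Ufr by blast
qed

section \<open>The model function |x|^2 and its regularity\<close>

lemma Grad_zero: "Grad (\<lambda>x. 0) x = 0"
  using Grad_scale[OF P1_closed(1), of 0] by simp

lemma has_weak_gradient_norm_square: "has_weak_gradient \<Omega> (\<lambda>x. x \<bullet> x) (\<lambda>x. 2 *\<^sub>R x)"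
  using has_weak_gradient_quadratic_plus_P1[OF P1_closed(1), of 1] by (simp add: Grad_zero)

lemma has_weak_partial_component: "has_weak_partial \<Omega> j (\<lambda>x. (2 *\<^sub>R x) $ i) (\<lambda>x. (2 *\<^sub>R axis i 1 :: point) $ j)"
  using has_weak_partial_linear[of j "2 *\<^sub>R axis i 1"] by (simp add: inner_axis' )

lemma norm_square_in_sobolev: "(\<lambda>x. x \<bullet> x) \<in> sobolev 2 \<Omega>"
proof -
  have "(\<lambda>x. (2 *\<^sub>R x) $ i) \<in> sobolev (Suc 0) \<Omega>" for i
    unfolding sobolev.simps
  proof (intro CollectI allI)
    fix j
    have "square_integrable \<Omega> (\<lambda>x. (2 *\<^sub>R axis i 1 :: point) $ j)"
      using has_weak_partial_component[of j i] unfolding has_weak_partial_def by blast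
    then show "\<exists>g\<in>{u. square_integrable \<Omega> u}. has_weak_partial \<Omega> j (\<lambda>x. (2 *\<^sub>R x) $ i) g"
      using has_weak_partial_component[of j i] by blast
  qed
  then show ?thesis
    unfolding numeral_2_eq_2 sobolev.simps(2)[of "Suc 0"]
    using has_weak_gradient_norm_square unfolding has_weak_gradient_def by blast
qed

text \<open>The square of the L2 norm on \<open>K\<close> of the gradient of |x|^2 - U; no root is
  taken, so that contributions of distinct elements add up.\<close>

definition element_error :: "(point \<Rightarrow> real) \<Rightarrow> point set \<Rightarrow> real" where
  "element_error U K = (\<integral>x. indicator K x * (norm (2 *\<^sub>R x - grad U K))\<^sup>2 \<partial>lborel)"

text \<open>
  The error of the gradient, summed over all elements containing the point: it is defined
  everywhere and bounds the derivative of the error along any line.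
\<close>

definition error_density :: "(point \<Rightarrow> real) \<Rightarrow> point \<Rightarrow> real" where
  "error_density U x = (\<Sum>K\<in>\<T>. indicator K x * norm (2 *\<^sub>R x - grad U K))"

lemma element_borel: "K \<in> \<T> \<Longrightarrow> K \<in> sets borel"
  using element(1) by (simp add: borel_compact)

lemma error_density_measurable [measurable]: "error_density U \<in> borel_measurable borel"
  using element_borel unfolding error_density_def[abs_def] by measurable

lemma error_density_nonneg: "0 \<le> error_density U x"
  unfolding error_density_def by (intro sum_nonneg) auto

lemma element_error_integrable:
  assumes "K \<in> \<T>"
  shows "integrable lborel (\<lambda>x. indicator K x * (norm (2 *\<^sub>R x - grad U K))\<^sup>2)"
  using borel_integrable_compact[of K "\<lambda>x. (norm (2 *\<^sub>R x - grad U K))\<^sup>2"] element(1)[OF assms]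
  by (simp add: set_integrable_def indicator_def continuous_intros if_distrib cong: if_cong)

lemma element_error_nonneg: "0 \<le> element_error U K"
  unfolding element_error_def by (intro Bochner_Integration.integral_nonneg) auto

text \<open>Off the skeleton a point lies in at most one element, so the square of the sum is the
  sum of the squares.\<close>

lemma AE_error_density:
  "AE x in lborel. (error_density U x)\<^sup>2 = (\<Sum>K\<in>\<T>. indicator K x * (norm (2 *\<^sub>R x - grad U K))\<^sup>2)
    \<and> indicator \<Omega> x * (norm (2 *\<^sub>R x - Grad U x))\<^sup>2 = (\<Sum>K\<in>\<T>. indicator K x * (norm (2 *\<^sub>R x - grad U K))\<^sup>2)"
  using AE_regular
proof eventually_elim
  case (elim x)
  show ?case
  proof (cases "x \<in> \<Union>\<T>")
    case True
    then obtain K where K: "K \<in> \<T>" "x \<in> interior K" "x \<in> \<Omega>" using regular_point[OF elim] by blast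
    have only: "(\<Sum>K'\<in>\<T>. indicator K' x * f K') = f K" for f :: "point set \<Rightarrow> real"
    proof -
      have "(\<Sum>K'\<in>\<T>. indicator K' x * f K') = (\<Sum>K'\<in>{K}. indicator K' x * f K')"
        using mesh_finite K element_eqI[OF K(1) _ K(2)]
        by (intro sum.mono_neutral_right) (auto simp: indicator_def)
      moreover have "x \<in> K" using K(2) interior_subset by blast
      ultimately show ?thesis by simp
    qed
    show ?thesis unfolding error_density_def only using K Grad_eq[OF K(1,2)] by simp
  next
    case False
    then have "x \<notin> \<Omega>" using Union_mesh closure_subset by blast
    moreover have "indicator K x = (0 :: real)" if "K \<in> \<T>" for K using False that by auto
    ultimately show ?thesis by (simp add: error_density_def)
  qed
qed

lemma error_density_square:
  "(\<integral>\<^sup>+x. ennreal (error_density U x) ^ 2 \<partial>lborel) = ennreal (\<Sum>K\<in>\<T>. element_error U K)"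
proof -
  have "(\<integral>\<^sup>+x. ennreal (error_density U x) ^ 2 \<partial>lborel)
      = (\<integral>\<^sup>+x. ennreal (\<Sum>K\<in>\<T>. indicator K x * (norm (2 *\<^sub>R x - grad U K))\<^sup>2) \<partial>lborel)"
  proof (rule nn_integral_cong_AE)
    show "AE x in lborel. ennreal (error_density U x) ^ 2
        = ennreal (\<Sum>K\<in>\<T>. indicator K x * (norm (2 *\<^sub>R x - grad U K))\<^sup>2)"
      using AE_error_density[of U]
    proof eventually_elim
      case (elim x)
      then show ?case by (simp only: ennreal_power error_density_nonneg)
    qed
  qed
  also have "\<dots> = ennreal (\<integral>x. (\<Sum>K\<in>\<T>. indicator K x * (norm (2 *\<^sub>R x - grad U K))\<^sup>2) \<partial>lborel)"
    by (intro nn_integral_eq_integral Bochner_Integration.integrable_sum element_error_integrable)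
       (auto intro!: AE_I2 sum_nonneg)
  also have "(\<integral>x. (\<Sum>K\<in>\<T>. indicator K x * (norm (2 *\<^sub>R x - grad U K))\<^sup>2) \<partial>lborel) = (\<Sum>K\<in>\<T>. element_error U K)"
    unfolding element_error_def by (intro Bochner_Integration.integral_sum element_error_integrable)
  finally show ?thesis .
qed

lemma seminorm_error:
  "(\<integral>x. (norm (2 *\<^sub>R x - Grad U x))\<^sup>2 \<partial>lebesgue_on \<Omega>) = (\<Sum>K\<in>\<T>. element_error U K)"
proof -
  have [measurable]: "\<Omega> \<in> sets borel" using domain_open by simp
  have "(\<integral>x. (norm (2 *\<^sub>R x - Grad U x))\<^sup>2 \<partial>lebesgue_on \<Omega>)
      = (\<integral>x. indicator \<Omega> x * (norm (2 *\<^sub>R x - Grad U x))\<^sup>2 \<partial>lebesgue)"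
    using domain_lmeasurable by (subst integral_restrict_space) (auto simp: fmeasurable_def)
  also have "\<dots> = (\<integral>x. indicator \<Omega> x * (norm (2 *\<^sub>R x - Grad U x))\<^sup>2 \<partial>lborel)"
    by (rule integral_completion) measurable
  also have "\<dots> = (\<integral>x. (\<Sum>K\<in>\<T>. indicator K x * (norm (2 *\<^sub>R x - grad U K))\<^sup>2) \<partial>lborel)"
    using AE_error_density[of U] element_borel by (intro integral_cong_AE) (measurable, auto)
  also have "\<dots> = (\<Sum>K\<in>\<T>. element_error U K)"
    unfolding element_error_def by (intro Bochner_Integration.integral_sum element_error_integrable)
  finally show ?thesis .
qed

lemma discrete_solution_norm_square:
  obtains U where "is_discrete_solution \<Omega> \<T> (\<lambda>x. x \<bullet> x) U" "U \<in> P1"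
    "\<And>x. x \<in> frontier \<Omega> \<Longrightarrow> \<bar>x \<bullet> x - U x\<bar> \<le> (mesh_size \<T>)\<^sup>2"
    "has_H1_seminorm \<Omega> (\<lambda>x. x \<bullet> x - U x) (sqrt (\<Sum>K\<in>\<T>. element_error U K))"
proof -
  define H :: "point \<Rightarrow> point" where "H x = (\<chi> i. 2)" for x
  define l where "l x = (\<Sum>i\<in>UNIV. H x $ i)" for x
  obtain I where I: "is_lagrange_interpolant \<Omega> \<T> (\<lambda>x. x \<bullet> x) I" using lagrange_interpolant_exists by blast
  \<comment> \<open>The Laplacian \<open>l\<close> is constant, so evaluating it at 0 supplies the
    constant load for which existence was shown.\<close>
  obtain U where U: "is_poisson_fe_solution \<Omega> \<T> (\<lambda>x. - l 0) (\<lambda>x. x \<bullet> x) U" "\<forall>x\<in>frontier \<Omega>. U x = I x"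
    using poisson_fe_solution_exists[OF I] by blast
  have UP: "U \<in> P1" using U by (simp add: is_poisson_fe_solution_def)
  have "has_weak_partial \<Omega> i (\<lambda>x. (2 *\<^sub>R x) $ i) (\<lambda>x. H x $ i)" for i
    using has_weak_partial_component[of i i] by (simp add: H_def)
  then have "has_weak_laplacian \<Omega> (\<lambda>x. x \<bullet> x) l"
    unfolding has_weak_laplacian_def l_def[abs_def] using has_weak_gradient_norm_square by blast
  moreover have "is_poisson_fe_solution \<Omega> \<T> (\<lambda>x. - l x) (\<lambda>x. x \<bullet> x) U"
    using U(1) by (simp add: l_def H_def)
  moreover have "continuous_on (closure \<Omega>) (\<lambda>x. x \<bullet> x)" by (intro continuous_intros)
  ultimately have 1: "is_discrete_solution \<Omega> \<T> (\<lambda>x. x \<bullet> x) U"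
    unfolding is_discrete_solution_def by (intro exI[of _ l] exI[of _ "\<lambda>x. x \<bullet> x"]) simp
  have 2: "\<bar>x \<bullet> x - U x\<bar> \<le> (mesh_size \<T>)\<^sup>2" if "x \<in> frontier \<Omega>" for x
    using lagrange_interpolant_error[OF I, of x] that U(2) by (simp add: frontier_def abs_minus_commute)
  have "has_weak_gradient \<Omega> (\<lambda>x. x \<bullet> x - U x) (\<lambda>x. 2 *\<^sub>R x - Grad U x)"
    using has_weak_gradient_quadratic_plus_P1[OF P1_closed(3)[OF UP, of "-1"], of 1] Grad_scale[OF UP, of "-1"]
    by simp
  then have 3: "has_H1_seminorm \<Omega> (\<lambda>x. x \<bullet> x - U x) (sqrt (\<Sum>K\<in>\<T>. element_error U K))"
    unfolding has_H1_seminorm_def seminorm_error[symmetric] by blast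
  show thesis using that 1 UP 2 3 by blast
qed

end

section \<open>The slope of the discrete solution along a line\<close>

lemma nn_integral_axes:
  assumes [measurable]: "g \<in> borel_measurable borel"
  shows "(\<integral>\<^sup>+x. g x \<partial>lborel) = (\<integral>\<^sup>+t. \<integral>\<^sup>+y. g (t *\<^sub>R axis 1 1 + y *\<^sub>R axis 2 1 :: point) \<partial>lborel \<partial>lborel)"
proof -
  let ?f = "\<lambda>(t, y). t *\<^sub>R axis 1 1 + y *\<^sub>R axis 2 1 :: point"
  have fm [measurable]: "?f \<in> measurable (lborel :: (real \<times> real) measure) borel"
  proof -
    have "continuous_on UNIV ?f" unfolding case_prod_beta by (intro continuous_intros)
    then show ?thesis by (simp add: borel_measurable_continuous_onI)
  qed
  have B: "Basis = {axis 1 1, axis 2 1 :: point}"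
    by (auto simp: Basis_vec_def UNIV_2)
  have ax: "(axis 2 1 :: point) $ 1 = 0" "(axis 1 1 :: point) $ 2 = 0" by (simp_all add: axis_def)
  have neq: "axis 1 1 \<noteq> (axis 2 1 :: point)" by (simp add: axis_eq_axis)
  have "lborel = distr (lborel :: (real \<times> real) measure) borel ?f"
  proof (rule lborel_eqI)
    fix l u :: point assume le: "\<And>b. b \<in> Basis \<Longrightarrow> l \<bullet> b \<le> u \<bullet> b"
    have le': "l $ 1 \<le> u $ 1" "l $ 2 \<le> u $ 2"
      using le[of "axis 1 1"] le[of "axis 2 1"] by (auto simp: B inner_axis)
    have pre: "?f -` box l u = box (l $ 1, l $ 2) (u $ 1, u $ 2)"
      using ax by (auto simp: box_def B Basis_prod_def inner_axis inner_axis_axis inner_add_left)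
    have "emeasure (distr lborel borel ?f) (box l u) = emeasure lborel (box (l $ 1, l $ 2) (u $ 1, u $ 2))"
      by (subst emeasure_distr) (auto simp: pre)
    also have "\<dots> = ennreal ((u $ 1 - l $ 1) * (u $ 2 - l $ 2))"
      using le' by (subst emeasure_lborel_box) (auto simp: Basis_prod_def)
    also have "\<dots> = ennreal (\<Prod>b\<in>Basis. (u - l) \<bullet> b)"
      using neq by (simp add: B inner_axis)
    finally show "emeasure (distr lborel borel ?f) (box l u) = ennreal (\<Prod>b\<in>Basis. (u - l) \<bullet> b)" .
  qed simp
  then have "(\<integral>\<^sup>+x. g x \<partial>lborel) = (\<integral>\<^sup>+x. g x \<partial>distr (lborel :: (real \<times> real) measure) borel ?f)"
    by simp
  also have "\<dots> = (\<integral>\<^sup>+p. g (?f p) \<partial>lborel)" by (rule nn_integral_distr) measurable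
  also have "\<dots> = (\<integral>\<^sup>+p. g (?f p) \<partial>(lborel \<Otimes>\<^sub>M lborel))" by (simp only: lborel_prod)
  also have "\<dots> = (\<integral>\<^sup>+t. \<integral>\<^sup>+y. g (?f (t, y)) \<partial>lborel \<partial>lborel)"
  proof (rule lborel.nn_integral_fst[symmetric])
    show "(\<lambda>p. g (?f p)) \<in> borel_measurable (lborel \<Otimes>\<^sub>M lborel)"
      unfolding lborel_prod by measurable
  qed
  finally show ?thesis by simp
qed

lemma lborel_distr_orthogonal:
  fixes f :: "real^'n::{finite,wellorder} \<Rightarrow> real^'n::_"
  assumes f: "orthogonal_transformation f"
  shows "distr lborel borel f = lborel"
proof (rule lborel_eqI[symmetric])
  have "linear f" using f by (simp add: orthogonal_transformation_linear)
  then have [measurable]: "f \<in> borel_measurable borel"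
    by (intro borel_measurable_continuous_onI linear_continuous_on) (simp add: linear_conv_bounded_linear)
  fix l u :: "real^'n::_" assume le: "\<And>b. b \<in> Basis \<Longrightarrow> l \<bullet> b \<le> u \<bullet> b"
  have bij: "bij f" using f by (rule orthogonal_transformation_bij)
  have g: "orthogonal_transformation (inv f)" using f by (rule orthogonal_transformation_inv)
  have B: "box l u \<in> lmeasurable" by simp
  have pre: "f -` box l u = inv f ` box l u"
    using bij by (simp add: bij_vimage_eq_inv_image)
  have "emeasure (distr lborel borel f) (box l u) = emeasure lborel (f -` box l u)"
    by (subst emeasure_distr) auto
  also have "\<dots> = emeasure lebesgue (f -` box l u)"
  proof -
    have "f -` box l u \<in> sets borel" by (rule measurable_sets_borel[of f borel]) auto
    then show ?thesis by simp
  qed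
  also have "\<dots> = ennreal (measure lebesgue (inv f ` box l u))"
    unfolding pre using measurable_orthogonal_image[OF g B]
    by (intro emeasure_eq_measure2) auto
  also have "\<dots> = ennreal (measure lebesgue (box l u))"
    by (simp only: measure_orthogonal_image[OF g B])
  also have "\<dots> = ennreal (\<Prod>b\<in>Basis. (u - l) \<bullet> b)"
    using le by (simp add: measure_lborel_box)
  finally show "emeasure (distr lborel borel f) (box l u) = ennreal (\<Prod>b\<in>Basis. (u - l) \<bullet> b)" .
qed simp

lemma orthogonal_transformation_orthonormal:
  fixes d n :: point
  assumes on: "norm d = 1" "norm n = 1" "d \<bullet> n = 0"
  shows "orthogonal_transformation (\<lambda>x::point. (x $ 1) *\<^sub>R d + (x $ 2) *\<^sub>R n)"
proof -
  let ?f = "\<lambda>x::point. (x $ 1) *\<^sub>R d + (x $ 2) *\<^sub>R n"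
  have ip: "d \<bullet> d = 1" "n \<bullet> n = 1" "n \<bullet> d = 0"
    using on by (auto simp: norm_eq_1 inner_commute)
  have "linear ?f" by (intro linearI) (auto simp: algebra_simps)
  moreover have "?f v \<bullet> ?f w = v \<bullet> w" for v w :: point
  proof -
    have "?f v \<bullet> ?f w = v $ 1 * w $ 1 + v $ 2 * w $ 2"
      using ip on by (simp add: inner_add_left inner_add_right)
    then show ?thesis by (simp add: inner_vec_def[of v w] sum_2)
  qed
  ultimately show ?thesis by (simp add: orthogonal_transformation_def)
qed

text \<open>Combines translation by \<open>a\<close>, the rotation taking the axes to
  \<open>d\<close> and \<open>n\<close>, and Fubini. It converts integrals over normal rays starting
  on the base line into plane integrals.\<close>

lemma nn_integral_orthonormal:
  fixes d n a :: point
  assumes [measurable]: "g \<in> borel_measurable borel" and on: "norm d = 1" "norm n = 1" "d \<bullet> n = 0"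
  shows "(\<integral>\<^sup>+x. g x \<partial>lborel) = (\<integral>\<^sup>+t. \<integral>\<^sup>+y. g (a + t *\<^sub>R d + y *\<^sub>R n) \<partial>lborel \<partial>lborel)"
proof -
  let ?f = "\<lambda>x::point. (x $ 1) *\<^sub>R d + (x $ 2) *\<^sub>R n"
  have o: "orthogonal_transformation ?f" by (rule orthogonal_transformation_orthonormal[OF on])
  then have "linear ?f" by (rule orthogonal_transformation_linear)
  then have fm [measurable]: "?f \<in> borel_measurable borel"
    by (intro borel_measurable_continuous_onI linear_continuous_on) (simp add: linear_conv_bounded_linear)
  have "(\<integral>\<^sup>+x. g x \<partial>lborel) = (\<integral>\<^sup>+x. g x \<partial>distr lborel borel ((+) a))" by (simp only: lborel_distr_plus)
  also have "\<dots> = (\<integral>\<^sup>+x. g (a + x) \<partial>lborel)" by (rule nn_integral_distr) measurable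
  also have "\<dots> = (\<integral>\<^sup>+x. g (a + x) \<partial>distr lborel borel ?f)" by (simp only: lborel_distr_orthogonal[OF o])
  also have "\<dots> = (\<integral>\<^sup>+x. g (a + ?f x) \<partial>lborel)" by (rule nn_integral_distr) measurable
  also have "\<dots> = (\<integral>\<^sup>+t. \<integral>\<^sup>+y. g (a + ?f (t *\<^sub>R axis 1 1 + y *\<^sub>R axis 2 1)) \<partial>lborel \<partial>lborel)"
    by (rule nn_integral_axes) measurable
  finally show ?thesis by (simp add: axis_def add.assoc)
qed

section \<open>Estimates on the real line\<close>

lemma finite_frontier_compact_interval:
  fixes J :: "real set"
  assumes "compact J" "convex J"
  shows "finite (frontier J)"
proof -
  obtain a b where "J = cbox a b"
    using assms is_interval_compact[of J] is_interval_convex_1[of J] by auto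
  then have "frontier J \<subseteq> {a, b}" by (auto simp: frontier_def)
  then show ?thesis using finite_subset by blast
qed

lemma consecutive_intervals_cover:
  fixes \<tau> :: "nat \<Rightarrow> real"
  shows "{\<tau> 0..\<tau> (Suc N)} \<subseteq> (\<Union>i\<in>{0..N}. {\<tau> i..\<tau> (Suc i)})"
proof (induction N)
  case (Suc N)
  have "{\<tau> 0..\<tau> (Suc (Suc N))} \<subseteq> {\<tau> 0..\<tau> (Suc N)} \<union> {\<tau> (Suc N)..\<tau> (Suc (Suc N))}" by auto
  then show ?case using Suc by (fastforce simp: atLeast0_atMost_Suc)
qed simp

lemma variation_bound:
  fixes m :: "nat \<Rightarrow> real"
  assumes "i \<le> N"
  shows "\<bar>m i - m 0\<bar> \<le> (\<Sum>j\<in>{1..N}. \<bar>m j - m (j - 1)\<bar>)"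
proof -
  have "\<bar>m i - m 0\<bar> \<le> (\<Sum>j\<in>{1..i}. \<bar>m j - m (j - 1)\<bar>)" by (induction i) auto
  also have "\<dots> \<le> (\<Sum>j\<in>{1..N}. \<bar>m j - m (j - 1)\<bar>)" using assms by (intro sum_mono2) auto
  finally show ?thesis .
qed

text \<open>The quadratic has second difference \<open>2 * k\<^sup>2\<close>. Up to a linear
  function \<psi> is \<open>V\<close>-Lipschitz, so its second difference is at most
  \<open>2 * V * k\<close>, hence at most \<open>k\<^sup>2\<close>, and \<open>k\<^sup>2\<close>
  remains for \<open>e\<close>. The interval has length \<open>3 * k\<close> so that all three nodes
  lie in it for every \<open>s\<close> in \<open>{0..k}\<close>.\<close>

lemma second_difference_lower_bound:
  fixes \<psi> :: "real \<Rightarrow> real"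
  assumes lip: "V-lipschitz_on {0..3 * k} (\<lambda>t. \<psi> t - m * t)" and V: "V \<le> k / 2" and s: "0 \<le> s" "s \<le> k"
    and e: "\<And>t. e t = t\<^sup>2 + b * t + c - \<psi> t"
  shows "k\<^sup>2 \<le> \<bar>e s\<bar> + 2 * \<bar>e (s + k)\<bar> + \<bar>e (s + 2 * k)\<bar>"
proof -
  have k: "0 \<le> k" using s by linarith
  have Vk: "V * k \<le> (k / 2) * k" using V k by (rule mult_right_mono)
  have "dist (\<psi> (s + k) - m * (s + k)) (\<psi> s - m * s) \<le> V * dist (s + k) s"
    "dist (\<psi> (s + 2 * k) - m * (s + 2 * k)) (\<psi> (s + k) - m * (s + k)) \<le> V * dist (s + 2 * k) (s + k)"
    using s k by (intro lipschitz_onD[OF lip]; simp)+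
  then have "\<bar>(\<psi> (s + k) - m * (s + k)) - (\<psi> s - m * s)\<bar> \<le> V * k"
    "\<bar>(\<psi> (s + 2 * k) - m * (s + 2 * k)) - (\<psi> (s + k) - m * (s + k))\<bar> \<le> V * k"
    using k by (auto simp: dist_real_def)
  then have "\<bar>\<psi> (s + 2 * k) - 2 * \<psi> (s + k) + \<psi> s\<bar> \<le> 2 * (V * k)"
    by (simp add: algebra_simps)
  then have 1: "\<bar>\<psi> (s + 2 * k) - 2 * \<psi> (s + k) + \<psi> s\<bar> \<le> k\<^sup>2"
    using Vk by (simp add: power2_eq_square)
  have "e (s + 2 * k) - 2 * e (s + k) + e s = 2 * k\<^sup>2 - (\<psi> (s + 2 * k) - 2 * \<psi> (s + k) + \<psi> s)"
    unfolding e by (simp add: power2_eq_square algebra_simps)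
  then show ?thesis using 1 by (smt (verit))
qed

lemma ennreal_le_of_square_le:
  fixes X :: ennreal
  assumes "X\<^sup>2 \<le> ennreal (c\<^sup>2)" "0 \<le> c"
  shows "X \<le> ennreal c"
proof (cases X)
  case (real x)
  then have "ennreal (x\<^sup>2) \<le> ennreal (c\<^sup>2)" using assms by (simp add: ennreal_power)
  then have "x\<^sup>2 \<le> c\<^sup>2" by (simp add: ennreal_le_iff)
  then show ?thesis using real assms(2) power2_le_imp_le by (simp add: ennreal_leI)
next
  case top
  then show ?thesis using assms by (simp add: power2_eq_square ennreal_top_mult top_unique)
qed

context triangulated_domain
begin

section \<open>The error along rays and the variation of the slope\<close>

lemma error_density_ge:
  assumes "K \<in> \<T>" "x \<in> K"
  shows "norm (2 *\<^sub>R x - grad U K) \<le> error_density U x"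
proof -
  have "(\<Sum>K'\<in>{K}. indicator K' x * norm (2 *\<^sub>R x - grad U K')) \<le> error_density U x"
    unfolding error_density_def using mesh_finite assms by (intro sum_mono2) auto
  then show ?thesis using assms by simp
qed

lemma error_density_bound: "\<exists>B. \<forall>x. error_density U x \<le> B"
proof -
  obtain R where R: "R > 0" "\<And>x. x \<in> closure \<Omega> \<Longrightarrow> norm x \<le> R" using domain_norm_bound by blast
  have "error_density U x \<le> (\<Sum>K\<in>\<T>. 2 * R + norm (grad U K))" for x
    unfolding error_density_def
  proof (rule sum_mono)
    fix K assume K: "K \<in> \<T>"
    show "indicator K x * norm (2 *\<^sub>R x - grad U K) \<le> 2 * R + norm (grad U K)"
    proof (cases "x \<in> K")
      case True
      then have "norm x \<le> R" using R(2) element(4)[OF K] by blast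
      then show ?thesis using True norm_triangle_ineq4[of "2 *\<^sub>R x" "grad U K"] by simp
    qed (use R(1) in simp)
  qed
  then show ?thesis by blast
qed

text \<open>
  Along the ray the error is differentiable except at the finitely many end points of the
  intersections of the ray with the elements, even if the ray runs along edges.
\<close>

lemma error_le_ray_integral:
  assumes U: "U \<in> P1" and fr: "\<And>x. x \<in> frontier \<Omega> \<Longrightarrow> \<bar>x \<bullet> x - U x\<bar> \<le> \<eta>"
    and D: "\<And>x y. x \<in> closure \<Omega> \<Longrightarrow> y \<in> closure \<Omega> \<Longrightarrow> norm (x - y) \<le> D"
    and n: "norm n = 1" and x: "x \<in> closure \<Omega>"
  shows "ennreal \<bar>x \<bullet> x - U x\<bar> \<le> ennreal \<eta> + (\<integral>\<^sup>+y\<in>{0..D}. ennreal (error_density U (x + y *\<^sub>R n)) \<partial>lborel)"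
proof (cases "x \<in> frontier \<Omega>")
  case True
  then have "ennreal \<bar>x \<bullet> x - U x\<bar> \<le> ennreal \<eta>" using fr by (simp add: ennreal_leI)
  then show ?thesis by (rule add_increasing2[rotated]) simp
next
  case False
  then have xO: "x \<in> interior \<Omega>" using x by (simp add: frontier_def)
  have "n \<noteq> 0" using n by auto
  obtain d where d: "0 < d" "x + d *\<^sub>R n \<in> frontier \<Omega>"
    "\<And>e. 0 \<le> e \<Longrightarrow> e < d \<Longrightarrow> x + e *\<^sub>R n \<in> interior \<Omega>"
    using ray_to_frontier[OF domain_bounded xO \<open>n \<noteq> 0\<close>] by metis
  have dD: "d \<le> D" using D[of "x + d *\<^sub>R n" x] d(1,2) n x by (simp add: frontier_def)
  define p where "p y = x + y *\<^sub>R n" for y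
  define \<phi> where "\<phi> y = p y \<bullet> p y - U (p y)" for y
  define S where "S = (\<Union>K\<in>\<T>. frontier (p -` K))"
  \<comment> \<open>At the exceptional parameters the value 0 is used, so that the bound by the
    nonnegative density holds at every parameter.\<close>
  define f' where "f' y = (if y \<in> {0<..<d} - S then vector_derivative \<phi> (at y) else 0)" for y
  have pc: "continuous_on UNIV p" unfolding p_def by (intro continuous_intros)
  have pcl: "p y \<in> closure \<Omega>" if "y \<in> {0..d}" for y
  proof (cases "y = d")
    case True then show ?thesis using d(2) by (simp add: p_def frontier_def)
  next
    case False
    then have "p y \<in> interior \<Omega>" using that unfolding p_def by (intro d(3)) auto
    then show ?thesis using interior_subset closure_subset by blast
  qed
  \<comment> \<open>The line through the ray meets each element in a compact interval of parameters,
    which has at most two frontier points.\<close>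
  have finS: "finite S" unfolding S_def
  proof (rule finite_UN_I[OF mesh_finite], rule finite_frontier_compact_interval)
    fix K assume K: "K \<in> \<T>"
    have lin: "linear (\<lambda>y. y *\<^sub>R n)" by (intro linearI) (auto simp: algebra_simps)
    have "p -` K = (\<lambda>y. y *\<^sub>R n) -` ((\<lambda>z. - x + z) ` K)"
      by (force simp: p_def image_iff)
    then show "convex (p -` K)"
      using element(2)[OF K] lin by (auto intro: convex_linear_vimage convex_translation)
    have "closed (p -` K)"
      using element(1)[OF K] pc by (intro closed_vimage) (auto simp: compact_imp_closed)
    moreover have "bounded (p -` K)"
    proof -
      obtain R where R: "R > 0" "\<And>z. z \<in> closure \<Omega> \<Longrightarrow> norm z \<le> R" using domain_norm_bound by blast
      have "\<bar>y\<bar> \<le> R + norm x" if "p y \<in> K" for y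
      proof -
        have "\<bar>y\<bar> = norm (p y - x)" using n by (simp add: p_def)
        also have "\<dots> \<le> norm (p y) + norm x" by (rule norm_triangle_ineq4)
        finally show ?thesis using R(2)[of "p y"] that element(4)[OF K] by force
      qed
      then show ?thesis unfolding bounded_iff by (intro exI[of _ "R + norm x"]) auto
    qed
    ultimately show "compact (p -` K)" by (simp add: compact_eq_bounded_closed)
  qed
  have der: "(\<phi> has_vector_derivative (2 *\<^sub>R p y - grad U K) \<bullet> n) (at y)"
    if K: "K \<in> \<T>" "y \<in> interior (p -` K)" for K y
  proof -
    have yK: "p y \<in> K" using K interior_subset by blast
    let ?q = "\<lambda>z. (p y \<bullet> p y + 2 * (z - y) * (p y \<bullet> n) + (z - y) * (z - y) * (n \<bullet> n)) - (U (p y) + (z - y) * (grad U K \<bullet> n))"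
    have "(?q has_real_derivative (2 *\<^sub>R p y - grad U K) \<bullet> n) (at y)"
      by (auto intro!: derivative_eq_intros simp: inner_simps)
    then have "(\<phi> has_real_derivative (2 *\<^sub>R p y - grad U K) \<bullet> n) (at y)"
    proof (rule has_field_derivative_transform_within_open)
      show "open (interior (p -` K))" "y \<in> interior (p -` K)" using K by auto
      fix z assume "z \<in> interior (p -` K)"
      then have "p z \<in> K" using interior_subset by blast
      have pz: "p z = p y + (z - y) *\<^sub>R n" by (simp add: p_def algebra_simps)
      have "U (p z) - U (p y) = grad U K \<bullet> (p z - p y)" by (rule P1_diff[OF U K(1) \<open>p z \<in> K\<close> yK])
      then have "U (p z) = U (p y) + (z - y) * (grad U K \<bullet> n)" by (simp add: pz)
      then show "?q z = \<phi> z" unfolding \<phi>_def by (simp add: pz inner_simps inner_commute algebra_simps)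
    qed
    then show ?thesis by (simp add: has_real_derivative_iff_has_vector_derivative)
  qed
  have inK: "\<exists>K\<in>\<T>. y \<in> interior (p -` K)" if "y \<in> {0<..<d} - S" for y
  proof -
    have "p y \<in> \<Union>\<T>" using pcl[of y] that Union_mesh by auto
    then obtain K where K: "K \<in> \<T>" "y \<in> p -` K" by blast
    then have "y \<notin> frontier (p -` K)" using that by (auto simp: S_def)
    then show ?thesis using K closure_subset[of "p -` K"] by (auto simp: frontier_def)
  qed
  have "(f' has_integral (\<phi> d - \<phi> 0)) {0..d}"
  proof (rule fundamental_theorem_of_calculus_interior_strong[OF finS])
    show "(\<phi> has_vector_derivative f' y) (at y)" if y: "y \<in> {0<..<d} - S" for y
    proof -
      obtain K where "K \<in> \<T>" "y \<in> interior (p -` K)" using inK[OF y] by blast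
      from der[OF this] show ?thesis using y by (simp add: f'_def vector_derivative_at)
    qed
    have "continuous_on {0..d} (\<lambda>y. U (p y))"
      using pcl by (intro continuous_on_compose2[OF P1_continuous[OF U]] continuous_on_subset[OF pc]) auto
    then show "continuous_on {0..d} \<phi>"
      unfolding \<phi>_def using continuous_on_subset[OF pc, of "{0..d}"] by (intro continuous_intros) auto
  qed (use d(1) in simp)
  then have f': "f' integrable_on {0..d}" "integral {0..d} f' = \<phi> d - \<phi> 0" by (auto simp: has_integral_iff)
  let ?g = "\<lambda>y. error_density U (p y)"
  have gi: "?g integrable_on {0..d}"
  proof -
    obtain B where B: "\<And>x. error_density U x \<le> B" using error_density_bound by blast
    have [measurable]: "p \<in> borel_measurable borel" using pc by (simp add: borel_measurable_continuous_onI)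
    have "?g \<in> borel_measurable borel" by measurable
    then have "?g \<in> borel_measurable (lebesgue_on {0..d})"
      by (intro measurable_restrict_space1 measurable_completion) simp
    then show ?thesis
      by (rule measurable_bounded_by_integrable_imp_integrable[where g = "\<lambda>_. B"])
         (auto simp: error_density_nonneg B)
  qed
  have "norm (integral {0..d} f') \<le> integral {0..d} ?g"
  proof (rule integral_norm_bound_integral[OF f'(1) gi])
    fix y assume "y \<in> {0..d}"
    show "norm (f' y) \<le> ?g y"
    proof (cases "y \<in> {0<..<d} - S")
      case True
      then obtain K where K: "K \<in> \<T>" "y \<in> interior (p -` K)" using inK by blast
      then have "p y \<in> K" using interior_subset by blast
      have "\<bar>(2 *\<^sub>R p y - grad U K) \<bullet> n\<bar> \<le> norm (2 *\<^sub>R p y - grad U K)"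
        using Cauchy_Schwarz_ineq2[of "2 *\<^sub>R p y - grad U K" n] n by simp
      also have "\<dots> \<le> ?g y" by (rule error_density_ge[OF K(1) \<open>p y \<in> K\<close>])
      finally show ?thesis using der[OF K] True by (simp add: f'_def vector_derivative_at)
    qed (auto simp: f'_def error_density_nonneg)
  qed
  then have "\<bar>\<phi> 0\<bar> \<le> \<bar>\<phi> d\<bar> + integral {0..d} ?g" using f'(2) by simp
  moreover have "\<bar>\<phi> d\<bar> \<le> \<eta>" using fr[OF d(2)] by (simp add: \<phi>_def p_def)
  ultimately have le: "\<bar>x \<bullet> x - U x\<bar> \<le> \<eta> + integral {0..d} ?g" by (simp add: \<phi>_def p_def)
  have g0: "0 \<le> integral {0..d} ?g" by (intro integral_nonneg[OF gi] error_density_nonneg)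
  have \<eta>0: "0 \<le> \<eta>" using fr[OF d(2)] by linarith
  have "ennreal \<bar>x \<bullet> x - U x\<bar> \<le> ennreal \<eta> + ennreal (integral {0..d} ?g)"
    using le g0 \<eta>0 by (simp add: ennreal_plus[symmetric] ennreal_leI del: ennreal_plus)
  also have "ennreal (integral {0..d} ?g) = (\<integral>\<^sup>+y\<in>{0..d}. ennreal (?g y) \<partial>lborel)"
    using gi by (intro nn_integral_has_integral_lebesgue'[symmetric] error_density_nonneg integrable_integral)
  \<comment> \<open>Passing from the exit parameter \<open>d\<close> to the uniform bound
    \<open>D\<close> frees the domain of integration from \<open>x\<close>; over all base points it
    becomes a rectangle.\<close>
  also have "\<dots> \<le> (\<integral>\<^sup>+y\<in>{0..D}. ennreal (?g y) \<partial>lborel)"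
    using dD by (intro nn_integral_mono) (auto simp: indicator_def)
  finally show ?thesis unfolding p_def by (simp add: add_left_mono)
qed

text \<open>Cauchy-Schwarz against the indicator \<open>S\<close> of a rectangle with sides
  \<open>L\<close> and \<open>D\<close> in the frame \<open>(a, d, n)\<close>, whose area enters
  through its square root.\<close>

lemma strip_integral_le:
  assumes E: "(\<Sum>K\<in>\<T>. element_error U K) \<le> \<epsilon>\<^sup>2" and \<epsilon>: "0 \<le> \<epsilon>" and on: "norm d = 1" "norm n = 1" "d \<bullet> n = 0"
    and LD: "0 \<le> L" "0 \<le> D"
  shows "(\<integral>\<^sup>+t\<in>{0..L}. (\<integral>\<^sup>+y\<in>{0..D}. ennreal (error_density U (a + t *\<^sub>R d + y *\<^sub>R n)) \<partial>lborel) \<partial>lborel)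
      \<le> ennreal (\<epsilon> * sqrt (L * D))"
proof -
  define S :: "point \<Rightarrow> ennreal" where "S x = indicator {0..L} ((x - a) \<bullet> d) * indicator {0..D} ((x - a) \<bullet> n)" for x
  have ip: "d \<bullet> d = 1" "n \<bullet> n = 1" "n \<bullet> d = 0"
    using on by (auto simp: norm_eq_1 inner_commute)
  have Sm [measurable]: "S \<in> borel_measurable borel" unfolding S_def[abs_def] by measurable
  have S: "S (a + t *\<^sub>R d + y *\<^sub>R n) = indicator {0..L} t * indicator {0..D} y" for t y
    using ip on by (simp add: S_def inner_simps)
  have "(\<integral>\<^sup>+x. S x ^ 2 \<partial>lborel) = (\<integral>\<^sup>+x. S x \<partial>lborel)"
    by (intro nn_integral_cong) (auto simp: S_def indicator_def)
  also have "\<dots> = (\<integral>\<^sup>+t. \<integral>\<^sup>+y. indicator {0..L} t * indicator {0..D} y \<partial>lborel \<partial>lborel)"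
    by (subst nn_integral_orthonormal[OF Sm on, of a]) (simp only: S)
  also have "\<dots> = ennreal (L * D)"
    using LD by (simp add: nn_integral_cmult nn_integral_multc ennreal_mult)
  finally have area: "(\<integral>\<^sup>+x. S x ^ 2 \<partial>lborel) = ennreal (L * D)" .
  have "(\<integral>\<^sup>+t\<in>{0..L}. (\<integral>\<^sup>+y\<in>{0..D}. ennreal (error_density U (a + t *\<^sub>R d + y *\<^sub>R n)) \<partial>lborel) \<partial>lborel)
      = (\<integral>\<^sup>+t. \<integral>\<^sup>+y. ennreal (error_density U (a + t *\<^sub>R d + y *\<^sub>R n)) * S (a + t *\<^sub>R d + y *\<^sub>R n) \<partial>lborel \<partial>lborel)"
    unfolding S by (intro nn_integral_cong) (auto simp: indicator_def)
  also have "\<dots> = (\<integral>\<^sup>+x. ennreal (error_density U x) * S x \<partial>lborel)"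
    by (rule nn_integral_orthonormal[symmetric, OF _ on]) measurable
  finally have eq: "(\<integral>\<^sup>+t\<in>{0..L}. (\<integral>\<^sup>+y\<in>{0..D}. ennreal (error_density U (a + t *\<^sub>R d + y *\<^sub>R n)) \<partial>lborel) \<partial>lborel)
      = (\<integral>\<^sup>+x. ennreal (error_density U x) * S x \<partial>lborel)" .
  have "(\<integral>\<^sup>+x. ennreal (error_density U x) * S x \<partial>lborel)\<^sup>2
      \<le> (\<integral>\<^sup>+x. ennreal (error_density U x) ^ 2 \<partial>lborel) * (\<integral>\<^sup>+x. S x ^ 2 \<partial>lborel)"
    by (rule Cauchy_Schwarz_nn_integral) measurable
  also have "\<dots> \<le> ennreal (\<epsilon>\<^sup>2) * ennreal (L * D)"
    unfolding area error_density_square using E by (intro mult_right_mono ennreal_leI) auto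
  also have "\<dots> = ennreal ((\<epsilon> * sqrt (L * D))\<^sup>2)"
    using LD by (simp add: ennreal_mult[symmetric] power_mult_distrib)
  finally show ?thesis unfolding eq
  proof (rule ennreal_le_of_square_le)
    show "0 \<le> \<epsilon> * sqrt (L * D)" using \<epsilon> LD by simp
  qed
qed

text \<open>The second-difference bound is integrated over \<open>s\<close> in
  \<open>{0..k}\<close>. Each of the three shifted integrals is at most the integral over the whole
  base line of length \<open>3 * k\<close>, and the weights 1 + 2 + 1 give the factor 4 in both
  terms.\<close>

lemma slope_variation_lower_bound:
  assumes U: "U \<in> P1" and fr: "\<And>x. x \<in> frontier \<Omega> \<Longrightarrow> \<bar>x \<bullet> x - U x\<bar> \<le> \<eta>" and \<eta>: "0 \<le> \<eta>"
    and D: "\<And>x y. x \<in> closure \<Omega> \<Longrightarrow> y \<in> closure \<Omega> \<Longrightarrow> norm (x - y) \<le> D"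
    and E: "(\<Sum>K\<in>\<T>. element_error U K) \<le> \<epsilon>\<^sup>2" and \<epsilon>: "0 \<le> \<epsilon>"
    and on: "norm d = 1" "norm n = 1" "d \<bullet> n = 0"
    and \<tau>: "\<tau> 0 = 0" "\<tau> (Suc N) = 3 * k" "0 \<le> k"
    and Ks: "\<And>i. i \<le> N \<Longrightarrow> Ks i \<in> \<T> \<and> a + \<tau> i *\<^sub>R d \<in> Ks i \<and> a + \<tau> (Suc i) *\<^sub>R d \<in> Ks i"
    and V: "(\<Sum>i\<in>{1..N}. \<bar>grad U (Ks i) \<bullet> d - grad U (Ks (i - 1)) \<bullet> d\<bar>) \<le> k / 2"
  shows "k ^ 3 \<le> 4 * \<eta> * k + 4 * (\<epsilon> * sqrt (3 * k * D))"
proof -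
  define V where "V = (\<Sum>i\<in>{1..N}. \<bar>grad U (Ks i) \<bullet> d - grad U (Ks (i - 1)) \<bullet> d\<bar>)"
  define m where "m i = grad U (Ks i) \<bullet> d" for i
  define \<psi> where "\<psi> t = U (a + t *\<^sub>R d)" for t
  define A where "A t = (\<integral>\<^sup>+y\<in>{0..D}. ennreal (error_density U (a + t *\<^sub>R d + y *\<^sub>R n)) \<partial>lborel)" for t
  have V0: "0 \<le> V" unfolding V_def by (intro sum_nonneg) auto
  have D0: "0 \<le> D" using D domain_nonempty closure_subset by (metis diff_self ex_in_conv norm_zero subsetD)
  have inKs: "a + t *\<^sub>R d \<in> Ks i" if i: "i \<le> N" and t: "t \<in> {\<tau> i..\<tau> (Suc i)}" for i t
  proof -
    have "t \<in> closed_segment (\<tau> i) (\<tau> (Suc i))" using t by (auto simp: closed_segment_eq_real_ivl)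
    then obtain u where u: "0 \<le> u" "u \<le> 1" "t = (1 - u) * \<tau> i + u * \<tau> (Suc i)"
      by (auto simp: closed_segment_def)
    have "a + t *\<^sub>R d = (1 - u) *\<^sub>R (a + \<tau> i *\<^sub>R d) + u *\<^sub>R (a + \<tau> (Suc i) *\<^sub>R d)"
      unfolding u(3) by (simp add: algebra_simps)
    then have "a + t *\<^sub>R d \<in> closed_segment (a + \<tau> i *\<^sub>R d) (a + \<tau> (Suc i) *\<^sub>R d)"
      unfolding closed_segment_def using u(1,2) by blast
    moreover have "closed_segment (a + \<tau> i *\<^sub>R d) (a + \<tau> (Suc i) *\<^sub>R d) \<subseteq> Ks i"
      using Ks[OF i] element(2) by (intro closed_segment_subset) auto
    ultimately show ?thesis by blast
  qed
  have cover: "{0..3 * k} \<subseteq> (\<Union>i\<in>{0..N}. {\<tau> i..\<tau> (Suc i)})"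
    using consecutive_intervals_cover[of \<tau> N] \<tau> by simp
  have cl: "a + t *\<^sub>R d \<in> closure \<Omega>" if t: "t \<in> {0..3 * k}" for t
  proof -
    have "t \<in> (\<Union>i\<in>{0..N}. {\<tau> i..\<tau> (Suc i)})" using cover t by (rule subsetD)
    then obtain i where i: "i \<le> N" "t \<in> {\<tau> i..\<tau> (Suc i)}" by (auto simp del: atLeastAtMost_iff simp: atLeastAtMost_iff[of _ 0 N])
    then have "a + t *\<^sub>R d \<in> Ks i" by (rule inKs)
    then show ?thesis using Ks[OF i(1)] element(4) by blast
  qed
  \<comment> \<open>The first slope \<open>m 0\<close> serves as reference: by telescoping, no later
    slope differs from it by more than the total variation \<open>V\<close>.\<close>
  have lip: "V-lipschitz_on {0..3 * k} (\<lambda>t. \<psi> t - m 0 * t)"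
  proof (rule lipschitz_on_closed_Union[OF _ _ _ V0 cover])
    fix i assume "i \<in> {0..N}"
    then have i: "i \<le> N" by simp
    show "V-lipschitz_on {\<tau> i..\<tau> (Suc i)} (\<lambda>t. \<psi> t - m 0 * t)"
    proof (rule lipschitz_onI[OF _ V0])
      fix s t assume st: "s \<in> {\<tau> i..\<tau> (Suc i)}" "t \<in> {\<tau> i..\<tau> (Suc i)}"
      have "\<psi> s - \<psi> t = grad U (Ks i) \<bullet> ((a + s *\<^sub>R d) - (a + t *\<^sub>R d))"
        unfolding \<psi>_def using Ks[OF i] inKs[OF i] st by (intro P1_diff[OF U]) auto
      then have "(\<psi> s - m 0 * s) - (\<psi> t - m 0 * t) = (m i - m 0) * (s - t)"
        by (simp add: m_def algebra_simps)
      then have "dist (\<psi> s - m 0 * s) (\<psi> t - m 0 * t) = \<bar>m i - m 0\<bar> * dist s t"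
        by (simp add: dist_real_def abs_mult)
      also have "\<dots> \<le> V * dist s t"
        using variation_bound[OF i, of m] unfolding V_def m_def by (intro mult_right_mono) auto
      finally show "dist (\<psi> s - m 0 * s) (\<psi> t - m 0 * t) \<le> V * dist s t" .
    qed
  qed auto
  define e where "e t = (a + t *\<^sub>R d) \<bullet> (a + t *\<^sub>R d) - U (a + t *\<^sub>R d)" for t
  have e: "e t = t\<^sup>2 + 2 * (a \<bullet> d) * t + a \<bullet> a - \<psi> t" for t
  proof -
    have "d \<bullet> d = 1" using on by (simp add: norm_eq_1)
    then show ?thesis by (simp add: e_def \<psi>_def inner_simps inner_commute power2_eq_square algebra_simps)
  qed
  have eA: "ennreal \<bar>e t\<bar> \<le> ennreal \<eta> + A t" if "t \<in> {0..3 * k}" for t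
    unfolding e_def A_def by (rule error_le_ray_integral[OF U fr D on(2) cl[OF that]])
  have Am [measurable]: "A \<in> borel_measurable borel"
    unfolding A_def[abs_def] by measurable
  have pw: "ennreal (k\<^sup>2) \<le> ennreal (4 * \<eta>) + (A s + 2 * A (s + k) + A (s + 2 * k))" if s: "s \<in> {0..k}" for s
  proof -
    have "k\<^sup>2 \<le> \<bar>e s\<bar> + 2 * \<bar>e (s + k)\<bar> + \<bar>e (s + 2 * k)\<bar>"
      using s V by (intro second_difference_lower_bound[OF lip _ _ _ e]) (auto simp: V_def)
    then have "ennreal (k\<^sup>2) \<le> ennreal (\<bar>e s\<bar> + 2 * \<bar>e (s + k)\<bar> + \<bar>e (s + 2 * k)\<bar>)"
      by (rule ennreal_leI)
    also have "\<dots> = ennreal \<bar>e s\<bar> + 2 * ennreal \<bar>e (s + k)\<bar> + ennreal \<bar>e (s + 2 * k)\<bar>"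
      by (simp add: ennreal_mult)
    also have "\<dots> \<le> (ennreal \<eta> + A s) + 2 * (ennreal \<eta> + A (s + k)) + (ennreal \<eta> + A (s + 2 * k))"
      using s by (intro add_mono mult_left_mono eA) auto
    also have "\<dots> = ennreal (4 * \<eta>) + (A s + 2 * A (s + k) + A (s + 2 * k))"
    proof -
      have "ennreal (4 * \<eta>) = 4 * ennreal \<eta>" using \<eta> by (simp add: ennreal_mult)
      also have "\<dots> = (1 + 2 + 1) * ennreal \<eta>" by simp
      also have "\<dots> = ennreal \<eta> + 2 * ennreal \<eta> + ennreal \<eta>" by (simp only: distrib_right mult_1)
      finally show ?thesis by (simp only: distrib_left ac_simps)
    qed
    finally show ?thesis .
  qed
  define T where "T = (\<integral>\<^sup>+t\<in>{0..3 * k}. A t \<partial>lborel)"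
  have shift: "(\<integral>\<^sup>+s\<in>{0..k}. A (s + c) \<partial>lborel) \<le> T" if c: "0 \<le> c" "c \<le> 2 * k" for c
  proof -
    have "T = ennreal \<bar>1\<bar> * (\<integral>\<^sup>+s. A (c + 1 * s) * indicator {0..3 * k} (c + 1 * s) \<partial>lborel)"
      unfolding T_def by (rule nn_integral_real_affine) auto
    also have "\<dots> = (\<integral>\<^sup>+s. A (s + c) * indicator {0..3 * k} (s + c) \<partial>lborel)" by (simp add: add.commute)
    also have "\<dots> \<ge> (\<integral>\<^sup>+s\<in>{0..k}. A (s + c) \<partial>lborel)"
      using c by (intro nn_integral_mono) (auto simp: indicator_def)
    finally show ?thesis .
  qed
  have "ennreal (k ^ 3) = (\<integral>\<^sup>+s\<in>{0..k}. ennreal (k\<^sup>2) \<partial>lborel)"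
    using \<tau>(3) by (simp add: nn_integral_cmult_indicator ennreal_mult[symmetric] power3_eq_cube power2_eq_square)
  also have "\<dots> \<le> (\<integral>\<^sup>+s\<in>{0..k}. (ennreal (4 * \<eta>) + (A s + 2 * A (s + k) + A (s + 2 * k))) \<partial>lborel)"
    using pw by (intro nn_integral_mono) (auto simp: indicator_def)
  also have "\<dots> = (\<integral>\<^sup>+s\<in>{0..k}. ennreal (4 * \<eta>) \<partial>lborel) + ((\<integral>\<^sup>+s\<in>{0..k}. A (s + 0) \<partial>lborel)
      + 2 * (\<integral>\<^sup>+s\<in>{0..k}. A (s + k) \<partial>lborel) + (\<integral>\<^sup>+s\<in>{0..k}. A (s + 2 * k) \<partial>lborel))"
    by (simp add: distrib_right nn_integral_add nn_integral_cmult mult.assoc)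
  also have "\<dots> \<le> ennreal (4 * \<eta> * k) + (T + 2 * T + T)"
    using \<eta> \<tau>(3) by (intro add_mono mult_left_mono shift) (auto simp: nn_integral_cmult_indicator ennreal_mult)
  also have "T + 2 * T + T = (1 + 2 + 1) * T" by (simp only: distrib_right mult_1)
  also have "(1 + 2 + 1) * T = 4 * T" by simp
  also have "ennreal (4 * \<eta> * k) + 4 * T \<le> ennreal (4 * \<eta> * k) + 4 * ennreal (\<epsilon> * sqrt (3 * k * D))"
    unfolding T_def A_def using strip_integral_le[OF E \<epsilon> on, of "3 * k" D a] \<tau>(3) D0
    by (intro add_left_mono mult_left_mono) auto
  also have "\<dots> = ennreal (4 * \<eta> * k + 4 * (\<epsilon> * sqrt (3 * k * D)))"
    using \<eta> \<epsilon> \<tau>(3) D0 by (simp add: ennreal_mult)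
  finally show ?thesis
    using \<eta> \<epsilon> \<tau>(3) D0 by (subst (asm) ennreal_le_iff) auto
qed

end

section \<open>The band estimate\<close>

lemma nn_integral_lborel_scale:
  fixes f :: "'a::euclidean_space \<Rightarrow> ennreal"
  assumes [measurable]: "f \<in> borel_measurable borel" and c: "c \<noteq> 0"
  shows "(\<integral>\<^sup>+x. f x \<partial>lborel) = ennreal (\<bar>c\<bar> ^ DIM('a)) * (\<integral>\<^sup>+x. f (t + c *\<^sub>R x) \<partial>lborel)"
proof -
  have "(\<integral>\<^sup>+x. f x \<partial>lborel) = (\<integral>\<^sup>+x. f x \<partial>density (distr lborel borel (\<lambda>x. t + c *\<^sub>R x)) (\<lambda>_. ennreal (\<bar>c\<bar> ^ DIM('a))))"
    using lborel_affine[OF c, of t] by simp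
  also have "\<dots> = (\<integral>\<^sup>+x. ennreal (\<bar>c\<bar> ^ DIM('a)) * f (t + c *\<^sub>R x) \<partial>lborel)"
    by (simp add: nn_integral_density nn_integral_distr)
  finally show ?thesis by (simp add: nn_integral_cmult)
qed

lemma orthonormal_expansion:
  fixes d n v :: point
  assumes "norm d = 1" "norm n = 1" "d \<bullet> n = 0"
  shows "v = (v \<bullet> d) *\<^sub>R d + (v \<bullet> n) *\<^sub>R n"
proof -
  let ?f = "\<lambda>x::point. (x $ 1) *\<^sub>R d + (x $ 2) *\<^sub>R n"
  have ip: "d \<bullet> d = 1" "n \<bullet> n = 1" "n \<bullet> d = 0"
    using assms by (auto simp: norm_eq_1 inner_commute)
  have "orthogonal_transformation ?f" by (rule orthogonal_transformation_orthonormal[OF assms])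
  then have "surj ?f" by (rule orthogonal_transformation_surj)
  then obtain x where x: "v = ?f x" by blast
  have "v \<bullet> d = x $ 1" "v \<bullet> n = x $ 2"
    unfolding x using ip assms by (simp_all add: inner_add_left)
  then show ?thesis using x by simp
qed

lemma vertex_angle_commute: "vertex_angle a b c = vertex_angle c b a"
  by (simp add: vertex_angle_def inner_commute mult.commute)

text \<open>Here \<tau> is arc length from \<open>P 0\<close>, so that the length telescopes. The
  normal of the half-plane is orthogonal to the line because its product with \<open>P 0\<close> and
  \<open>P 1\<close> is the same.\<close>

lemma band_coordinates:
  assumes "is_band \<T> N P Q"
  obtains d n :: point and \<tau> :: "nat \<Rightarrow> real"
  where "norm d = 1" "norm n = 1" "d \<bullet> n = 0" "\<tau> 0 = 0" "\<And>i. i \<le> N \<Longrightarrow> \<tau> i < \<tau> (Suc i)"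
    "\<And>i. i \<le> Suc N \<Longrightarrow> P i = P 0 + \<tau> i *\<^sub>R d"
    "\<And>i j. i \<le> N \<Longrightarrow> j \<le> Suc N \<Longrightarrow> 0 < (Q i - P j) \<bullet> n"
    "band_length N P = \<tau> (Suc N)"
proof -
  have "\<exists>a d t. d \<noteq> 0 \<and> strict_mono_on {0..N + 1} (t :: nat \<Rightarrow> real) \<and> (\<forall>i \<in> {0..N + 1}. P i = a + t i *\<^sub>R d)"
    using assms unfolding is_band_def by (elim conjE)
  then obtain a d0 t where d0: "d0 \<noteq> 0" and t: "strict_mono_on {0..N + 1} (t :: nat \<Rightarrow> real)"
    and P: "\<forall>i \<in> {0..N + 1}. P i = a + t i *\<^sub>R d0"
    by (elim exE conjE)
  note P = P[rule_format]
  have "\<exists>n c. (\<forall>i \<in> {0..N + 1}. n \<bullet> P i = c) \<and> (\<forall>i \<in> {0..N}. n \<bullet> Q i > c)"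
    using assms unfolding is_band_def by (elim conjE)
  then obtain n0 c where n0: "\<forall>i \<in> {0..N + 1}. n0 \<bullet> P i = c" "\<forall>i \<in> {0..N}. n0 \<bullet> Q i > c"
    by (elim exE conjE)
  note n0 = n0[rule_format]
  define d where "d = d0 /\<^sub>R norm d0"
  define n where "n = n0 /\<^sub>R norm n0"
  define \<tau> where "\<tau> i = (t i - t 0) * norm d0" for i
  have n0nz: "n0 \<noteq> 0" using n0(1)[of 0] n0(2)[of 0] by auto
  have "n0 \<bullet> P 1 - n0 \<bullet> P 0 = (t 1 - t 0) * (n0 \<bullet> d0)"
    using P[of 0] P[of 1] by (simp add: inner_simps algebra_simps)
  moreover have "n0 \<bullet> P 1 = n0 \<bullet> P 0" using n0(1)[of 0] n0(1)[of 1] by simp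
  moreover have "t 0 < t 1" using t by (auto simp: strict_mono_on_def)
  ultimately have orth: "n0 \<bullet> d0 = 0" by simp
  have 1: "norm d = 1" "norm n = 1" "d \<bullet> n = 0"
    using d0 n0nz orth by (auto simp: d_def n_def inner_commute)
  have mono: "\<tau> i < \<tau> (Suc i)" if "i \<le> N" for i
  proof -
    have "t i < t (Suc i)" using t that by (auto simp: strict_mono_on_def)
    then show ?thesis using d0 by (simp add: \<tau>_def)
  qed
  have Pt: "P i = P 0 + \<tau> i *\<^sub>R d" if "i \<le> Suc N" for i
  proof -
    have "\<tau> i *\<^sub>R d = (t i - t 0) *\<^sub>R d0" using d0 by (simp add: \<tau>_def d_def)
    then show ?thesis using P[of i] P[of 0] that by (simp add: algebra_simps)
  qed
  have side: "0 < (Q i - P j) \<bullet> n" if "i \<le> N" "j \<le> Suc N" for i j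
  proof -
    have "n0 \<bullet> Q i > n0 \<bullet> P j" using n0(1)[of j] n0(2)[of i] that by simp
    then show ?thesis using n0nz by (simp add: n_def inner_simps inner_commute)
  qed
  have "dist (P i) (P (i + 1)) = \<tau> (Suc i) - \<tau> i" if "i \<le> N" for i
  proof -
    have "P i - P (i + 1) = (\<tau> i - \<tau> (Suc i)) *\<^sub>R d"
      using Pt[of i] Pt[of "Suc i"] that by (simp add: algebra_simps)
    then show ?thesis using 1 mono[OF that] by (simp add: dist_norm)
  qed
  then have "band_length N P = (\<Sum>i = 0..N. \<tau> (Suc i) - \<tau> i)"
    unfolding band_length_def by (intro sum.cong) auto
  also have "\<dots> = \<tau> (Suc N)" using sum_Suc_diff[of 0 "N" \<tau>] by (simp add: \<tau>_def)
  finally have len: "band_length N P = \<tau> (Suc N)" .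
  show thesis using that[OF 1 _ mono Pt side len] by (simp add: \<tau>_def)
qed

context triangulated_domain
begin

text \<open>
  Halving \<open>K\<close> about \<open>x\<^sub>0\<close>: the affine map \<open>p = 2 x - grad U K\<close> satisfies
  \<open>p x\<^sub>0 = 2 p ((x\<^sub>0 + y) / 2) - p y\<close>.
\<close>

lemma element_deviation:
  assumes K: "K \<in> \<T>" and x0: "x\<^sub>0 \<in> K"
  shows "area K * (norm (2 *\<^sub>R x\<^sub>0 - grad U K))\<^sup>2 \<le> 34 * element_error U K"
proof -
  define p where "p x = 2 *\<^sub>R x - grad U K" for x
  define f where "f x = ennreal (indicator K x * (norm (p x))\<^sup>2)" for x
  have [measurable]: "K \<in> sets borel" using element_borel[OF K] .
  have fm [measurable]: "f \<in> borel_measurable borel" unfolding f_def[abs_def] p_def by measurable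
  let ?mid = "\<lambda>y. (1/2) *\<^sub>R x\<^sub>0 + (1/2) *\<^sub>R y"
  have f: "(\<integral>\<^sup>+x. f x \<partial>lborel) = ennreal (element_error U K)"
    unfolding f_def p_def element_error_def
    by (intro nn_integral_eq_integral element_error_integrable K) auto
  have half: "(\<integral>\<^sup>+y. f (?mid y) \<partial>lborel) = 4 * ennreal (element_error U K)"
  proof -
    have "4 * (\<integral>\<^sup>+x. f x \<partial>lborel) = 4 * (ennreal (\<bar>1/2\<bar> ^ 2) * (\<integral>\<^sup>+y. f (?mid y) \<partial>lborel))"
      using nn_integral_lborel_scale[OF fm, of "1/2" "(1/2) *\<^sub>R x\<^sub>0"] by simp
    also have "\<dots> = ennreal (4 * \<bar>1/2\<bar> ^ 2) * (\<integral>\<^sup>+y. f (?mid y) \<partial>lborel)"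
      by (subst ennreal_mult) (auto simp: mult.assoc)
    also have "4 * \<bar>1/2 :: real\<bar> ^ 2 = 1" by (simp add: power2_eq_square)
    finally show ?thesis by (simp add: f)
  qed
  \<comment> \<open>Uses (2 a + b)^2 \<le> 8 a^2 + 2 b^2. The substitution by the midpoint costs a
    factor 4 in the plane, which gives 8 * 4 + 2 = 34.\<close>
  have pw: "ennreal ((norm (p x\<^sub>0))\<^sup>2) * indicator K y \<le> 8 * f (?mid y) + 2 * f y" for y
  proof (cases "y \<in> K")
    case True
    have mid: "?mid y \<in> K"
      using convexD[OF element(2)[OF K] x0 True, of "1/2" "1/2"] by simp
    have "p x\<^sub>0 = 2 *\<^sub>R p (?mid y) - p y" by (simp add: p_def algebra_simps scaleR_2)
    then have "norm (p x\<^sub>0) \<le> 2 * norm (p (?mid y)) + norm (p y)"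
      by (metis abs_numeral norm_scaleR norm_triangle_ineq4)
    then have "(norm (p x\<^sub>0))\<^sup>2 \<le> (2 * norm (p (?mid y)) + norm (p y))\<^sup>2" by (intro power_mono) auto
    also have "\<dots> \<le> 8 * (norm (p (?mid y)))\<^sup>2 + 2 * (norm (p y))\<^sup>2"
      using zero_le_power2[of "2 * norm (p (?mid y)) - norm (p y)"] by (simp add: power2_eq_square algebra_simps)
    finally have "ennreal ((norm (p x\<^sub>0))\<^sup>2) \<le> ennreal (8 * (norm (p (?mid y)))\<^sup>2 + 2 * (norm (p y))\<^sup>2)"
      by (rule ennreal_leI)
    also have "\<dots> = 8 * f (?mid y) + 2 * f y"
      using True mid by (simp add: f_def ennreal_mult)
    finally show ?thesis using True by simp
  qed simp
  have em: "emeasure lborel K = ennreal (area K)"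
  proof -
    have "emeasure lborel K < \<infinity>"
      using emeasure_bounded_finite[of K] element(1)[OF K] compact_imp_bounded by blast
    then show ?thesis unfolding area_def by (simp add: emeasure_eq_ennreal_measure)
  qed
  have "ennreal ((norm (p x\<^sub>0))\<^sup>2) * ennreal (area K) = (\<integral>\<^sup>+y. ennreal ((norm (p x\<^sub>0))\<^sup>2) * indicator K y \<partial>lborel)"
    by (simp add: nn_integral_cmult_indicator em)
  also have "\<dots> \<le> (\<integral>\<^sup>+y. 8 * f (?mid y) + 2 * f y \<partial>lborel)" by (intro nn_integral_mono pw)
  also have "\<dots> = 8 * (4 * ennreal (element_error U K)) + 2 * ennreal (element_error U K)"
    by (simp add: nn_integral_add nn_integral_cmult half f)
  also have "\<dots> = (8 * 4 + 2) * ennreal (element_error U K)"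
    by (simp only: distrib_right mult.assoc)
  also have "\<dots> = ennreal (34 * element_error U K)"
    using element_error_nonneg[of U K] by (simp add: ennreal_mult)
  finally have "ennreal ((norm (p x\<^sub>0))\<^sup>2 * area K) \<le> ennreal (34 * element_error U K)"
    by (simp add: ennreal_mult area_def)
  then show ?thesis
    using element_error_nonneg[of U K] by (subst (asm) ennreal_le_iff) (auto simp: p_def mult.commute)
qed

text \<open>Weighting by the area of \<open>K'\<close> instead of \<open>K\<close> is where area
  comparability enters; 34 is rounded up to 36 so that the root is 6.\<close>

lemma sqrt_area_deviation:
  assumes "K \<in> \<T>" "x\<^sub>0 \<in> K" and area: "area K' \<le> c * area K" and c: "0 \<le> c"
  shows "sqrt (area K') * norm (2 *\<^sub>R x\<^sub>0 - grad U K) \<le> 6 * sqrt c * sqrt (element_error U K)"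
proof (rule power2_le_imp_le)
  have "(sqrt (area K') * norm (2 *\<^sub>R x\<^sub>0 - grad U K))\<^sup>2 = area K' * (norm (2 *\<^sub>R x\<^sub>0 - grad U K))\<^sup>2"
    by (simp add: power_mult_distrib area_def)
  also have "\<dots> \<le> (c * area K) * (norm (2 *\<^sub>R x\<^sub>0 - grad U K))\<^sup>2"
    using area by (intro mult_right_mono) auto
  also have "\<dots> \<le> c * (34 * element_error U K)"
    using mult_left_mono[OF element_deviation[OF assms(1,2), of U] c] by (simp add: mult.assoc)
  also have "\<dots> \<le> c * (36 * element_error U K)"
    using c element_error_nonneg[of U K] by (intro mult_left_mono) auto
  also have "\<dots> = (6 * sqrt c * sqrt (element_error U K))\<^sup>2"
    using c element_error_nonneg[of U K] by (simp add: power_mult_distrib)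
  finally show "(sqrt (area K') * norm (2 *\<^sub>R x\<^sub>0 - grad U K))\<^sup>2 \<le> (6 * sqrt c * sqrt (element_error U K))\<^sup>2" .
qed (use c element_error_nonneg[of U K] in auto)

text \<open>The normalized jump bound is applied in the frame at \<open>P i\<close>, with reference
  gradient \<open>2 *\<^sub>R P i\<close>. The longest-edge condition places
  \<open>Q (i - 1)\<close> and \<open>Q i\<close> on opposite sides of the normal through
  \<open>P i\<close>, which fixes the signs that the bound requires; the maximality of the angle at
  \<open>P i\<close> bounds its cosine by 1/2.\<close>

lemma band_slope_jump:
  assumes band: "is_band \<T> N P Q" and U: "U \<in> P1" and i: "i \<in> {1..N}"
    and on: "norm d = 1" "norm n = 1" "d \<bullet> n = 0"
    and mono: "\<And>i. i \<le> N \<Longrightarrow> \<tau> i < \<tau> (Suc i)"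
    and Pt: "\<And>i. i \<le> Suc N \<Longrightarrow> P i = P 0 + \<tau> i *\<^sub>R d"
    and side: "\<And>i j. i \<le> N \<Longrightarrow> j \<le> Suc N \<Longrightarrow> 0 < (Q i - P j) \<bullet> n"
  shows "\<bar>grad U (band_K P Q i) \<bullet> d - grad U (band_K P Q (i - 1)) \<bullet> d\<bar>
    \<le> 4 * sin (pi - band_angle' P Q i) *
      (norm (2 *\<^sub>R P i - grad U (band_K' P Q i)) + norm (2 *\<^sub>R P i - grad U (band_K P Q (i - 1)))
        + norm (2 *\<^sub>R P i - grad U (band_K P Q i)))"
    and "0 \<le> sin (pi - band_angle' P Q i)"
proof -
  obtain j where j: "i = Suc j" using i by (cases i) auto
  have jN: "j \<le> N" "Suc j \<le> N" "j + 1 = Suc j" "Suc j - 1 = j" using i j by auto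
  let ?b = "P (Suc j)" and ?a = "Q j" and ?c = "Q (Suc j)"
  define p1 where "p1 = - ((?a - ?b) \<bullet> d)"
  define q1 where "q1 = (?a - ?b) \<bullet> n"
  define p2 where "p2 = (?c - ?b) \<bullet> d"
  define q2 where "q2 = (?c - ?b) \<bullet> n"
  have a: "?a - ?b = (- p1) *\<^sub>R d + q1 *\<^sub>R n" and c: "?c - ?b = p2 *\<^sub>R d + q2 *\<^sub>R n"
    unfolding p1_def q1_def p2_def q2_def using orthonormal_expansion[OF on] by simp_all
  have q: "0 < q1" "0 < q2" unfolding q1_def q2_def using side jN by auto
  have ip: "d \<bullet> d = 1" "n \<bullet> n = 1" "n \<bullet> d = 0"
    using on by (auto simp: norm_eq_1 inner_commute)
  have ne: "?a \<noteq> ?b" "?c \<noteq> ?b" using q by (auto simp: q1_def q2_def)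
  have sq: "(norm (w + l *\<^sub>R d))\<^sup>2 = (norm w)\<^sup>2 + 2 * l * (w \<bullet> d) + l\<^sup>2" for w l
    unfolding power2_norm_eq_inner
    by (simp add: inner_add_left inner_add_right inner_commute ip power2_eq_square algebra_simps)
  \<comment> \<open>\<open>Q j\<close> is no farther from \<open>P j\<close> than \<open>?b\<close>
    is; expanding the square shows that its projection to the line does not pass
    \<open>?b\<close>.\<close>
  have p1: "0 \<le> p1"
  proof -
    define l where "l = \<tau> (Suc j) - \<tau> j"
    have l: "0 < l" using mono jN by (simp add: l_def)
    have Pd: "?b - P j = l *\<^sub>R d" using Pt[of j] Pt[of "Suc j"] jN by (simp add: l_def algebra_simps)
    have "dist (P j) (Q j) \<le> dist (P j) (P (j + 1))" using band jN unfolding is_band_def by auto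
    then have "norm (Q j - P j) \<le> norm (?b - P j)" by (simp add: dist_norm norm_minus_commute)
    moreover have "norm (?b - P j) = l" unfolding Pd using l on by simp
    ultimately have "(norm (Q j - P j))\<^sup>2 \<le> l\<^sup>2" by (intro power_mono) auto
    moreover have "Q j - P j = (?a - ?b) + l *\<^sub>R d" using Pd by (simp add: algebra_simps)
    then have "(norm (Q j - P j))\<^sup>2 = (norm (?a - ?b))\<^sup>2 + 2 * l * ((?a - ?b) \<bullet> d) + l\<^sup>2"
      by (simp only: sq)
    ultimately have "2 * l * ((?a - ?b) \<bullet> d) \<le> 0" using zero_le_power2[of "norm (?a - ?b)"] by linarith
    then show ?thesis using l by (simp add: p1_def mult_le_0_iff)
  qed
  \<comment> \<open>The mirror image of the previous argument at the next base point. Keeping the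
    strict sign separates \<open>?a\<close> from \<open>?c\<close> below.\<close>
  have p2: "0 < p2"
  proof -
    define l where "l = \<tau> (Suc (Suc j)) - \<tau> (Suc j)"
    have l: "0 < l" using mono jN by (simp add: l_def)
    have Pd: "P (Suc (Suc j)) - ?b = l *\<^sub>R d" using Pt[of "Suc (Suc j)"] Pt[of "Suc j"] jN by (simp add: l_def algebra_simps)
    have "dist (P (Suc j + 1)) (Q (Suc j)) \<le> dist (P (Suc j)) (P (Suc j + 1))"
      using band jN unfolding is_band_def by auto
    then have "norm (?c - P (Suc (Suc j))) \<le> norm (P (Suc (Suc j)) - ?b)" by (simp add: dist_norm norm_minus_commute)
    moreover have "norm (P (Suc (Suc j)) - ?b) = l" unfolding Pd using l on by simp
    ultimately have "(norm (?c - P (Suc (Suc j))))\<^sup>2 \<le> l\<^sup>2" by (intro power_mono) auto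
    moreover have "?c - P (Suc (Suc j)) = (?c - ?b) + (- l) *\<^sub>R d" using Pd by (simp add: algebra_simps)
    then have "(norm (?c - P (Suc (Suc j))))\<^sup>2 = (norm (?c - ?b))\<^sup>2 + 2 * (- l) * ((?c - ?b) \<bullet> d) + (- l)\<^sup>2"
      by (simp only: sq)
    then have "(norm (?c - P (Suc (Suc j))))\<^sup>2 = (norm (?c - ?b))\<^sup>2 - 2 * l * ((?c - ?b) \<bullet> d) + l\<^sup>2"
      by simp
    moreover have "0 < (norm (?c - ?b))\<^sup>2" using ne by simp
    ultimately have "0 < 2 * l * ((?c - ?b) \<bullet> d)" by linarith
    then show ?thesis using l by (simp add: p2_def zero_less_mult_iff)
  qed
  have ac: "?a \<noteq> ?c"
  proof
    assume "?a = ?c"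
    then have "p2 = - p1" by (simp add: p1_def p2_def)
    then show False using p1 p2 by linarith
  qed
  define r1 where "r1 = norm (?a - ?b)"
  define r2 where "r2 = norm (?c - ?b)"
  have r: "0 < r1" "0 < r2" using ne by (auto simp: r1_def r2_def)
  have r1: "r1\<^sup>2 = p1\<^sup>2 + q1\<^sup>2"
    unfolding r1_def a power2_norm_eq_inner using ip on by (simp add: inner_simps power2_eq_square)
  have r2: "r2\<^sup>2 = p2\<^sup>2 + q2\<^sup>2"
    unfolding r2_def c power2_norm_eq_inner using ip on by (simp add: inner_simps power2_eq_square)
  have ba: "band_angle' P Q (Suc j) = vertex_angle ?a ?b ?c"
    using band i j unfolding is_band_def by auto
  have sin_eq: "sin (pi - band_angle' P Q (Suc j)) = (q2 / r2) * (p1 / r1) + (q1 / r1) * (p2 / r2)"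
  proof -
    have "sin (pi - vertex_angle ?a ?b ?c) = \<bar>(- p1) * q2 - p2 * q1\<bar> / (r1 * r2)"
      unfolding r1_def r2_def by (rule sin_pi_minus_vertex_angle[OF ne on a c])
    also have "\<bar>(- p1) * q2 - p2 * q1\<bar> = q2 * p1 + q1 * p2"
    proof -
      have "0 \<le> p1 * q2" "0 \<le> p2 * q1" using p1 p2 q by auto
      then show ?thesis by (simp add: algebra_simps)
    qed
    finally show ?thesis unfolding ba by (simp add: add_divide_distrib mult.commute)
  qed
  have "vertex_angle ?c ?a ?b \<le> vertex_angle ?a ?b ?c" "vertex_angle ?b ?c ?a \<le> vertex_angle ?a ?b ?c"
  proof -
    have "vertex_angle ?b ?a ?c \<le> band_angle' P Q (Suc j)" "vertex_angle ?a ?c ?b \<le> band_angle' P Q (Suc j)"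
      unfolding band_angle'_def max_angle_def by auto
    then show "vertex_angle ?c ?a ?b \<le> vertex_angle ?a ?b ?c" "vertex_angle ?b ?c ?a \<le> vertex_angle ?a ?b ?c"
      unfolding ba using vertex_angle_commute by metis+
  qed
  from cos_max_angle_le_half[OF ne ac this]
  have ang: "(q1 / r1) * (q2 / r2) - (p1 / r1) * (p2 / r2) \<le> 1 / 2"
  proof -
    assume h: "(?a - ?b) \<bullet> (?c - ?b) / (norm (?a - ?b) * norm (?c - ?b)) \<le> 1 / 2"
    have "(?a - ?b) \<bullet> (?c - ?b) = q1 * q2 - p1 * p2"
      unfolding a c using ip on by (simp add: inner_simps)
    then show ?thesis using h unfolding r1_def[symmetric] r2_def[symmetric] by (simp add: diff_divide_distrib)
  qed
  let ?G = "grad U (band_K' P Q (Suc j))" and ?g1 = "grad U (band_K P Q j)" and ?g2 = "grad U (band_K P Q (Suc j))"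
  have T: "band_K' P Q (Suc j) \<in> \<T>" "band_K P Q j \<in> \<T>" "band_K P Q (Suc j) \<in> \<T>"
    using band jN i j unfolding is_band_def by auto
  have hull: "?a \<in> band_K' P Q (Suc j)" "?b \<in> band_K' P Q (Suc j)" "?c \<in> band_K' P Q (Suc j)"
    "?a \<in> band_K P Q j" "?b \<in> band_K P Q j" "?b \<in> band_K P Q (Suc j)" "?c \<in> band_K P Q (Suc j)"
    unfolding band_K_def band_K'_def by (auto intro: hull_inc)
  \<comment> \<open>Both elements contain the two end points of this edge, so the same difference of
    values of \<open>U\<close> is computed with either gradient.\<close>
  have "?G \<bullet> (?a - ?b) = ?g1 \<bullet> (?a - ?b)"
    using P1_diff[OF U T(1) hull(1,2)] P1_diff[OF U T(2) hull(4,5)] by simp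
  then have e1: "(?G \<bullet> n) * (q1 / r1) - (?G \<bullet> d) * (p1 / r1) = (?g1 \<bullet> n) * (q1 / r1) - (?g1 \<bullet> d) * (p1 / r1)"
  proof -
    assume "?G \<bullet> (?a - ?b) = ?g1 \<bullet> (?a - ?b)"
    then have "(?G \<bullet> n) * q1 - (?G \<bullet> d) * p1 = (?g1 \<bullet> n) * q1 - (?g1 \<bullet> d) * p1"
      unfolding a by (simp add: inner_add_right algebra_simps)
    then have "((?G \<bullet> n) * q1 - (?G \<bullet> d) * p1) / r1 = ((?g1 \<bullet> n) * q1 - (?g1 \<bullet> d) * p1) / r1" by simp
    then show ?thesis by (simp add: diff_divide_distrib)
  qed
  have "?G \<bullet> (?c - ?b) = ?g2 \<bullet> (?c - ?b)"
    using P1_diff[OF U T(1) hull(3,2)] P1_diff[OF U T(3) hull(7,6)] by simp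
  then have e2: "(?G \<bullet> d) * (p2 / r2) + (?G \<bullet> n) * (q2 / r2) = (?g2 \<bullet> d) * (p2 / r2) + (?g2 \<bullet> n) * (q2 / r2)"
  proof -
    assume "?G \<bullet> (?c - ?b) = ?g2 \<bullet> (?c - ?b)"
    then have "(?G \<bullet> d) * p2 + (?G \<bullet> n) * q2 = (?g2 \<bullet> d) * p2 + (?g2 \<bullet> n) * q2"
      unfolding c by (simp add: inner_add_right mult.commute)
    then have "((?G \<bullet> d) * p2 + (?G \<bullet> n) * q2) / r2 = ((?g2 \<bullet> d) * p2 + (?g2 \<bullet> n) * q2) / r2" by simp
    then show ?thesis by (simp add: add_divide_distrib)
  qed
  have dev: "\<bar>g \<bullet> v - (2 *\<^sub>R ?b) \<bullet> v\<bar> \<le> norm (2 *\<^sub>R ?b - g)" if "norm v = 1" for g v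
    using Cauchy_Schwarz_ineq2[of "2 *\<^sub>R ?b - g" v] that
    by (simp add: inner_diff_left abs_minus_commute)
  have unit: "(p1 / r1)\<^sup>2 + (q1 / r1)\<^sup>2 = 1" "(p2 / r2)\<^sup>2 + (q2 / r2)\<^sup>2 = 1"
    using r q r1[symmetric] r2[symmetric] by (simp_all add: power_divide add_divide_distrib[symmetric])
  have "\<bar>?g2 \<bullet> d - ?g1 \<bullet> d\<bar> \<le> 4 * ((q2 / r2) * (p1 / r1) + (q1 / r1) * (p2 / r2)) *
      (norm (2 *\<^sub>R ?b - ?G) + norm (2 *\<^sub>R ?b - ?g1) + norm (2 *\<^sub>R ?b - ?g2))"
    using p1 p2 q r
    by (intro jump_bound_normalized[OF _ _ _ _ unit e1 e2 ang dev dev dev dev dev] on) auto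
  then show "\<bar>grad U (band_K P Q i) \<bullet> d - grad U (band_K P Q (i - 1)) \<bullet> d\<bar>
    \<le> 4 * sin (pi - band_angle' P Q i) *
      (norm (2 *\<^sub>R P i - grad U (band_K' P Q i)) + norm (2 *\<^sub>R P i - grad U (band_K P Q (i - 1)))
        + norm (2 *\<^sub>R P i - grad U (band_K P Q i)))"
    unfolding sin_eq[symmetric] by (simp add: j)
  show "0 \<le> sin (pi - band_angle' P Q i)"
    unfolding j sin_eq using p1 p2 q r by simp
qed

text \<open>Cauchy-Schwarz on \<open>N\<close> terms; since the elements are distinct, their squared
  errors add up to no more than the total.\<close>

lemma sum_sqrt_element_error_le:
  fixes N :: nat
  assumes "inj_on F {1..N}" "\<And>i. i \<in> {1..N} \<Longrightarrow> F i \<in> \<T>" and E: "(\<Sum>K\<in>\<T>. element_error U K) \<le> \<epsilon>\<^sup>2" "0 \<le> \<epsilon>"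
  shows "(\<Sum>i\<in>{1..N}. sqrt (element_error U (F i))) \<le> sqrt N * \<epsilon>"
proof (rule power2_le_imp_le)
  have "(\<Sum>i\<in>{1..N}. sqrt (element_error U (F i)))\<^sup>2 \<le> (\<Sum>i\<in>{1..N}. (sqrt (element_error U (F i)))\<^sup>2) * card {1..N}"
    by (rule sum_squared_le_sum_of_squares)
  also have "(\<Sum>i\<in>{1..N}. (sqrt (element_error U (F i)))\<^sup>2) = (\<Sum>i\<in>{1..N}. element_error U (F i))"
    by (simp add: element_error_nonneg)
  also have "\<dots> = (\<Sum>K\<in>F ` {1..N}. element_error U K)"
    using assms(1) by (simp add: sum.reindex)
  also have "\<dots> \<le> (\<Sum>K\<in>\<T>. element_error U K)"
    using assms(2) mesh_finite by (intro sum_mono2) (auto simp: element_error_nonneg)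
  also have "\<dots> \<le> \<epsilon>\<^sup>2" by (rule E)
  finally have "(\<Sum>i\<in>{1..N}. sqrt (element_error U (F i)))\<^sup>2 \<le> \<epsilon>\<^sup>2 * real N" by (simp add: mult_right_mono)
  then show "(\<Sum>i\<in>{1..N}. sqrt (element_error U (F i)))\<^sup>2 \<le> (sqrt N * \<epsilon>)\<^sup>2"
    by (simp add: power_mult_distrib mult.commute)
qed (use E in simp)

text \<open>\<open>big\<close> contradicts the conclusion of
  \<open>slope_variation_lower_bound\<close>, so the jumps sum to more than \<open>k / 2\<close>, a
  sixth of the length. The constant is 432 = 6 * 24 * 3: the factor 6 from the length, 24 = 4 * 6
  from the jump bound and the element deviation, and 3 from the three families of elements.\<close>

lemma band_estimate:
  assumes band: "is_band \<T> N P Q" and U: "U \<in> P1"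
    and fr: "\<And>x. x \<in> frontier \<Omega> \<Longrightarrow> \<bar>x \<bullet> x - U x\<bar> \<le> \<eta>" and \<eta>: "0 \<le> \<eta>"
    and D: "\<And>x y. x \<in> closure \<Omega> \<Longrightarrow> y \<in> closure \<Omega> \<Longrightarrow> norm (x - y) \<le> D"
    and E: "(\<Sum>K\<in>\<T>. element_error U K) \<le> \<epsilon>\<^sup>2" "0 \<le> \<epsilon>"
    and C_K: "0 < C_K"
    and area: "\<And>i. i \<in> {1..N} \<Longrightarrow> area (band_K' P Q i) \<le> C_K * area (band_K P Q i)
      \<and> area (band_K' P Q i) \<le> C_K * area (band_K P Q (i - 1))"
    and k: "k = band_length N P / 3" and big: "4 * \<eta> * k + 4 * (\<epsilon> * sqrt (3 * k * D)) < k ^ 3"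
  shows "(MIN i\<in>{1..N}. 1 / sin (pi - band_angle' P Q i)) *
      (MIN i\<in>{1..N}. sqrt (area (band_K' P Q i))) * band_length N P * real N powr (- 1 / 2)
      \<le> 432 * (1 + sqrt C_K) * \<epsilon>"
proof -
  obtain d n \<tau> where on: "norm d = 1" "norm n = 1" "d \<bullet> n = 0" and \<tau>0: "\<tau> 0 = 0"
    and mono: "\<And>i. i \<le> N \<Longrightarrow> \<tau> i < \<tau> (Suc i)"
    and Pt: "\<And>i. i \<le> Suc N \<Longrightarrow> P i = P 0 + \<tau> i *\<^sub>R d"
    and side: "\<And>i j. i \<le> N \<Longrightarrow> j \<le> Suc N \<Longrightarrow> 0 < (Q i - P j) \<bullet> n"
    and len: "band_length N P = \<tau> (Suc N)"
    using band_coordinates[OF band] by metis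
  have N: "1 \<le> N" using band by (simp add: is_band_def)
  have T: "i \<le> N \<Longrightarrow> band_K P Q i \<in> \<T>" for i
    using band by (auto simp: is_band_def)
  have T': "i \<in> {1..N} \<Longrightarrow> band_K' P Q i \<in> \<T>" for i
    using band unfolding is_band_def by blast
  have inj: "inj_on (band_K P Q) {0..N}" "inj_on (band_K' P Q) {1..N}"
    using band by (auto simp: is_band_def)
  define \<mu> where "\<mu> = (MIN i\<in>{1..N}. 1 / sin (pi - band_angle' P Q i))"
  define \<rho> where "\<rho> = (MIN i\<in>{1..N}. sqrt (area (band_K' P Q i)))"
  define jmp where "jmp i = \<bar>grad U (band_K P Q i) \<bullet> d - grad U (band_K P Q (i - 1)) \<bullet> d\<bar>" for i
  have k0: "0 \<le> k" unfolding k band_length_def by (simp add: sum_nonneg)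
  have V: "k / 2 < (\<Sum>i\<in>{1..N}. jmp i)"
  proof (rule ccontr)
    assume "\<not> ?thesis"
    then have "(\<Sum>i\<in>{1..N}. \<bar>grad U (band_K P Q i) \<bullet> d - grad U (band_K P Q (i - 1)) \<bullet> d\<bar>) \<le> k / 2"
      by (simp add: jmp_def)
    moreover have "band_K P Q i \<in> \<T> \<and> P 0 + \<tau> i *\<^sub>R d \<in> band_K P Q i \<and> P 0 + \<tau> (Suc i) *\<^sub>R d \<in> band_K P Q i"
      if "i \<le> N" for i
    proof -
      have "P i \<in> band_K P Q i" "P (i + 1) \<in> band_K P Q i" unfolding band_K_def by (auto intro: hull_inc)
      then show ?thesis using T[OF that] Pt[of i] Pt[of "Suc i"] that by simp
    qed
    ultimately have "k ^ 3 \<le> 4 * \<eta> * k + 4 * (\<epsilon> * sqrt (3 * k * D))"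
      using len k by (intro slope_variation_lower_bound[where \<tau> = \<tau> and Ks = "band_K P Q" and a = "P 0" and N = N,
          OF U fr \<eta> D E on \<tau>0 _ k0]) auto
    then show False using big by simp
  qed
  have fin: "finite {1..N}" "{1..N} \<noteq> {}" using N by auto
  have s0: "0 \<le> sin (pi - band_angle' P Q i)" if "i \<in> {1..N}" for i
    by (rule band_slope_jump(2)[OF band U that on mono Pt side])
  have \<mu>0: "0 \<le> \<mu>" unfolding \<mu>_def using fin s0 by (subst Min_ge_iff) auto
  have \<rho>0: "0 \<le> \<rho>" unfolding \<rho>_def using fin by (subst Min_ge_iff) (auto simp: area_def)
  define e where "e K = sqrt (element_error U K)" for K
  have e0: "0 \<le> e K" for K by (simp add: e_def element_error_nonneg)
  have jump_le: "\<mu> * \<rho> * jmp i \<le> 24 * (1 + sqrt C_K) * (e (band_K' P Q i) + e (band_K P Q (i - 1)) + e (band_K P Q i))"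
    if i: "i \<in> {1..N}" for i
  proof -
    let ?s = "sin (pi - band_angle' P Q i)" and ?K' = "band_K' P Q i"
    let ?dev = "\<lambda>K. norm (2 *\<^sub>R P i - grad U K)"
    have mem: "P i \<in> ?K'" "P i \<in> band_K P Q (i - 1)" "P i \<in> band_K P Q i"
      using i unfolding band_K_def band_K'_def by (auto intro!: hull_inc)
    have "\<mu> \<le> 1 / ?s" unfolding \<mu>_def using fin i by (intro Min_le) auto
    moreover have "\<rho> \<le> sqrt (area ?K')" unfolding \<rho>_def using fin i by (intro Min_le) auto
    ultimately have \<mu>\<rho>: "\<mu> * \<rho> \<le> (1 / ?s) * sqrt (area ?K')"
      using \<mu>0 \<rho>0 s0[OF i] by (intro mult_mono) auto
    have jmp: "jmp i \<le> 4 * ?s * (?dev ?K' + ?dev (band_K P Q (i - 1)) + ?dev (band_K P Q i))"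
      unfolding jmp_def by (rule band_slope_jump(1)[OF band U i on mono Pt side])
    have "\<mu> * \<rho> * jmp i \<le> ((1 / ?s) * sqrt (area ?K')) * (4 * ?s * (?dev ?K' + ?dev (band_K P Q (i - 1)) + ?dev (band_K P Q i)))"
      using s0[OF i] by (intro mult_mono[OF \<mu>\<rho> jmp]) (auto simp: jmp_def area_def)
    also have "\<dots> = (1 / ?s * ?s) * (4 * (sqrt (area ?K') * ?dev ?K' + sqrt (area ?K') * ?dev (band_K P Q (i - 1)) + sqrt (area ?K') * ?dev (band_K P Q i)))"
      by (simp add: algebra_simps)
    \<comment> \<open>The sine is known to be nonnegative here; as division by zero yields 0, the
      product \<open>1 / ?s * ?s\<close> is at most 1 in every case.\<close>
    also have "\<dots> \<le> 1 * (4 * (sqrt (area ?K') * ?dev ?K' + sqrt (area ?K') * ?dev (band_K P Q (i - 1)) + sqrt (area ?K') * ?dev (band_K P Q i)))"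
      by (intro mult_right_mono) (auto simp: area_def)
    also have "\<dots> \<le> 4 * (6 * (1 + sqrt C_K) * e ?K' + 6 * (1 + sqrt C_K) * e (band_K P Q (i - 1)) + 6 * (1 + sqrt C_K) * e (band_K P Q i))"
    proof -
      \<comment> \<open>The factor \<open>1 + sqrt C_K\<close> covers both the element itself, with
        ratio 1, and its neighbours, with ratio \<open>C_K\<close>.\<close>
      have mid: "6 * c * e K \<le> 6 * (1 + sqrt C_K) * e K" if "c \<le> 1 + sqrt C_K" for c K
        using that e0[of K] by (intro mult_right_mono) auto
      have "sqrt (area ?K') * ?dev ?K' \<le> 6 * sqrt 1 * e ?K'"
        unfolding e_def by (rule sqrt_area_deviation[OF T'[OF i] mem(1)]) auto
      also have "\<dots> \<le> 6 * (1 + sqrt C_K) * e ?K'" using C_K by (intro mid) auto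
      finally have 1: "sqrt (area ?K') * ?dev ?K' \<le> 6 * (1 + sqrt C_K) * e ?K'" .
      have "sqrt (area ?K') * ?dev (band_K P Q (i - 1)) \<le> 6 * sqrt C_K * e (band_K P Q (i - 1))"
        unfolding e_def using area[OF i] C_K i by (intro sqrt_area_deviation[OF T mem(2)]) auto
      also have "\<dots> \<le> 6 * (1 + sqrt C_K) * e (band_K P Q (i - 1))" by (intro mid) auto
      finally have 2: "sqrt (area ?K') * ?dev (band_K P Q (i - 1)) \<le> 6 * (1 + sqrt C_K) * e (band_K P Q (i - 1))" .
      have "sqrt (area ?K') * ?dev (band_K P Q i) \<le> 6 * sqrt C_K * e (band_K P Q i)"
        unfolding e_def using area[OF i] C_K i by (intro sqrt_area_deviation[OF T mem(3)]) auto
      also have "\<dots> \<le> 6 * (1 + sqrt C_K) * e (band_K P Q i)" by (intro mid) auto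
      finally have 3: "sqrt (area ?K') * ?dev (band_K P Q i) \<le> 6 * (1 + sqrt C_K) * e (band_K P Q i)" .
      show ?thesis unfolding mult_1 by (intro mult_left_mono add_mono 1 2 3) simp
    qed
    finally show ?thesis by (simp add: algebra_simps)
  qed
  have "\<mu> * \<rho> * band_length N P = 6 * (\<mu> * \<rho> * (k / 2))" by (simp add: k)
  also have "\<dots> \<le> 6 * (\<mu> * \<rho> * (\<Sum>i\<in>{1..N}. jmp i))"
    using V \<mu>0 \<rho>0 by (intro mult_left_mono) auto
  also have "\<mu> * \<rho> * (\<Sum>i\<in>{1..N}. jmp i) = (\<Sum>i\<in>{1..N}. \<mu> * \<rho> * jmp i)" by (rule sum_distrib_left)
  also have "\<dots> \<le> (\<Sum>i\<in>{1..N}. 24 * (1 + sqrt C_K) * (e (band_K' P Q i) + e (band_K P Q (i - 1)) + e (band_K P Q i)))"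
    by (rule sum_mono[OF jump_le])
  also have "\<dots> = 24 * (1 + sqrt C_K) * ((\<Sum>i\<in>{1..N}. e (band_K' P Q i)) + (\<Sum>i\<in>{1..N}. e (band_K P Q (i - 1))) + (\<Sum>i\<in>{1..N}. e (band_K P Q i)))"
    by (simp only: sum_distrib_left[symmetric] sum.distrib)
  also have "\<dots> \<le> 24 * (1 + sqrt C_K) * (sqrt N * \<epsilon> + sqrt N * \<epsilon> + sqrt N * \<epsilon>)"
  proof (intro mult_left_mono add_mono)
    show "(\<Sum>i\<in>{1..N}. e (band_K' P Q i)) \<le> sqrt N * \<epsilon>"
      unfolding e_def using inj T' E by (intro sum_sqrt_element_error_le) auto
    show "(\<Sum>i\<in>{1..N}. e (band_K P Q i)) \<le> sqrt N * \<epsilon>"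
      unfolding e_def using inj T E by (intro sum_sqrt_element_error_le) (auto intro: inj_on_subset)
    \<comment> \<open>Starting at 1 matters: truncated subtraction is injective there, and the
      shifted indices stay within \<open>{0..N}\<close>.\<close>
    have "inj_on (\<lambda>i. band_K P Q (i - 1)) {1..N}"
    proof (rule inj_onI)
      fix x y assume xy: "x \<in> {1..N}" "y \<in> {1..N}" "band_K P Q (x - 1) = band_K P Q (y - 1)"
      then have "x - 1 = y - 1" by (intro inj_onD[OF inj(1)]) auto
      then show "x = y" using xy by auto
    qed
    then show "(\<Sum>i\<in>{1..N}. e (band_K P Q (i - 1))) \<le> sqrt N * \<epsilon>"
      unfolding e_def using T E by (intro sum_sqrt_element_error_le) auto
  qed (use C_K in auto)
  finally have "\<mu> * \<rho> * band_length N P \<le> 432 * (1 + sqrt C_K) * \<epsilon> * sqrt N"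
    by (simp add: algebra_simps)
  then have "\<mu> * \<rho> * band_length N P * real N powr (- 1 / 2) \<le> 432 * (1 + sqrt C_K) * \<epsilon> * sqrt N * real N powr (- 1 / 2)"
    by (intro mult_right_mono) auto
  also have "sqrt N * real N powr (- 1 / 2) = 1"
    using N by (simp add: powr_half_sqrt[symmetric] powr_add[symmetric])
  then have "432 * (1 + sqrt C_K) * \<epsilon> * sqrt N * real N powr (- 1 / 2) = 432 * (1 + sqrt C_K) * \<epsilon>"
    by (simp add: mult.assoc)
  finally show ?thesis unfolding \<mu>_def \<rho>_def .
qed

end

text \<open>The threshold \<theta> is quantified before the meshes and before \<open>C\<close>,
  \<open>C_K\<close>, \<open>C_\<alpha>\<close> and \<open>C_L\<close>, so that it can depend only
  on \<Omega>, \<open>h0\<close>, \<alpha> and the number \<open>c\<close>, the error constant of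
  the model function.\<close>

theorem corollary9:
  fixes \<Omega> :: "point set" and h0 \<alpha> c :: real
  assumes "polygonal_lipschitz_domain \<Omega>" and "0 < h0" and "0 \<le> \<alpha>" and "\<alpha> \<le> 1"
  shows "\<exists>\<theta> :: real.
    \<forall>(\<T> :: real \<Rightarrow> point set set) (C :: (point \<Rightarrow> real) \<Rightarrow> real) C_K C_\<alpha> C_L.
      (\<forall>h \<in> {0<..<h0}. conforming_triangulation \<Omega> (\<T> h) \<and> mesh_size (\<T> h) = h) \<longrightarrow>
      (\<forall>u \<in> sobolev 2 \<Omega>. \<forall>h \<in> {0<..<h0}. \<forall>U s.
         is_discrete_solution \<Omega> (\<T> h) u U \<longrightarrow> has_H1_seminorm \<Omega> (\<lambda>x. u x - U x) s \<longrightarrow>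
         s \<le> C u * h powr \<alpha>) \<longrightarrow>
      C (\<lambda>x. (x $ 1)\<^sup>2 + (x $ 2)\<^sup>2) = c \<longrightarrow>
      0 < C_K \<longrightarrow> 0 < C_\<alpha> \<longrightarrow> 0 < C_L \<longrightarrow> \<theta> < C_L \<longrightarrow>
      (\<exists>C' > 0. \<forall>h \<in> {0<..<h0}. \<forall>N P Q.
         is_band (\<T> h) N P Q \<longrightarrow>
         C_L * h powr (2 * \<alpha> / 5) \<le> band_length N P \<longrightarrow>
         (\<forall>i \<in> {1..N}.
            area (band_K' P Q i) \<le> C_K * area (band_K P Q i) \<and>
            area (band_K' P Q i) \<le> C_K * area (band_K P Q (i - 1)) \<and>
            sin (pi - band_angle P Q (i - 1)) \<le> C_\<alpha> * sin (pi - band_angle' P Q i)) \<longrightarrow>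
         (MIN i\<in>{1..N}. 1 / sin (pi - band_angle' P Q i)) *
           (MIN i\<in>{1..N}. sqrt (area (band_K' P Q i))) *
           band_length N P * real N powr (- 1 / 2)
         \<le> C' * h powr \<alpha>)"
proof -
  have "bounded (closure \<Omega>)" using assms(1) by (auto simp: polygonal_lipschitz_domain_def)
  then obtain R where R: "R > 0" "\<And>x. x \<in> closure \<Omega> \<Longrightarrow> norm x \<le> R" unfolding bounded_pos by blast
  define D where "D = 2 * R"
  have D0: "0 < D" using R by (simp add: D_def)
  have D: "norm (x - y) \<le> D" if "x \<in> closure \<Omega>" "y \<in> closure \<Omega>" for x y
    using norm_triangle_ineq4[of x y] R(2)[OF that(1)] R(2)[OF that(2)] by (simp add: D_def)
  \<comment> \<open>Bounds the error terms, divided by \<open>sqrt k\<close>, in units of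
    \<open>h powr \<alpha>\<close>: the first summand uses
    \<open>h\<^sup>2 \<le> h0 powr (2 - \<alpha>) * h powr \<alpha>\<close> and
    \<open>k \<le> D\<close>, the second comes from the strip of width \<open>D\<close>.\<close>
  define \<Theta> where "\<Theta> = 4 * h0 powr (2 - \<alpha>) * sqrt D + 4 * (\<bar>c\<bar> * sqrt (3 * D))"
  have \<Theta>0: "0 \<le> \<Theta>" unfolding \<Theta>_def using D0 by auto
  show ?thesis
  \<comment> \<open>Chosen so that \<Theta> < (C_L / 3)^(5/2); the factor 3 accounts for
    \<open>k\<close> being a third of the length.\<close>
  proof (rule exI[of _ "3 * \<Theta> powr (2 / 5)"], intro allI impI)
    fix \<T> :: "real \<Rightarrow> point set set" and C :: "(point \<Rightarrow> real) \<Rightarrow> real" and C_K C_\<alpha> C_L :: real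
    assume tri: "\<forall>h \<in> {0<..<h0}. conforming_triangulation \<Omega> (\<T> h) \<and> mesh_size (\<T> h) = h"
      and err: "\<forall>u \<in> sobolev 2 \<Omega>. \<forall>h \<in> {0<..<h0}. \<forall>U s.
         is_discrete_solution \<Omega> (\<T> h) u U \<longrightarrow> has_H1_seminorm \<Omega> (\<lambda>x. u x - U x) s \<longrightarrow>
         s \<le> C u * h powr \<alpha>"
      and c: "C (\<lambda>x. (x $ 1)\<^sup>2 + (x $ 2)\<^sup>2) = c"
      and C_K: "0 < C_K" and "0 < C_\<alpha>" and C_L: "0 < C_L" "3 * \<Theta> powr (2 / 5) < C_L"
    show "\<exists>C' > 0. \<forall>h \<in> {0<..<h0}. \<forall>N P Q.
         is_band (\<T> h) N P Q \<longrightarrow>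
         C_L * h powr (2 * \<alpha> / 5) \<le> band_length N P \<longrightarrow>
         (\<forall>i \<in> {1..N}.
            area (band_K' P Q i) \<le> C_K * area (band_K P Q i) \<and>
            area (band_K' P Q i) \<le> C_K * area (band_K P Q (i - 1)) \<and>
            sin (pi - band_angle P Q (i - 1)) \<le> C_\<alpha> * sin (pi - band_angle' P Q i)) \<longrightarrow>
         (MIN i\<in>{1..N}. 1 / sin (pi - band_angle' P Q i)) *
           (MIN i\<in>{1..N}. sqrt (area (band_K' P Q i))) *
           band_length N P * real N powr (- 1 / 2)
         \<le> C' * h powr \<alpha>"
    \<comment> \<open>Replacing \<open>c\<close> by \<open>\<bar>c\<bar> + 1\<close> makes the
      constant positive whatever the value of \<open>c\<close>.\<close>
    proof (rule exI[of _ "432 * (1 + sqrt C_K) * (\<bar>c\<bar> + 1)"], intro conjI ballI allI impI)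
      show "0 < 432 * (1 + sqrt C_K) * (\<bar>c\<bar> + 1)"
        using C_K by (intro mult_pos_pos) (auto intro: add_pos_nonneg)
      fix h N P Q
      assume h: "h \<in> {0<..<h0}" and band: "is_band (\<T> h) N P Q"
        and len: "C_L * h powr (2 * \<alpha> / 5) \<le> band_length N P"
        and geo: "\<forall>i \<in> {1..N}.
            area (band_K' P Q i) \<le> C_K * area (band_K P Q i) \<and>
            area (band_K' P Q i) \<le> C_K * area (band_K P Q (i - 1)) \<and>
            sin (pi - band_angle P Q (i - 1)) \<le> C_\<alpha> * sin (pi - band_angle' P Q i)"
      interpret triangulated_domain \<Omega> "\<T> h"
        using assms(1) tri h by unfold_locales auto
      have ms: "mesh_size (\<T> h) = h" using tri h by auto
      obtain U where U: "is_discrete_solution \<Omega> (\<T> h) (\<lambda>x. x \<bullet> x) U" "U \<in> P1"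
        "\<And>x. x \<in> frontier \<Omega> \<Longrightarrow> \<bar>x \<bullet> x - U x\<bar> \<le> h\<^sup>2"
        "has_H1_seminorm \<Omega> (\<lambda>x. x \<bullet> x - U x) (sqrt (\<Sum>K\<in>\<T> h. element_error U K))"
        using discrete_solution_norm_square unfolding ms by blast
      have uc: "C (\<lambda>x. x \<bullet> x) = c" using c by (simp add: inner_self_2)
      define \<epsilon> where "\<epsilon> = c * h powr \<alpha>"
      have s: "sqrt (\<Sum>K\<in>\<T> h. element_error U K) \<le> \<epsilon>"
        using err[rule_format, OF norm_square_in_sobolev h U(1,4)] uc by (simp add: \<epsilon>_def)
      have E0: "0 \<le> (\<Sum>K\<in>\<T> h. element_error U K)" by (intro sum_nonneg element_error_nonneg)
      then have \<epsilon>0: "0 \<le> \<epsilon>" using s by (smt (verit) real_sqrt_ge_zero)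
      have E: "(\<Sum>K\<in>\<T> h. element_error U K) \<le> \<epsilon>\<^sup>2" using s by (rule sqrt_le_D)
      have h0: "0 < h" "h < h0" using h by auto
      have ha: "0 < h powr \<alpha>" using h0 by simp
      define k where "k = band_length N P / 3"
      have k_ge: "C_L / 3 * h powr (2 * \<alpha> / 5) \<le> k" using len by (simp add: k_def)
      have k0: "0 < k"
      proof -
        have "0 < C_L / 3 * h powr (2 * \<alpha> / 5)" using C_L(1) h0 by simp
        then show ?thesis using k_ge by linarith
      qed
      \<comment> \<open>The base line is straight, so its length is the distance of its end points,
        and both lie in the closed domain.\<close>
      have kD: "k \<le> D"
      proof -
        obtain d n \<tau> where b: "norm d = 1" "\<tau> 0 = 0" "\<And>i. i \<le> Suc N \<Longrightarrow> P i = P 0 + \<tau> i *\<^sub>R d"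
          "band_length N P = \<tau> (Suc N)"
          using band_coordinates[OF band] by metis
        have "band_K P Q 0 \<in> \<T> h" "band_K P Q N \<in> \<T> h" using band by (auto simp: is_band_def)
        moreover have "P 0 \<in> band_K P Q 0" "P (Suc N) \<in> band_K P Q N"
          unfolding band_K_def by (auto intro: hull_inc)
        ultimately have "norm (P (Suc N) - P 0) \<le> D" using element(4) by (intro D) blast+
        then have "band_length N P \<le> D" using b(1,4) b(3)[of "Suc N"] by simp
        then show ?thesis using k0 by (simp add: k_def)
      qed
      have h2: "h\<^sup>2 \<le> h0 powr (2 - \<alpha>) * h powr \<alpha>"
      proof -
        have "h\<^sup>2 = h powr (2 - \<alpha>) * h powr \<alpha>"
          using h0 by (simp add: powr_add[symmetric])
        also have "\<dots> \<le> h0 powr (2 - \<alpha>) * h powr \<alpha>"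
          using h0 assms(4) by (intro mult_right_mono powr_mono2) auto
        finally show ?thesis .
      qed
      have big: "4 * h\<^sup>2 * k + 4 * (\<epsilon> * sqrt (3 * k * D)) < k ^ 3"
      proof -
        have sk: "sqrt k \<le> sqrt D" "0 < sqrt k" "k = sqrt k * sqrt k" using kD k0 by auto
        have "4 * h\<^sup>2 * k + 4 * (\<epsilon> * sqrt (3 * k * D)) = sqrt k * (4 * h\<^sup>2 * sqrt k + 4 * (\<epsilon> * sqrt (3 * D)))"
        proof -
          have "sqrt (3 * k * D) = sqrt k * sqrt (3 * D)" by (simp add: real_sqrt_mult)
          moreover have "4 * h\<^sup>2 * k = sqrt k * (4 * h\<^sup>2 * sqrt k)" by (subst sk(3)) simp
          ultimately show ?thesis by (simp add: algebra_simps)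
        qed
        also have "\<dots> \<le> sqrt k * (\<Theta> * h powr \<alpha>)"
        proof (rule mult_left_mono)
          have "h\<^sup>2 * sqrt k \<le> (h0 powr (2 - \<alpha>) * h powr \<alpha>) * sqrt D"
            using h2 sk(1) k0 by (intro mult_mono) auto
          moreover have "\<epsilon> * sqrt (3 * D) \<le> (\<bar>c\<bar> * h powr \<alpha>) * sqrt (3 * D)"
            unfolding \<epsilon>_def using ha D0 by (intro mult_right_mono) auto
          ultimately show "4 * h\<^sup>2 * sqrt k + 4 * (\<epsilon> * sqrt (3 * D)) \<le> \<Theta> * h powr \<alpha>"
            by (simp add: \<Theta>_def algebra_simps)
        qed (use sk in simp)
        \<comment> \<open>Raising the lower bound for \<open>k\<close> to the power 5/2 turns
          \<open>h powr (2 * \<alpha> / 5)\<close> into \<open>h powr \<alpha>\<close>, the order of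
          the error terms.\<close>
        also have "\<dots> < sqrt k * k powr (5 / 2)"
        proof (rule mult_strict_left_mono[OF _ sk(2)])
          have "\<Theta> = (\<Theta> powr (2 / 5)) powr (5 / 2)" using \<Theta>0 by (simp add: powr_powr)
          also have "\<dots> < (C_L / 3) powr (5 / 2)" using C_L by (intro powr_less_mono2) auto
          finally have "\<Theta> * h powr \<alpha> < (C_L / 3) powr (5 / 2) * h powr \<alpha>" using ha by simp
          also have "\<dots> = (C_L / 3 * h powr (2 * \<alpha> / 5)) powr (5 / 2)"
          proof -
            have "(C_L / 3 * h powr (2 * \<alpha> / 5)) powr (5 / 2)
                = (C_L / 3) powr (5 / 2) * (h powr (2 * \<alpha> / 5)) powr (5 / 2)"
              by (rule powr_mult)
            then show ?thesis by (simp only: powr_powr) simp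
          qed
          also have "\<dots> \<le> k powr (5 / 2)" using k_ge C_L(1) by (intro powr_mono2) auto
          finally show "\<Theta> * h powr \<alpha> < k powr (5 / 2)" .
        qed
        also have "\<dots> = k ^ 3"
          using k0 by (simp add: powr_half_sqrt[symmetric] powr_add[symmetric] powr_numeral)
        finally show ?thesis .
      qed
      have "(MIN i\<in>{1..N}. 1 / sin (pi - band_angle' P Q i)) *
           (MIN i\<in>{1..N}. sqrt (area (band_K' P Q i))) *
           band_length N P * real N powr (- 1 / 2) \<le> 432 * (1 + sqrt C_K) * \<epsilon>"
        using geo by (intro band_estimate[OF band U(2,3) _ D E \<epsilon>0 C_K _ k_def big]) auto
      also have "\<dots> \<le> 432 * (1 + sqrt C_K) * ((\<bar>c\<bar> + 1) * h powr \<alpha>)"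
        unfolding \<epsilon>_def using C_K ha by (intro mult_left_mono mult_right_mono) auto
      finally show "(MIN i\<in>{1..N}. 1 / sin (pi - band_angle' P Q i)) *
           (MIN i\<in>{1..N}. sqrt (area (band_K' P Q i))) *
           band_length N P * real N powr (- 1 / 2) \<le> 432 * (1 + sqrt C_K) * (\<bar>c\<bar> + 1) * h powr \<alpha>"
        by (simp only: mult.assoc)
    qed
  qed
qed

end
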